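(* Let $l\ge1$ and let $\mathbf{s}=(s_0,\dots,s_{l-1})\in\mathcal{T}_{l,\infty}$, i.e. $s_0\le\dots\le s_{l-1}$. As a $\mathcal{U}_q(\mathfrak{sl}_\infty)$-module, the Fock space $\mathcal{F}_{\mathbf{s},\infty}$ decomposes as $$\mathcal{F}_{\mathbf{s},\infty}\simeq\bigoplus_{\mathbf{v}\in\mathcal{T}_{l,\infty}}V_\infty(\mathbf{v})^{\oplus K_{\lambda(\mathbf{v}),\mu(\mathbf{v})}}.$$
   Context: **Fock space.** An $l$-partition is $\boldsymbol{\lambda}=(\lambda^0,\dots,\lambda^{l-1})$, each $\lambda^c$ a partition. $\mathcal{F}_{\mathbf{s}}$ is the $\mathbb{Q}(q)$-vector space with basis all $l$-partitions. A node $(a,b,c)$ (row $a$, column $b$ of $\lambda^c$) has content $b-a+s_c$; for $j\in\mathbb{Z}$ a $j$-node is a node of content $j$. A node is removable (resp. addable) if removing (resp. adding) it gives an $l$-partition. Addable/removable $j$-nodes are ordered by $(a,b,c)\prec_{\mathbf{s}}(a',b',c')$ iff $c>c'$. $\mathcal{F}_{\mathbf{s},\infty}$ denotes $\mathcal{F}_{\mathbf{s}}$ with the standard (Jimbo–Misra–Miwa–Okado/Uglov) action of $\mathcal{U}_q(\mathfrak{sl}_\infty)$ (Chevalley generators $e_j,f_j,t_j^{\pm1}$, $j\in\mathbb{Z}$): $$f_j\boldsymbol{\lambda}=\sum_{\boldsymbol{\mu}}q^{N_j^{\succ}(\boldsymbol{\lambda},\boldsymbol{\mu})}\boldsymbol{\mu},\quad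 e_j\boldsymbol{\mu}=\sum_{\boldsymbol{\lambda}}q^{-N_j^{\prec}(\boldsymbol{\lambda},\boldsymbol{\mu})}\boldsymbol{\lambda},\quad t_j\boldsymbol{\lambda}=q^{N_j(\boldsymbol{\lambda})}\boldsymbol{\lambda},$$ sums over pairs with $\boldsymbol{\mu}$ obtained from $\boldsymbol{\lambda}$ by adding a $j$-node $\gamma$, where $N_j^{\succ}$ (resp. $N_j^{\prec}$) is the number of addable $j$-nodes of $\boldsymbol{\lambda}$ that are $\succ_{\mathbf{s}}\gamma$ (resp. $\prec_{\mathbf{s}}\gamma$) minus the number of removable $j$-nodes of $\boldsymbol{\lambda}$ that are $\succ_{\mathbf{s}}\gamma$ (resp. $\prec_{\mathbf{s}}\gamma$), and $N_j(\boldsymbol{\lambda})$ is the number of addable $j$-nodes minus the number of removable $j$-nodes. $\mathcal{T}_{l,\infty}=\{\mathbf{t}\in\mathbb{Z}^l\mid t_0\le\dots\le t_{l-1}\}$. For $\mathbf{v}\in\mathcal{T}_{l,\infty}$, $V_\infty(\mathbf{v})$ is the irreducible highest weight $\mathcal{U}_q(\mathfrak{sl}_\infty)$-module of highest weight $\Lambda_{\mathbf{v},\infty}=\sum_{c=0}^{l-1}\Lambda_{v_c,\infty}$ ($\Lambda_{j,\infty}$, $j\in\mathbb{Z}$, the fundamental weights); it is realized as the submodule of $\mathcal{F}_{\mathbf{v},\infty}$ generated by the empty $l$-partition. **Multiplicities.** For $\mathbf{v}\in\mathcal{T}_{l,\infty}$ let $\lambda$ be the Young diagram with row lengths $v_c-v_0$,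 $c=l-1,\dots,0$ from top to bottom, and $\lambda(\mathbf{v})=\lambda^*$ its conjugate diagram. Let $\mu(\mathbf{v})=(\mu_0,\dots,\mu_{l-1})$ with $\mu_c=s_c-v_0$. In this paper a tableau of ordinary shape is a filling of a Young diagram in which rows are strictly increasing from left to right and columns are weakly increasing from top to bottom. $K_{\lambda(\mathbf{v}),\mu(\mathbf{v})}$ is the number of such tableaux of shape $\lambda(\mathbf{v})$ with entries in $\{1,\dots,l\}$ in which the letter $c+1$ occurs exactly $\mu_c$ times for $c=0,\dots,l-1$ (so it is $0$ if some $\mu_c<0$ or if the sizes disagree). *)

theory Defs
  imports
    "HOL-Computational_Algebra.Fraction_Field"
    "HOL-Computational_Algebra.Polynomial"
    "HOL-Library.Poly_Mapping"
    "HOL-Library.FuncSet"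
begin

section \<open>Modules over the quantum group of type A infinity\<close>

text \<open>The ground field is the field of rational functions in one variable over the rationals.\<close>

type_synonym ratfun = "rat poly fract"

definition qq :: ratfun where
  "qq = Fraction_Field.Fract [:0, 1:] 1"

text \<open>
  A representation is a subspace \<open>uq_carrier\<close> of an ambient vector space (scalar multiplication
  \<open>uq_scale\<close>) together with the actions of the Chevalley generators, indexed by the integers;
  \<open>uq_tinv j\<close> is the action of the inverse of \<open>t\<^sub>j\<close>. What the operations do outside
  \<open>uq_carrier\<close> is irrelevant.
\<close>

record 'v uq_rep =
  uq_carrier :: "'v set"
  uq_scale :: "ratfun \<Rightarrow> 'v \<Rightarrow> 'v"
  uq_e :: "int \<Rightarrow> 'v \<Rightarrow> 'v"
  uq_f :: "int \<Rightarrow> 'v \<Rightarrow> 'v"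
  uq_t :: "int \<Rightarrow> 'v \<Rightarrow> 'v"
  uq_tinv :: "int \<Rightarrow> 'v \<Rightarrow> 'v"

definition linear_between ::
    "'v::ab_group_add set \<Rightarrow> (ratfun \<Rightarrow> 'v \<Rightarrow> 'v) \<Rightarrow> (ratfun \<Rightarrow> 'w \<Rightarrow> 'w)
      \<Rightarrow> ('v \<Rightarrow> 'w::ab_group_add) \<Rightarrow> bool" where
  "linear_between C sc sc' \<phi> \<longleftrightarrow>
     (\<forall>x\<in>C. \<forall>y\<in>C. \<phi> (x + y) = \<phi> x + \<phi> y) \<and> (\<forall>a. \<forall>x\<in>C. \<phi> (sc a x) = sc' a (\<phi> x))"

definition uq_submodule :: "'v::ab_group_add uq_rep \<Rightarrow> 'v set \<Rightarrow> bool" where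
  "uq_submodule M U \<longleftrightarrow>
     U \<subseteq> uq_carrier M \<and> module.subspace (uq_scale M) U \<and>
     (\<forall>j. \<forall>x\<in>U. uq_e M j x \<in> U \<and> uq_f M j x \<in> U \<and> uq_t M j x \<in> U \<and> uq_tinv M j x \<in> U)"

definition cartan :: "int \<Rightarrow> int \<Rightarrow> int" where
  "cartan i j = (if i = j then 2 else if \<bar>i - j\<bar> = 1 then -1 else 0)"

locale uq_module =
  fixes M :: "'v::ab_group_add uq_rep"
  assumes vector_space: "vector_space (uq_scale M)"
    and closed: "uq_submodule M (uq_carrier M)"
    and linear:
      "linear_between (uq_carrier M) (uq_scale M) (uq_scale M) (uq_e M j)"
      "linear_between (uq_carrier M) (uq_scale M) (uq_scale M) (uq_f M j)"
      "linear_between (uq_carrier M) (uq_scale M) (uq_scale M) (uq_t M j)"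
      "linear_between (uq_carrier M) (uq_scale M) (uq_scale M) (uq_tinv M j)"
    and t_inverse:
      "x \<in> uq_carrier M \<Longrightarrow> uq_t M j (uq_tinv M j x) = x"
      "x \<in> uq_carrier M \<Longrightarrow> uq_tinv M j (uq_t M j x) = x"
    and t_t: "x \<in> uq_carrier M \<Longrightarrow> uq_t M i (uq_t M j x) = uq_t M j (uq_t M i x)"
    and t_e: "x \<in> uq_carrier M \<Longrightarrow>
      uq_t M i (uq_e M j (uq_tinv M i x)) = uq_scale M (qq powi cartan i j) (uq_e M j x)"
    and t_f: "x \<in> uq_carrier M \<Longrightarrow>
      uq_t M i (uq_f M j (uq_tinv M i x)) = uq_scale M (qq powi (- cartan i j)) (uq_f M j x)"
    and e_f: "x \<in> uq_carrier M \<Longrightarrow>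
      uq_e M i (uq_f M j x) - uq_f M j (uq_e M i x) =
        (if i = j then uq_scale M (1 / (qq - inverse qq)) (uq_t M i x - uq_tinv M i x) else 0)"
    and serre_far:
      "x \<in> uq_carrier M \<Longrightarrow> \<bar>i - j\<bar> > 1 \<Longrightarrow> uq_e M i (uq_e M j x) = uq_e M j (uq_e M i x)"
      "x \<in> uq_carrier M \<Longrightarrow> \<bar>i - j\<bar> > 1 \<Longrightarrow> uq_f M i (uq_f M j x) = uq_f M j (uq_f M i x)"
    and serre_near:
      "x \<in> uq_carrier M \<Longrightarrow> \<bar>i - j\<bar> = 1 \<Longrightarrow>
        uq_e M i (uq_e M i (uq_e M j x))
        - uq_scale M (qq + inverse qq) (uq_e M i (uq_e M j (uq_e M i x)))
        + uq_e M j (uq_e M i (uq_e M i x)) = 0"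
      "x \<in> uq_carrier M \<Longrightarrow> \<bar>i - j\<bar> = 1 \<Longrightarrow>
        uq_f M i (uq_f M i (uq_f M j x))
        - uq_scale M (qq + inverse qq) (uq_f M i (uq_f M j (uq_f M i x)))
        + uq_f M j (uq_f M i (uq_f M i x)) = 0"

definition uq_isomorphic ::
    "'v::ab_group_add uq_rep \<Rightarrow> 'w::ab_group_add uq_rep \<Rightarrow> bool" where
  "uq_isomorphic M N \<longleftrightarrow>
     uq_module M \<and> uq_module N \<and>
     (\<exists>\<phi>. bij_betw \<phi> (uq_carrier M) (uq_carrier N) \<and>
        linear_between (uq_carrier M) (uq_scale M) (uq_scale N) \<phi> \<and>
        (\<forall>j. \<forall>x\<in>uq_carrier M.
           \<phi> (uq_e M j x) = uq_e N j (\<phi> x) \<and> \<phi> (uq_f M j x) = uq_f N j (\<phi> x) \<and>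
           \<phi> (uq_t M j x) = uq_t N j (\<phi> x) \<and> \<phi> (uq_tinv M j x) = uq_tinv N j (\<phi> x)))"

definition uq_direct_sum ::
    "'i set \<Rightarrow> ('i \<Rightarrow> 'v::ab_group_add uq_rep) \<Rightarrow> ('i \<Rightarrow>\<^sub>0 'v) uq_rep" where
  "uq_direct_sum I M =
     \<lparr> uq_carrier = {x. Poly_Mapping.keys x \<subseteq> I \<and>
                        (\<forall>i\<in>I. Poly_Mapping.lookup x i \<in> uq_carrier (M i))},
       uq_scale = (\<lambda>a. Poly_Mapping.mapp (\<lambda>i. uq_scale (M i) a)),
       uq_e = (\<lambda>j. Poly_Mapping.mapp (\<lambda>i. uq_e (M i) j)),
       uq_f = (\<lambda>j. Poly_Mapping.mapp (\<lambda>i. uq_f (M i) j)),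
       uq_t = (\<lambda>j. Poly_Mapping.mapp (\<lambda>i. uq_t (M i) j)),
       uq_tinv = (\<lambda>j. Poly_Mapping.mapp (\<lambda>i. uq_tinv (M i) j)) \<rparr>"

definition uq_generated :: "'v::ab_group_add uq_rep \<Rightarrow> 'v set \<Rightarrow> 'v set" where
  "uq_generated M X = \<Inter>{U. uq_submodule M U \<and> X \<subseteq> U}"

text \<open>
  A weight is represented by its values on the simple coroots, so that \<open>t\<^sub>j\<close> acts on a vector of
  weight \<open>\<Lambda>\<close> as multiplication by the \<open>\<Lambda> j\<close>-th power of \<open>qq\<close>.
\<close>

definition fund_weight :: "int \<Rightarrow> int \<Rightarrow> int" where
  "fund_weight i j = (if i = j then 1 else 0)"

definition Lambda_weight :: "int list \<Rightarrow> int \<Rightarrow> int" where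
  "Lambda_weight v j = (\<Sum>c<length v. fund_weight (v ! c) j)"

definition irreducible_highest_weight ::
    "'v::ab_group_add uq_rep \<Rightarrow> (int \<Rightarrow> int) \<Rightarrow> bool" where
  "irreducible_highest_weight M \<Lambda> \<longleftrightarrow>
     uq_module M \<and>
     (\<exists>x\<in>uq_carrier M. x \<noteq> 0 \<and> (\<forall>j. uq_e M j x = 0) \<and>
        (\<forall>j. uq_t M j x = uq_scale M (qq powi \<Lambda> j) x) \<and>
        uq_generated M {x} = uq_carrier M) \<and>
     (\<forall>U. uq_submodule M U \<longrightarrow> U = {0} \<or> U = uq_carrier M)"


section \<open>Multipartitions\<close>

text \<open>
  A partition is the weakly decreasing list of its (positive) parts. Rows, columns and components
  are all counted from 0; this does not affect the differences \<open>b - a\<close> in the contents.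
\<close>

definition partitions :: "nat list set" where
  "partitions = {p. sorted_wrt (\<ge>) p \<and> 0 \<notin> set p}"

definition young_diagram :: "nat list \<Rightarrow> (nat \<times> nat) set" where
  "young_diagram p = {(a, b). a < length p \<and> b < p ! a}"

definition multipartitions :: "nat \<Rightarrow> nat list list set" where
  "multipartitions l = {la. length la = l \<and> set la \<subseteq> partitions}"

type_synonym node = "nat \<times> nat \<times> nat"

definition nodes :: "nat list list \<Rightarrow> node set" where
  "nodes la = {(a, b, c). c < length la \<and> (a, b) \<in> young_diagram (la ! c)}"

fun content :: "int list \<Rightarrow> node \<Rightarrow> int" where
  "content s (a, b, c) = int b - int a + s ! c"

text \<open>\<open>adds_node l la \<gamma> mu\<close>: the \<open>l\<close>-partition \<open>mu\<close> arises from \<open>la\<close> by adding the node \<open>\<gamma>\<close>.\<close>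

definition adds_node :: "nat \<Rightarrow> nat list list \<Rightarrow> node \<Rightarrow> nat list list \<Rightarrow> bool" where
  "adds_node l la \<gamma> mu \<longleftrightarrow>
     la \<in> multipartitions l \<and> mu \<in> multipartitions l \<and>
     \<gamma> \<notin> nodes la \<and> nodes mu = insert \<gamma> (nodes la)"

definition addable :: "nat \<Rightarrow> int list \<Rightarrow> int \<Rightarrow> nat list list \<Rightarrow> node set" where
  "addable l s j la = {\<gamma>. content s \<gamma> = j \<and> (\<exists>mu. adds_node l la \<gamma> mu)}"

definition removable :: "nat \<Rightarrow> int list \<Rightarrow> int \<Rightarrow> nat list list \<Rightarrow> node set" where
  "removable l s j la = {\<gamma>. content s \<gamma> = j \<and> (\<exists>ka. adds_node l ka \<gamma> la)}"

fun node_less :: "node \<Rightarrow> node \<Rightarrow> bool" where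
  "node_less (a, b, c) (a', b', c') \<longleftrightarrow> c > c'"


section \<open>Fock spaces\<close>

definition N_succ :: "nat \<Rightarrow> int list \<Rightarrow> int \<Rightarrow> nat list list \<Rightarrow> node \<Rightarrow> int" where
  "N_succ l s j la \<gamma> =
     int (card {\<delta> \<in> addable l s j la. node_less \<gamma> \<delta>})
     - int (card {\<delta> \<in> removable l s j la. node_less \<gamma> \<delta>})"

definition N_prec :: "nat \<Rightarrow> int list \<Rightarrow> int \<Rightarrow> nat list list \<Rightarrow> node \<Rightarrow> int" where
  "N_prec l s j la \<gamma> =
     int (card {\<delta> \<in> addable l s j la. node_less \<delta> \<gamma>})
     - int (card {\<delta> \<in> removable l s j la. node_less \<delta> \<gamma>})"

definition N_total :: "nat \<Rightarrow> int list \<Rightarrow> int \<Rightarrow> nat list list \<Rightarrow> int" where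
  "N_total l s j la = int (card (addable l s j la)) - int (card (removable l s j la))"

text \<open>
  Vectors of the Fock space are finitely supported coefficient functions with support in the set of
  \<open>l\<close>-partitions, \<open>single la 1\<close> being the basis vector labelled by \<open>la\<close>.
\<close>

type_synonym fock = "nat list list \<Rightarrow>\<^sub>0 ratfun"

definition fock_scale :: "ratfun \<Rightarrow> fock \<Rightarrow> fock" where
  "fock_scale a = Poly_Mapping.map (\<lambda>b. a * b)"

definition linear_extension :: "(nat list list \<Rightarrow> fock) \<Rightarrow> fock \<Rightarrow> fock" where
  "linear_extension g x =
     (\<Sum>la\<in>Poly_Mapping.keys x. fock_scale (Poly_Mapping.lookup x la) (g la))"

definition Fock :: "nat \<Rightarrow> int list \<Rightarrow> fock uq_rep" where
  "Fock l s =
     \<lparr> uq_carrier = {x. Poly_Mapping.keys x \<subseteq> multipartitions l},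
       uq_scale = fock_scale,
       uq_e = (\<lambda>j. linear_extension (\<lambda>mu.
         \<Sum>(la, \<gamma>) \<in> {(la, \<gamma>). adds_node l la \<gamma> mu \<and> content s \<gamma> = j}.
           Poly_Mapping.single la (qq powi (- N_prec l s j la \<gamma>)))),
       uq_f = (\<lambda>j. linear_extension (\<lambda>la.
         \<Sum>(mu, \<gamma>) \<in> {(mu, \<gamma>). adds_node l la \<gamma> mu \<and> content s \<gamma> = j}.
           Poly_Mapping.single mu (qq powi N_succ l s j la \<gamma>))),
       uq_t = (\<lambda>j. linear_extension (\<lambda>la. Poly_Mapping.single la (qq powi N_total l s j la))),
       uq_tinv = (\<lambda>j. linear_extension
         (\<lambda>la. Poly_Mapping.single la (qq powi (- N_total l s j la)))) \<rparr>"

definition multicharges :: "nat \<Rightarrow> int list set" where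
  "multicharges l = {t. length t = l \<and> sorted t}"

text \<open>
  The irreducible highest weight module of weight \<open>Lambda_weight v\<close>, realized inside the Fock space.
\<close>

definition V_infty :: "nat \<Rightarrow> int list \<Rightarrow> fock uq_rep" where
  "V_infty l v = (Fock l v)
     \<lparr> uq_carrier := uq_generated (Fock l v) {Poly_Mapping.single (replicate l []) 1} \<rparr>"


section \<open>Multiplicities\<close>

text \<open>For \<open>v\<close> sorted, \<open>nat\<close> below is applied to nonnegative integers only.\<close>

definition lambda_shape :: "int list \<Rightarrow> (nat \<times> nat) set" where
  "lambda_shape v = prod.swap ` young_diagram (map (\<lambda>x. nat (x - v ! 0)) (rev v))"

text \<open>Note the convention: rows are strictly, columns weakly increasing.\<close>

definition tableaux :: "(nat \<times> nat) set \<Rightarrow> nat \<Rightarrow> (nat \<times> nat \<Rightarrow> nat) set" where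
  "tableaux D l = {T \<in> D \<rightarrow>\<^sub>E {1..l}.
     (\<forall>a b b'. (a, b) \<in> D \<and> (a, b') \<in> D \<and> b < b' \<longrightarrow> T (a, b) < T (a, b')) \<and>
     (\<forall>a a' b. (a, b) \<in> D \<and> (a', b) \<in> D \<and> a < a' \<longrightarrow> T (a, b) \<le> T (a', b))}"

definition K_mult :: "nat \<Rightarrow> int list \<Rightarrow> int list \<Rightarrow> nat" where
  "K_mult l s v = card {T \<in> tableaux (lambda_shape v) l.
     \<forall>c<l. int (card {x \<in> lambda_shape v. T x = c + 1}) = s ! c - v ! 0}"

end

theory Submission
  imports Defs
begin

text \<open>
  The Fock space has an orthonormal basis of \<open>l\<close>-partitions, and for this form the adjoint of
  \<open>f\<^sub>j\<close> is \<open>q\<^sup>-\<^sup>1 t\<^sub>j e\<^sub>j\<close>. The field \<open>\<rat>(q)\<close> can be ordered so that \<open>q > 1\<close>, so the form is positive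
  definite. Most of the representation theory follows from this single fact, without any structure
  theory of the quantum group. Call a vector singular if all \<open>e\<^sub>j\<close> kill it.

  \<^item> A singular vector is orthogonal to all \<open>f\<^sub>j x\<close>. So a singular vector which is also a sum of such
    vectors is zero. This yields the Serre relations (\<open>commuting_operator_zero\<close>) and the irreducibility
    of the submodule generated by a singular vector \<open>x\<close> (\<open>irreducible_range_ev\<close>).
  \<^item> The inner products of the vectors \<open>f\<^sub>w x\<close>, where \<open>w\<close> is a word in the indices, depend only on the
    weight of \<open>x\<close> and, by a common factor, on its norm (\<open>ip_fw\<close>). So singular vectors of the same weight
    generate isomorphic submodules, whatever Fock spaces they lie in.
  \<^item> A submodule that contains all singular vectors is the whole space
    (\<open>submodule_with_all_singular\<close>).

  Hence a basis of the singular vectors that consists of weight vectors gives a decomposition into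
  irreducible modules (\<open>decomposition_from_singular_basis\<close>). It remains to find such a basis and to count
  it. Describe an \<open>l\<close>-partition by \<open>l\<close> sets of integers, the positions of its beads; then \<open>f\<^sub>j\<close> moves a
  bead from position \<open>j\<close> to \<open>j + 1\<close>. Order these configurations, comparing the last components first.

  \<^item> In the largest configuration of a singular vector, the first \<open>k\<close> components together have, for every
    \<open>k \<le> l\<close>, at most as many beads in position \<open>p + 1\<close> as in position \<open>p\<close>. For \<open>k = l\<close> this holds because
    the weight of a singular vector is dominant, by positivity of norms; smaller \<open>k\<close> are reduced to this
    case by restricting the vector to its part with the same last components
    (\<open>dominant_of_maximal\<close>). Such configurations are called dominant.
  \<^item> Every dominant configuration is the largest one of some singular vector
    (\<open>singular_vector_with_leading_term\<close>). This vector is made from the empty \<open>l\<close>-partition, with other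
    charges, by operators that move beads between neighbouring components. They commute with all \<open>e\<^sub>j\<close>
    (\<open>FE_commutes_e_single\<close>); they belong to the commuting action of a quantum group of type \<open>gl\<^sub>l\<close>
    on the sum of the Fock spaces of all charges (skew Howe duality).

  So singular vectors have a basis indexed by dominant configurations. Listing the components
  with a bead in position \<open>v\<^sub>0 + 1\<close>, \<open>v\<^sub>0 + 2\<close>, and so on as the rows of a tableau identifies the dominant
  configurations of weight \<open>\<Lambda>\<^sub>v\<close> with the tableaux that \<open>K_mult\<close> counts (\<open>leading_tableaux_bij\<close>).
\<close>

abbreviation "keys \<equiv> Poly_Mapping.keys"
abbreviation "lookup \<equiv> Poly_Mapping.lookup"
abbreviation "single \<equiv> Poly_Mapping.single"

section \<open>The ground field as an ordered field\<close>

text \<open>A polynomial is positive if its leading coefficient is; so \<open>q\<close> is larger than all constants.\<close>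

lemma qq_gt_1: "qq > 1"
proof -
  have "[:0, 1:] > (1::rat poly)"
    unfolding less_poly_def pos_poly_def by (simp add: one_pCons)
  then have "Fraction_Field.Fract 1 1 < qq" unfolding qq_def by (subst less_fract) auto
  then show ?thesis by (simp add: One_fract_def)
qed

lemma qq_pos: "qq > 0" and qq_neq_0 [simp]: "qq \<noteq> 0"
  using qq_gt_1 by auto

lemma qq_powi_pos: "qq powi n > 0"
  using qq_pos by (rule zero_less_power_int)

lemma qq_powi_neq_0 [simp]: "qq powi n \<noteq> 0"
  using qq_powi_pos[of n] by simp

lemma qq_diff_pos: "qq - inverse qq > 0"
  using qq_gt_1 inverse_less_1_iff[of qq] by (smt (verit) diff_gt_0_iff_gt less_trans)

lemma qq_diff_neq_0 [simp]: "qq - inverse qq \<noteq> 0"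
  using qq_diff_pos by auto

text \<open>The quantum integer, usually written \<open>[n]\<close>.\<close>

definition qint :: "int \<Rightarrow> ratfun" where
  "qint n = (qq powi n - qq powi (- n)) / (qq - inverse qq)"

lemma qint_0 [simp]: "qint 0 = 0" and qint_1 [simp]: "qint 1 = 1" and qint_m1: "qint (- 1) = - 1"
proof -
  have "qint (- 1) = - (qq - inverse qq) / (qq - inverse qq)" by (simp add: qint_def power_int_minus)
  then show "qint (- 1) = - 1" by (simp only: minus_divide_left[symmetric] divide_self[OF qq_diff_neq_0])
  show "qint 1 = 1" using divide_self[OF qq_diff_neq_0] by (simp add: qint_def power_int_minus)
qed (simp_all add: qint_def)

lemma qint_neg: "n < 0 \<Longrightarrow> qint n < 0"
proof -
  assume "n < 0"
  then have "qq powi n < qq powi (- n)"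
    using qq_gt_1 by (intro power_int_strict_increasing) auto
  then show ?thesis unfolding qint_def using qq_diff_pos by (simp add: divide_less_0_iff)
qed

lemma qint_recurrence: "qint (n - 1) + qint (n + 1) = (qq + inverse qq) * qint n"
proof -
  have a: "qq powi (n - 1) + qq powi (n + 1) = (qq + inverse qq) * qq powi n" for n
    by (simp add: power_int_add power_int_diff field_simps)
  have "qint (n - 1) + qint (n + 1)
    = ((qq powi (n - 1) + qq powi (n + 1)) - (qq powi (- n - 1) + qq powi (- n + 1)))
        / (qq - inverse qq)"
  proof -
    have e: "- (n - 1) = - n + 1" "- (n + 1) = - n - 1" by auto
    show ?thesis unfolding qint_def add_divide_distrib[symmetric] e
      by (simp only: add_diff_add add.commute[of "qq powi (- n - 1)"])
  qed
  also have "(qq powi (n - 1) + qq powi (n + 1)) - (qq powi (- n - 1) + qq powi (- n + 1))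
      = (qq + inverse qq) * (qq powi n - qq powi (- n))"
    by (simp only: a right_diff_distrib)
  finally show ?thesis by (simp add: qint_def)
qed

lemma qint_add: "qint (m + n) = qint m * qq powi n + qq powi (- m) * qint n"
proof -
  have "(qq powi (m + n) - qq powi (- (m + n)))
    = (qq powi m - qq powi (- m)) * qq powi n + qq powi (- m) * (qq powi n - qq powi (- n))"
    using power_int_add[of qq m n] power_int_add[of qq "- m" "- n"] by (simp add: algebra_simps)
  then show ?thesis unfolding qint_def by (simp add: add_divide_distrib)
qed

section \<open>Free vector spaces and their standard bilinear form\<close>

definition sc :: "ratfun \<Rightarrow> ('b \<Rightarrow>\<^sub>0 ratfun) \<Rightarrow> ('b \<Rightarrow>\<^sub>0 ratfun)" where
  "sc a = Poly_Mapping.map (\<lambda>b. a * b)"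

lemma lookup_sc [simp]: "lookup (sc a x) b = a * lookup x b"
  unfolding sc_def by (simp add: Poly_Mapping.map.rep_eq when_def)

lemma sc_simps [simp]: "sc a 0 = 0" "sc 0 x = 0" "sc 1 x = x" "sc a (sc b x) = sc (a * b) x"
  "sc a (single k b) = single k (a * b)"
  by (auto intro!: poly_mapping_eqI simp: lookup_single when_def)

lemma sc_add: "sc a (x + y) = sc a x + sc a y" and sc_add_left: "sc (a + b) x = sc a x + sc b x"
  and sc_diff: "sc a (x - y) = sc a x - sc a y" and sc_minus_left: "sc (- a) x = - sc a x"

  by (auto intro!: poly_mapping_eqI simp: lookup_add lookup_minus algebra_simps)

lemma vector_space_sc: "vector_space sc"
  by unfold_locales (auto simp: sc_add sc_add_left)

lemma sc_sum: "sc a (sum h A) = (\<Sum>i\<in>A. sc a (h i))"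
  by (induction A rule: infinite_finite_induct) (auto simp: sc_add)

lemma keys_sc: "keys (sc a x) \<subseteq> keys x"
  by (auto simp: in_keys_iff)

definition lin :: "(('a \<Rightarrow>\<^sub>0 ratfun) \<Rightarrow> ('b \<Rightarrow>\<^sub>0 ratfun)) \<Rightarrow> bool" where
  "lin T \<longleftrightarrow> (\<forall>x y. T (x + y) = T x + T y) \<and> (\<forall>a x. T (sc a x) = sc a (T x))"

lemma lin_add: "lin T \<Longrightarrow> T (x + y) = T x + T y"
  and lin_sc: "lin T \<Longrightarrow> T (sc a x) = sc a (T x)"
  by (auto simp: lin_def)

lemma lin_zero: "lin T \<Longrightarrow> T 0 = 0"
  using lin_sc[of T 0 0] by simp

lemma lin_uminus: "lin T \<Longrightarrow> T (- x) = - T x"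
  using lin_sc[of T "- 1" x] by (simp add: sc_minus_left)

lemma lin_diff: "lin T \<Longrightarrow> T (x - y) = T x - T y"
  using lin_add[of T x "- y"] by (simp add: lin_uminus)

lemma lin_sum: "lin T \<Longrightarrow> T (sum h A) = (\<Sum>i\<in>A. T (h i))"
  by (induction A rule: infinite_finite_induct) (auto simp: lin_add lin_zero)

lemma lin_compose: "lin T \<Longrightarrow> lin S \<Longrightarrow> lin (\<lambda>x. T (S x))"
  by (auto simp: lin_def)

lemma lin_id: "lin (\<lambda>x. x)"
  and lin_sc_op: "lin (\<lambda>x. sc a x)"

  and lin_minus: "lin T \<Longrightarrow> lin S \<Longrightarrow> lin (\<lambda>x. T x - S x)"
  and lin_const_0: "lin (\<lambda>x. 0)"
  by (auto simp: lin_def sc_add sc_diff mult.commute)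

definition lext :: "('a \<Rightarrow> ('b \<Rightarrow>\<^sub>0 ratfun)) \<Rightarrow> ('a \<Rightarrow>\<^sub>0 ratfun) \<Rightarrow> ('b \<Rightarrow>\<^sub>0 ratfun)" where
  "lext g x = (\<Sum>a\<in>keys x. sc (lookup x a) (g a))"

lemma lext_superset: "finite A \<Longrightarrow> keys x \<subseteq> A \<Longrightarrow> lext g x = (\<Sum>a\<in>A. sc (lookup x a) (g a))"
  unfolding lext_def by (rule sum.mono_neutral_left) (auto simp: in_keys_iff)

lemma lin_lext: "lin (lext g)"
  unfolding lin_def
proof (intro conjI allI)
  fix x y :: "'a \<Rightarrow>\<^sub>0 ratfun" and a
  have fin: "finite (keys x \<union> keys y)" by simp
  show "lext g (x + y) = lext g x + lext g y"
    using lext_superset[OF fin, of x g] lext_superset[OF fin, of y g]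
      lext_superset[OF fin, of "x + y" g] keys_add[of x y]
    by (simp add: lookup_add sc_add_left sum.distrib)
  show "lext g (sc a x) = sc a (lext g x)"
    using lext_superset[of "keys x" "sc a x" g] keys_sc[of a x]
    by (simp add: lext_def sc_sum)
qed

lemma lext_single [simp]: "lext g (single a c) = sc c (g a)"
  by (simp add: lext_def)

lemma lext_singles: "lext (\<lambda>a. single a 1) x = x"
proof (rule poly_mapping_eqI)
  fix k
  have "lookup (lext (\<lambda>a. single a 1) x) k = (\<Sum>a\<in>keys x. lookup x a * (1 when a = k))"
    by (simp add: lext_def lookup_sum lookup_single del: sc_simps)
  also have "\<dots> = (\<Sum>a\<in>keys x. if a = k then lookup x a else 0)"
    by (intro sum.cong) (auto simp: when_def)
  also have "\<dots> = lookup x k" by (simp add: in_keys_iff)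
  finally show "lookup (lext (\<lambda>a. single a 1) x) k = lookup x k" .
qed

lemma lin_lext_compose: "lin T \<Longrightarrow> T (lext g x) = lext (\<lambda>a. T (g a)) x"
  by (simp add: lext_def lin_sum lin_sc)

lemma lin_expand: "lin T \<Longrightarrow> T x = lext (\<lambda>a. T (single a 1)) x"
  using lin_lext_compose[of T "\<lambda>a. single a 1" x] by (simp add: lext_singles)

lemma lext_cong: "(\<And>a. a \<in> keys x \<Longrightarrow> g a = h a) \<Longrightarrow> lext g x = lext h x"
  by (simp add: lext_def)

lemma lin_eq_on:
  assumes "lin T" "lin S" "\<And>a. a \<in> keys x \<Longrightarrow> T (single a 1) = S (single a 1)"
  shows "T x = S x"
  using lin_expand[OF assms(1), of x] lin_expand[OF assms(2), of x] assms(3)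
  by (metis (no_types, lifting) lext_cong)

lemma lookup_lext: "lookup (lext g x) b = (\<Sum>a\<in>keys x. lookup x a * lookup (g a) b)"
  by (simp add: lext_def lookup_sum)

lemma keys_lext: "keys (lext g x) \<subseteq> (\<Union>a\<in>keys x. keys (g a))"
proof
  fix b assume "b \<in> keys (lext g x)"
  then have "(\<Sum>a\<in>keys x. lookup x a * lookup (g a) b) \<noteq> 0" by (simp add: in_keys_iff lookup_lext)
  then obtain a where "a \<in> keys x" "lookup x a * lookup (g a) b \<noteq> 0" by (meson sum.neutral)
  then show "b \<in> (\<Union>a\<in>keys x. keys (g a))" by (auto simp: in_keys_iff)
qed

lemma lin_keys_le:
  assumes "lin T" shows "keys (T x) \<subseteq> (\<Union>a\<in>keys x. keys (T (single a 1)))"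
  using keys_lext[of "\<lambda>a. T (single a 1)" x] lin_expand[OF assms, of x] by simp

definition ip :: "('b \<Rightarrow>\<^sub>0 ratfun) \<Rightarrow> ('b \<Rightarrow>\<^sub>0 ratfun) \<Rightarrow> ratfun" where
  "ip x y = (\<Sum>b\<in>keys x. lookup x b * lookup y b)"

lemma ip_superset: "finite A \<Longrightarrow> keys x \<subseteq> A \<Longrightarrow> ip x y = (\<Sum>b\<in>A. lookup x b * lookup y b)"
  unfolding ip_def by (rule sum.mono_neutral_left) (auto simp: in_keys_iff)

lemma ip_commute: "ip x y = ip y x"
proof -
  have "finite (keys x \<union> keys y)" by simp
  from ip_superset[OF this, of x y] ip_superset[OF this, of y x]
  show ?thesis by (simp add: mult.commute)
qed

lemma ip_add_right: "ip x (y + z) = ip x y + ip x z"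
  and ip_sc_right: "ip x (sc a y) = a * ip x y"
  and ip_diff_right: "ip x (y - z) = ip x y - ip x z"
  and ip_zero_right [simp]: "ip x 0 = 0"
  by (auto simp: ip_def lookup_add lookup_minus algebra_simps sum.distrib sum_subtractf
      sum_distrib_left)

lemma ip_add_left: "ip (y + z) x = ip y x + ip z x"
  and ip_sc_left: "ip (sc a y) x = a * ip y x"
  and ip_diff_left: "ip (y - z) x = ip y x - ip z x"
  and ip_zero_left [simp]: "ip 0 x = 0"
  by (simp_all add: ip_commute[of _ x] ip_add_right ip_sc_right ip_diff_right)

lemma ip_sum_right: "ip x (sum h A) = (\<Sum>i\<in>A. ip x (h i))"
  by (induction A rule: infinite_finite_induct) (auto simp: ip_add_right)


lemma ip_lext_right: "ip x (lext g y) = (\<Sum>a\<in>keys y. lookup y a * ip x (g a))"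
  by (simp add: lext_def ip_sum_right ip_sc_right)

lemma ip_lext_left: "ip (lext g y) x = (\<Sum>a\<in>keys y. lookup y a * ip (g a) x)"
  by (simp add: ip_commute[of _ x] ip_lext_right)

text \<open>The ground field is formally real, so the standard form is anisotropic.\<close>

lemma ip_nonneg: "ip x x \<ge> 0"
  unfolding ip_def by (intro sum_nonneg) simp

lemma ip_self_eq_0 [simp]: "ip x x = 0 \<longleftrightarrow> x = 0"
proof
  assume "ip x x = 0"
  then have "\<forall>b\<in>keys x. lookup x b * lookup x b = 0"
    unfolding ip_def by (subst (asm) sum_nonneg_eq_0_iff) auto
  then have "lookup x b = 0" for b by (cases "b \<in> keys x") (auto simp: in_keys_iff)
  then show "x = 0" by (intro poly_mapping_eqI) simp
qed simp

lemma ip_self_pos: "x \<noteq> 0 \<Longrightarrow> ip x x > 0"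
  using ip_nonneg[of x] ip_self_eq_0[of x] by linarith

definition diag :: "('b \<Rightarrow> ratfun) \<Rightarrow> ('b \<Rightarrow>\<^sub>0 ratfun) \<Rightarrow> ('b \<Rightarrow>\<^sub>0 ratfun)" where
  "diag \<phi> = lext (\<lambda>b. single b (\<phi> b))"

lemma lookup_diag [simp]: "lookup (diag \<phi> x) b = \<phi> b * lookup x b"
proof -
  have "lookup (diag \<phi> x) b = (\<Sum>a\<in>keys x. if a = b then lookup x a * \<phi> a else 0)"
    unfolding diag_def lookup_lext by (intro sum.cong) (auto simp: lookup_single when_def)
  then show ?thesis by (simp add: in_keys_iff)
qed

lemma lin_diag: "lin (diag \<phi>)" by (simp add: diag_def lin_lext)

lemma diag_single: "diag \<phi> (single b a) = single b (\<phi> b * a)"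
  by (rule poly_mapping_eqI) (auto simp: lookup_single when_def)

lemma keys_diag: "keys (diag \<phi> x) \<subseteq> keys x"
  by (auto simp: in_keys_iff)

lemma diag_eq_sc: "(\<And>b. b \<in> keys x \<Longrightarrow> \<phi> b = a) \<Longrightarrow> diag \<phi> x = sc a x"
  by (rule poly_mapping_eqI) (auto simp: in_keys_iff)

definition rst :: "('b \<Rightarrow> bool) \<Rightarrow> ('b \<Rightarrow>\<^sub>0 ratfun) \<Rightarrow> ('b \<Rightarrow>\<^sub>0 ratfun)" where
  "rst P = diag (\<lambda>b. of_bool (P b))"

lemma lookup_rst [simp]: "lookup (rst P x) b = (if P b then lookup x b else 0)"
  by (simp add: rst_def)

lemma keys_rst: "keys (rst P x) = {b \<in> keys x. P b}"
  by (auto simp: in_keys_iff split: if_splits)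

lemma lin_rst: "lin (rst P)" by (simp add: rst_def lin_diag)

lemma rst_single: "rst P (single b a) = (if P b then single b a else 0)"
  by (simp add: rst_def diag_single)

lemma keys_subset_add: "keys x \<subseteq> S \<Longrightarrow> keys y \<subseteq> S \<Longrightarrow> keys (x + y) \<subseteq> S"
  using keys_add[of x y] by blast

lemma keys_subset_diff: "keys x \<subseteq> S \<Longrightarrow> keys y \<subseteq> S \<Longrightarrow> keys (x - y) \<subseteq> S"
  using keys_diff[of x y] by blast

lemma keys_subset_sc: "keys x \<subseteq> S \<Longrightarrow> keys (sc a x) \<subseteq> S"
  using keys_sc[of a x] by blast

lemma subspace_sc_iff:
  "module.subspace sc U \<longleftrightarrow> 0 \<in> U \<and> (\<forall>x\<in>U. \<forall>y\<in>U. x + y \<in> U) \<and> (\<forall>a. \<forall>x\<in>U. sc a x \<in> U)"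
  by (rule module.subspace_def[OF module.intro])
    (auto simp: sc_add sc_add_left)

text \<open>
  The induction adds one coordinate \<open>b\<close> at a time. If some vector of \<open>W\<close> has a non-zero \<open>b\<close>-coordinate, then
  subtracting its projection to the vectors of \<open>W\<close> without \<open>b\<close>-coordinate leaves a vector \<open>h\<close> which together with
  those spans \<open>W\<close>. Since the form is anisotropic, one can divide by the norm of \<open>h\<close>.
\<close>

lemma orthogonal_projection:
  assumes "finite S"
  shows "module.subspace sc W \<Longrightarrow> (\<And>x. x \<in> W \<Longrightarrow> keys x \<subseteq> S)
    \<Longrightarrow> \<exists>w\<in>W. \<forall>u\<in>W. ip (y - w) u = 0"
  using assms
proof (induction S arbitrary: W y rule: finite_induct)
  case empty
  then have "\<forall>u\<in>W. u = 0" by (metis keys_eq_empty subset_empty)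
  moreover have "0 \<in> W" using empty by (simp add: subspace_sc_iff)
  ultimately show ?case by (metis ip_zero_right)
next
  case (insert b S)
  define W0 where "W0 = {x\<in>W. lookup x b = 0}"
  have W: "0 \<in> W" "\<And>x y. x \<in> W \<Longrightarrow> y \<in> W \<Longrightarrow> x + y \<in> W" "\<And>a x. x \<in> W \<Longrightarrow> sc a x \<in> W"
    using insert.prems(1) by (auto simp: subspace_sc_iff)
  have Wd: "x - y \<in> W" if "x \<in> W" "y \<in> W" for x y
    using W(2)[OF that(1) W(3)[OF that(2), of "-1"]] by (simp add: sc_minus_left)
  have sub0: "module.subspace sc W0"
    unfolding subspace_sc_iff W0_def using W by (auto simp: lookup_add)
  have keys0: "keys x \<subseteq> S" if "x \<in> W0" for x
    using that insert.prems(2)[of x] by (auto simp: W0_def in_keys_iff)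
  obtain w0 where w0: "w0 \<in> W0" "\<forall>u\<in>W0. ip (y - w0) u = 0"
    using insert.IH[OF sub0 keys0] by blast
  show ?case
  proof (cases "W = W0")
    case True
    then show ?thesis using w0 by auto
  next
    case False
    then obtain g where g: "g \<in> W" "lookup g b \<noteq> 0" by (auto simp: W0_def)
    obtain g0 where g0: "g0 \<in> W0" "\<forall>u\<in>W0. ip (g - g0) u = 0"
      using insert.IH[OF sub0 keys0] by blast
    define h where "h = g - g0"
    have h: "h \<in> W" "lookup h b \<noteq> 0" "\<And>u. u \<in> W0 \<Longrightarrow> ip h u = 0"
      using g g0 by (auto simp: h_def W0_def Wd lookup_minus)
    then have h0: "ip h h \<noteq> 0" by auto
    define w where "w = w0 + sc (ip (y - w0) h / ip h h) h"
    have "w \<in> W" using w0 h by (auto simp: w_def W0_def W)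
    moreover have "ip (y - w) u = 0" if "u \<in> W" for u
    proof -
      define c where "c = lookup u b / lookup h b"
      have u0: "u - sc c h \<in> W0"
        using that h W Wd by (auto simp: W0_def c_def lookup_minus)
      have "ip (y - w) u = ip (y - w) (u - sc c h) + c * ip (y - w) h"
        by (simp add: ip_diff_right ip_sc_right)
      moreover have "y - w = (y - w0) - sc (ip (y - w0) h / ip h h) h" by (simp add: w_def)
      ultimately show ?thesis
        using w0(2)[rule_format, OF u0] h(3)[OF u0] h0 by (simp only: ip_diff_left ip_sc_left) simp
    qed
    ultimately show ?thesis by blast
  qed
qed

section \<open>Modules with a contravariant form\<close>

text \<open>
  The axioms concern basis vectors only. By \<open>adj_basis\<close>, the adjoint of \<open>f j\<close> is \<open>e j\<close> followed by the
  action of \<open>t\<^sub>j\<close> and division by \<open>q\<close>. The Serre relations are not among the axioms; they are derived below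
  in the presence of a grading.
\<close>

locale contravariant =
  fixes B :: "'b set"
    and e f :: "int \<Rightarrow> ('b \<Rightarrow>\<^sub>0 ratfun) \<Rightarrow> ('b \<Rightarrow>\<^sub>0 ratfun)"
    and wt :: "'b \<Rightarrow> int \<Rightarrow> int"
  assumes lin_e: "lin (e j)" and lin_f: "lin (f j)"
    and e_basis: "b \<in> B \<Longrightarrow> b' \<in> keys (e j (single b 1)) \<Longrightarrow>
      b' \<in> B \<and> (\<forall>i. wt b' i = wt b i + cartan i j)"
    and f_basis: "b \<in> B \<Longrightarrow> keys (f j (single b 1)) \<subseteq> B"
    and e_f_basis: "b \<in> B \<Longrightarrow>
      e i (f j (single b 1)) - f j (e i (single b 1))
        = (if i = j then single b (qint (wt b i)) else 0)"
    and adj_basis: "b \<in> B \<Longrightarrow> b' \<in> B \<Longrightarrow>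
      lookup (f j (single b 1)) b' = qq powi (wt b j - 1) * lookup (e j (single b' 1)) b"
begin

definition t where "t j = diag (\<lambda>b. qq powi wt b j)"
definition tinv where "tinv j = diag (\<lambda>b. qq powi (- wt b j))"

text \<open>
  \<open>h 0 j\<close> is the commutator of \<open>e j\<close> and \<open>f j\<close>. The shift \<open>n\<close> records the change of weight when such an
  operator is moved past some \<open>f i\<close>.
\<close>

definition h where "h n j = diag (\<lambda>b. qint (wt b j + n))"

lemma lin_t: "lin (t j)" and lin_tinv: "lin (tinv j)" and lin_h: "lin (h n j)"
  by (auto simp: t_def tinv_def h_def lin_diag)

lemmas linearity =
  lin_add[OF lin_e] lin_add[OF lin_f] lin_add[OF lin_t] lin_add[OF lin_tinv] lin_add[OF lin_h]
  lin_diff[OF lin_e] lin_diff[OF lin_f] lin_diff[OF lin_t] lin_diff[OF lin_tinv] lin_diff[OF lin_h]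
  lin_sc[OF lin_e] lin_sc[OF lin_f] lin_sc[OF lin_t] lin_sc[OF lin_tinv] lin_sc[OF lin_h]
  lin_zero[OF lin_e] lin_zero[OF lin_f] lin_zero[OF lin_t] lin_zero[OF lin_tinv] lin_zero[OF lin_h]

lemma e_closed: "keys x \<subseteq> B \<Longrightarrow> keys (e j x) \<subseteq> B"
  using lin_keys_le[OF lin_e, of j x] e_basis by blast

lemma f_closed: "keys x \<subseteq> B \<Longrightarrow> keys (f j x) \<subseteq> B"
  using lin_keys_le[OF lin_f, of j x] f_basis by blast

lemma t_closed: "keys x \<subseteq> B \<Longrightarrow> keys (t j x) \<subseteq> B"
  and tinv_closed: "keys x \<subseteq> B \<Longrightarrow> keys (tinv j x) \<subseteq> B"
  and h_closed: "keys x \<subseteq> B \<Longrightarrow> keys (h n j x) \<subseteq> B"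
  unfolding t_def tinv_def h_def by (rule order_trans[OF keys_diag], assumption)+

lemma f_basis_adj:
  "b \<in> B \<Longrightarrow> b' \<in> keys (f j (single b 1)) \<Longrightarrow> b' \<in> B \<and> b \<in> keys (e j (single b' 1))"
  using f_basis[of b j] adj_basis[of b b' j] by (auto simp: in_keys_iff)

lemma f_basis_wt:
  "b \<in> B \<Longrightarrow> b' \<in> keys (f j (single b 1)) \<Longrightarrow> b' \<in> B \<and> (\<forall>i. wt b' i = wt b i - cartan i j)"
  using f_basis_adj[of b b' j] e_basis[of b' b j] by auto

lemma diag_e:
  assumes "keys x \<subseteq> B"
    and "\<And>b b'. b \<in> B \<Longrightarrow> b' \<in> B \<Longrightarrow> (\<And>i. wt b' i = wt b i + cartan i j) \<Longrightarrow> \<psi> b' = \<phi> b"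
  shows "diag \<psi> (e j x) = e j (diag \<phi> x)"
proof (rule lin_eq_on[OF lin_compose[OF lin_diag lin_e] lin_compose[OF lin_e lin_diag]])
  fix b assume "b \<in> keys x"
  then have b: "b \<in> B" using assms(1) by auto
  have "diag \<psi> (e j (single b 1)) = sc (\<phi> b) (e j (single b 1))"
    by (rule diag_eq_sc) (use e_basis[OF b] assms(2)[OF b] in blast)
  then show "diag \<psi> (e j (single b 1)) = e j (diag \<phi> (single b 1))"
    using lin_sc[OF lin_e, of j "\<phi> b" "single b 1"] by (simp add: diag_single)
qed

lemma diag_f:
  assumes "keys x \<subseteq> B"
    and "\<And>b b'. b \<in> B \<Longrightarrow> b' \<in> B \<Longrightarrow> (\<And>i. wt b' i = wt b i - cartan i j) \<Longrightarrow> \<psi> b' = \<phi> b"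
  shows "diag \<psi> (f j x) = f j (diag \<phi> x)"
proof (rule lin_eq_on[OF lin_compose[OF lin_diag lin_f] lin_compose[OF lin_f lin_diag]])
  fix b assume "b \<in> keys x"
  then have b: "b \<in> B" using assms(1) by auto
  have "diag \<psi> (f j (single b 1)) = sc (\<phi> b) (f j (single b 1))"
    by (rule diag_eq_sc) (use f_basis_wt[OF b] assms(2)[OF b] in blast)
  then show "diag \<psi> (f j (single b 1)) = f j (diag \<phi> (single b 1))"
    using lin_sc[OF lin_f, of j "\<phi> b" "single b 1"] by (simp add: diag_single)
qed

lemma h_f: "keys x \<subseteq> B \<Longrightarrow> h n i (f j x) = f j (h (n - cartan i j) i x)"
  unfolding h_def by (rule diag_f) (auto intro!: arg_cong[where f = qint])

lemma t_tinv: "t j (tinv j x) = x" "tinv j (t j x) = x"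
  by (auto intro!: poly_mapping_eqI simp: t_def tinv_def power_int_minus)

lemma t_e: "keys x \<subseteq> B \<Longrightarrow> t i (e j (tinv i x)) = sc (qq powi cartan i j) (e j x)"
proof -
  assume x: "keys x \<subseteq> B"
  have "t i (e j (tinv i x)) = e j (diag (\<lambda>b. qq powi (wt b i + cartan i j)) (tinv i x))"
    unfolding t_def by (rule diag_e) (use tinv_closed[OF x] in auto)
  also have "diag (\<lambda>b. qq powi (wt b i + cartan i j)) (tinv i x) = sc (qq powi cartan i j) x"
    by (rule poly_mapping_eqI) (auto simp: tinv_def power_int_add power_int_minus)
  finally show ?thesis by (simp add: linearity)
qed

lemma tinv_f: "keys x \<subseteq> B \<Longrightarrow> tinv i (f j x) = sc (qq powi cartan i j) (f j (tinv i x))"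
proof -
  assume x: "keys x \<subseteq> B"
  have "tinv i (f j x) = f j (diag (\<lambda>b. qq powi (- wt b i + cartan i j)) x)"
    unfolding tinv_def by (rule diag_f) (use x in auto)
  also have "diag (\<lambda>b. qq powi (- wt b i + cartan i j)) x = sc (qq powi cartan i j) (tinv i x)"
  proof (rule poly_mapping_eqI)
    fix b
    have "qq powi (- wt b i + cartan i j) = qq powi (- wt b i) * qq powi cartan i j"
      by (rule power_int_add) simp
    then show "lookup (diag (\<lambda>b. qq powi (- wt b i + cartan i j)) x) b
        = lookup (sc (qq powi cartan i j) (tinv i x)) b"
      unfolding tinv_def lookup_diag lookup_sc by (simp only: mult_ac)
  qed
  finally show ?thesis by (simp add: linearity)
qed

lemma t_f: "keys x \<subseteq> B \<Longrightarrow> t i (f j (tinv i x)) = sc (qq powi (- cartan i j)) (f j x)"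
proof -
  assume x: "keys x \<subseteq> B"
  have "sc (qq powi cartan i j) (t i (f j (tinv i x))) = f j x"
    using tinv_f[OF x, of i j] t_tinv(1)[of i "f j x"] by (simp add: linearity)
  then have "sc (qq powi (- cartan i j)) (sc (qq powi cartan i j) (t i (f j (tinv i x))))
      = sc (qq powi (- cartan i j)) (f j x)" by simp
  then show ?thesis by (simp add: power_int_minus)
qed

lemma e_f: "keys x \<subseteq> B \<Longrightarrow> e i (f j x) = f j (e i x) + (if i = j then h 0 i x else 0)"
proof -
  assume x: "keys x \<subseteq> B"
  have lin: "lin (\<lambda>x. if i = j then h 0 i x else 0)"
    using lin_h lin_const_0 by (cases "i = j") auto
  have "e i (f j x) - f j (e i x) = (if i = j then h 0 i x else 0)"
    by (rule lin_eq_on[OF lin_minus[OF lin_compose[OF lin_e lin_f] lin_compose[OF lin_f lin_e]] lin])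
      (use e_f_basis[of _ i j] x in \<open>auto simp: h_def diag_single subset_iff\<close>)
  then show ?thesis by (simp add: algebra_simps)
qed

lemma adj_f:
  assumes x: "keys x \<subseteq> B" and y: "keys y \<subseteq> B"
  shows "ip (f j x) y = inverse qq * ip (t j x) (e j y)"
proof -
  have "ip (f j x) y = (\<Sum>a\<in>keys x. lookup x a * ip (f j (single a 1)) y)"
    unfolding lin_expand[OF lin_f, of j x] by (rule ip_lext_left)
  also have "\<dots> = (\<Sum>a\<in>keys x. \<Sum>b\<in>keys y. lookup x a * lookup y b * lookup (f j (single a 1)) b)"
    unfolding ip_commute[of _ y] by (simp add: ip_def sum_distrib_left mult_ac)
  also have "\<dots> = (\<Sum>a\<in>keys x. \<Sum>b\<in>keys y.
      inverse qq * (lookup y b * (lookup (t j x) a * lookup (e j (single b 1)) a)))"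
    using x y by (intro sum.cong) (auto simp: adj_basis t_def power_int_diff subset_iff divide_inverse)
  also have "\<dots> = inverse qq * (\<Sum>b\<in>keys y. lookup y b *
      (\<Sum>a\<in>keys x. (lookup (t j x) a * lookup (e j (single b 1)) a)))"
    unfolding sum_distrib_left by (rule sum.swap)
  also have "\<dots> = inverse qq * (\<Sum>b\<in>keys y. lookup y b * ip (t j x) (e j (single b 1)))"
    by (simp add: t_def ip_superset[OF finite_keys[of x] keys_diag])
  also have "\<dots> = inverse qq * ip (t j x) (e j y)"
    unfolding lin_expand[OF lin_e, of j y] by (simp add: ip_lext_right)
  finally show ?thesis .
qed

lemma adj_e:
  assumes x: "keys x \<subseteq> B" and y: "keys y \<subseteq> B"
  shows "ip (e j y) x = qq * ip y (f j (tinv j x))"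
proof -
  have "ip (f j (tinv j x)) y = inverse qq * ip x (e j y)"
    using adj_f[OF tinv_closed[OF x] y, of j j] by (simp only: t_tinv)
  then show ?thesis by (simp add: ip_commute[of _ "f j (tinv j x)"] ip_commute[of x])
qed

definition singular :: "('b \<Rightarrow>\<^sub>0 ratfun) \<Rightarrow> bool" where
  "singular x \<longleftrightarrow> keys x \<subseteq> B \<and> (\<forall>j. e j x = 0)"

lemma singular_orthogonal: "keys x \<subseteq> B \<Longrightarrow> singular z \<Longrightarrow> ip (f j x) z = 0"
  using adj_f[of x z j] by (simp add: singular_def)

text \<open>
  The norm of \<open>f j x\<close> is a positive multiple of \<open>qint n\<close> times the norm of \<open>x\<close>; so \<open>qint n\<close> cannot be
  negative.
\<close>

lemma singular_weight_nonneg: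
  assumes x: "keys x \<subseteq> B" "x \<noteq> 0" "e j x = 0" and n: "\<And>b. b \<in> keys x \<Longrightarrow> wt b j = n"
  shows "n \<ge> 0"
proof (rule ccontr)
  assume "\<not> n \<ge> 0"
  have "h 0 j x = sc (qint n) x" unfolding h_def using n by (intro diag_eq_sc) simp
  moreover have "t j x = sc (qq powi n) x" unfolding t_def using n by (intro diag_eq_sc) simp
  ultimately have "ip (f j x) (f j x) = inverse qq * qq powi n * qint n * ip x x"
    using adj_f[OF x(1) f_closed[OF x(1)], of j j] e_f[OF x(1), of j j] x(3)
    by (simp add: linearity ip_sc_left ip_sc_right)
  moreover have "inverse qq * qq powi n > 0" using qq_pos qq_powi_pos by simp
  moreover have "qint n < 0" using \<open>\<not> n \<ge> 0\<close> by (intro qint_neg) simp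
  ultimately have "ip (f j x) (f j x) < 0"
    using ip_self_pos[OF x(2)] by (simp add: mult_less_0_iff zero_less_mult_iff)
  then show False using ip_nonneg[of "f j x"] by simp
qed

definition rep :: "('b \<Rightarrow>\<^sub>0 ratfun) uq_rep" where
  "rep = \<lparr> uq_carrier = {x. keys x \<subseteq> B}, uq_scale = sc, uq_e = e, uq_f = f, uq_t = t, uq_tinv = tinv \<rparr>"

end

text \<open>
  The degree is lowered by the \<open>e j\<close>. It gives an induction on vectors, and vectors of bounded degree
  form a finite-dimensional space.
\<close>

locale graded_contravariant = contravariant +
  fixes deg :: "'a \<Rightarrow> nat"
  assumes e_deg: "b \<in> B \<Longrightarrow> b' \<in> keys (e j (single b 1)) \<Longrightarrow> deg b = Suc (deg b')"
    and finite_deg: "finite {b \<in> B. deg b < n}"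
begin

lemma e_lowers: "keys x \<subseteq> {b \<in> B. deg b < Suc n} \<Longrightarrow> keys (e j x) \<subseteq> {b \<in> B. deg b < n}"
proof
  fix b' assume x: "keys x \<subseteq> {b \<in> B. deg b < Suc n}" and "b' \<in> keys (e j x)"
  then obtain b where b: "b \<in> B" "deg b < Suc n" "b' \<in> keys (e j (single b 1))"
    using lin_keys_le[OF lin_e, of j x] by blast
  with e_deg[OF b(1,3)] e_basis[OF b(1,3)] show "b' \<in> {b \<in> B. deg b < n}" by auto
qed

lemma f_raises: "keys x \<subseteq> {b \<in> B. deg b < n} \<Longrightarrow> keys (f j x) \<subseteq> {b \<in> B. deg b < Suc n}"
proof
  fix b' assume x: "keys x \<subseteq> {b \<in> B. deg b < n}" and "b' \<in> keys (f j x)"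
  then obtain b where b: "b \<in> B" "deg b < n" "b' \<in> keys (f j (single b 1))"
    using lin_keys_le[OF lin_f, of j x] by blast
  with f_basis_adj[of b b' j] e_deg[of b' b j] show "b' \<in> {b \<in> B. deg b < Suc n}" by auto
qed

lemma degree_bound: "keys x \<subseteq> B \<Longrightarrow> \<exists>n. keys x \<subseteq> {b \<in> B. deg b < n}"
  using finite_nat_set_iff_bounded[of "deg ` keys x"] by auto

text \<open>
  On a vector of least degree where \<open>S\<close> does not vanish, its value would be killed by all \<open>e k\<close>, hence
  orthogonal to itself. The Serre relations are the instances for which this is needed; there \<open>S\<close> is the difference of
  the two sides.
\<close>

lemma commuting_operator_zero:
  assumes S: "\<And>x. keys x \<subseteq> B \<Longrightarrow> keys (S x) \<subseteq> B" "S 0 = 0"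
    and comm: "\<And>k x. keys x \<subseteq> B \<Longrightarrow> e k (S x) = S (e k x)"
    and img: "\<And>x z. keys x \<subseteq> B \<Longrightarrow> singular z \<Longrightarrow> ip (S x) z = 0"
    and x: "keys x \<subseteq> B"
  shows "S x = 0"
proof -
  have "keys x \<subseteq> {b \<in> B. deg b < n} \<Longrightarrow> S x = 0" for n x
  proof (induction n arbitrary: x)
    case 0
    then have "x = 0" by simp
    then show ?case using S(2) by simp
  next
    case (Suc n)
    then have x: "keys x \<subseteq> B" by auto
    have "e k (S x) = 0" for k
      using comm[OF x] Suc.IH[OF e_lowers[OF Suc.prems]] by simp
    then have "singular (S x)" using S(1)[OF x] by (simp add: singular_def)
    from img[OF x this] show ?case by simp
  qed
  then show ?thesis using degree_bound[OF x] by blast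
qed

lemma serre_far_f: assumes "keys x \<subseteq> B" "\<bar>i - j\<bar> > 1" shows "f i (f j x) = f j (f i x)"
proof -
  have c: "cartan i j = 0" "cartan j i = 0" "i \<noteq> j" using assms(2) by (auto simp: cartan_def)
  have "f i (f j x) - f j (f i x) = 0"
  proof (rule commuting_operator_zero[where S = "\<lambda>x. f i (f j x) - f j (f i x)"])
    show "keys (f i (f j x) - f j (f i x)) \<subseteq> B" if "keys x \<subseteq> B" for x
      using that by (intro keys_subset_diff f_closed)
    show "e k (f i (f j x) - f j (f i x)) = f i (f j (e k x)) - f j (f i (e k x))"
      if "keys x \<subseteq> B" for k x
      using that c by (auto simp: linearity e_f f_closed e_closed h_closed h_f)
    show "ip (f i (f j x) - f j (f i x)) z = 0" if "keys x \<subseteq> B" "singular z" for x z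
      using that by (simp add: ip_diff_left singular_orthogonal f_closed)
  qed (use assms in \<open>auto simp: linearity\<close>)
  then show ?thesis by simp
qed

text \<open>This identity makes the Serre element commute with \<open>e i\<close> and \<open>e j\<close>.\<close>

lemma h_recurrence: "h (n + 1) j x + h (n - 1) j x = sc (qq + inverse qq) (h n j x)"
proof (rule poly_mapping_eqI)
  fix b
  show "lookup (h (n + 1) j x + h (n - 1) j x) b = lookup (sc (qq + inverse qq) (h n j x)) b"
    using arg_cong[OF qint_recurrence[of "wt b j + n"], of "\<lambda>z. z * lookup x b"]
    by (simp add: h_def lookup_add algebra_simps)
qed

lemma serre_near_f:
  assumes "keys x \<subseteq> B" "\<bar>i - j\<bar> = 1"
  shows "f i (f i (f j x)) - sc (qq + inverse qq) (f i (f j (f i x))) + f j (f i (f i x)) = 0"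
proof -
  let ?a = "qq + inverse qq"
  define S where "S x = f i (f i (f j x)) - sc ?a (f i (f j (f i x))) + f j (f i (f i x))" for x
  have c: "cartan i j = -1" "cartan j i = -1" "cartan i i = 2" "cartan j j = 2" "i \<noteq> j"
    using assms(2) by (auto simp: cartan_def)
  have "S x = 0"
  proof (rule commuting_operator_zero[where S = S])
    show "keys (S x) \<subseteq> B" if "keys x \<subseteq> B" for x
      unfolding S_def using that by (intro keys_subset_diff keys_subset_add keys_subset_sc f_closed)
    show "e k (S x) = S (e k x)" if x: "keys x \<subseteq> B" for k x
    proof -
      note closed = f_closed e_closed h_closed x
      consider "k = i" | "k = j" | "k \<noteq> i" "k \<noteq> j" by blast
      then show ?thesis
      proof cases
        case 1
        have 1: "e i (f i (f i (f j x)))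
            = f i (f i (f j (e i x))) + f i (f j (h 1 i x + h (-1) i x))"
          using c by (simp add: e_f h_f closed linearity)
        have 2: "e i (f i (f j (f i x)))
            = f i (f j (f i (e i x))) + f i (f j (h 0 i x)) + f j (f i (h (-1) i x))"
          using c by (simp add: e_f h_f closed linearity)
        have 3: "e i (f j (f i (f i x)))
            = f j (f i (f i (e i x))) + f j (f i (h 0 i x + h (-2) i x))"
          using c by (simp add: e_f h_f closed linearity)
        have r: "h 1 i x + h (-1) i x = sc ?a (h 0 i x)" "h 0 i x + h (-2) i x = sc ?a (h (-1) i x)"
          using h_recurrence[of 0 i x] h_recurrence[of "-1" i x] by simp_all
        show ?thesis unfolding \<open>k = i\<close> S_def linearity 1 2 3 r sc_add by simp
      next
        case 2
        have 1: "e j (f i (f i (f j x))) = f i (f i (f j (e j x))) + f i (f i (h 0 j x))"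
          using c by (simp add: e_f h_f closed linearity)
        have 2: "e j (f i (f j (f i x))) = f i (f j (f i (e j x))) + f i (f i (h 1 j x))"
          using c by (simp add: e_f h_f closed linearity)
        have 3: "e j (f j (f i (f i x))) = f j (f i (f i (e j x))) + f i (f i (h 2 j x))"
          using c by (simp add: e_f h_f closed linearity)
        have "f i (f i (h 0 j x)) + f i (f i (h 2 j x)) = sc ?a (f i (f i (h 1 j x)))"
          using arg_cong[OF h_recurrence[of 1 j x], of "\<lambda>y. f i (f i y)"]
          by (simp add: linearity add.commute)
        then show ?thesis unfolding \<open>k = j\<close> S_def linearity 1 2 3 sc_add
          by (simp add: algebra_simps)
      next
        case 3
        then show ?thesis using c by (simp add: S_def linearity e_f closed)
      qed
    qed
    show "ip (S x) z = 0" if "keys x \<subseteq> B" "singular z" for x z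
      using that
      by (simp add: S_def ip_diff_left ip_add_left ip_sc_left singular_orthogonal f_closed)
  qed (use assms in \<open>auto simp: linearity S_def\<close>)
  then show ?thesis by (simp add: S_def)
qed

lemma eq_0_if_orthogonal: "keys x \<subseteq> B \<Longrightarrow> (\<And>u. keys u \<subseteq> B \<Longrightarrow> ip x u = 0) \<Longrightarrow> x = 0"
  using ip_self_eq_0 by blast

lemma tinv_tinv: "tinv i (tinv j x) = tinv j (tinv i x)"
  by (auto intro!: poly_mapping_eqI simp: tinv_def)

text \<open>The Serre relations for the \<open>e j\<close> are adjoint to those for the \<open>f j\<close>.\<close>

lemma serre_far_e: assumes x: "keys x \<subseteq> B" and ij: "\<bar>i - j\<bar> > 1" shows "e i (e j x) = e j (e i x)"
proof -
  note closed = f_closed e_closed tinv_closed x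
  have c: "cartan i j = 0" "cartan j i = 0" using ij by (auto simp: cartan_def)
  have "e i (e j x) - e j (e i x) = 0"
  proof (rule eq_0_if_orthogonal)
    fix u :: "'a \<Rightarrow>\<^sub>0 ratfun" assume u: "keys u \<subseteq> B"
    have "f j (f i (tinv i (tinv j u))) = f i (f j (tinv i (tinv j u)))"
      using serre_far_f[of "tinv i (tinv j u)" i j] ij u by (simp add: closed)
    then show "ip (e i (e j x) - e j (e i x)) u = 0"
      using c u by (simp add: ip_diff_left adj_e tinv_f closed tinv_tinv[of j i])
  qed (intro keys_subset_diff closed)
  then show ?thesis by simp
qed

lemma serre_near_e:
  assumes x: "keys x \<subseteq> B" and ij: "\<bar>i - j\<bar> = 1"
  shows "e i (e i (e j x)) - sc (qq + inverse qq) (e i (e j (e i x))) + e j (e i (e i x)) = 0"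
proof (rule eq_0_if_orthogonal)
  note closed = f_closed e_closed tinv_closed x
  have c: "cartan i j = -1" "cartan j i = -1" "cartan i i = 2" using ij by (auto simp: cartan_def)
  fix u :: "'a \<Rightarrow>\<^sub>0 ratfun" assume u: "keys u \<subseteq> B"
  define v where "v = tinv i (tinv i (tinv j u))"
  have v: "keys v \<subseteq> B" using u by (simp add: v_def closed)
  have [simp]: "qq * (qq * (inverse qq * inverse qq)) = 1" "inverse qq * (inverse qq * (qq * qq)) = 1"
    by (simp_all add: field_simps)
  have 1: "ip (e i (e i (e j x))) u = qq * (qq * (qq * ip x (f j (f i (f i v)))))"
    using c u by (simp add: adj_e ip_sc_right tinv_f closed linearity v_def tinv_tinv[of j i] power_int_minus power2_eq_square)
  have 2: "ip (e i (e j (e i x))) u = qq * (qq * (qq * ip x (f i (f j (f i v)))))"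
    using c u by (simp add: adj_e ip_sc_right tinv_f closed linearity v_def tinv_tinv[of j i] power_int_minus power2_eq_square)
  have 3: "ip (e j (e i (e i x))) u = qq * (qq * (qq * ip x (f i (f i (f j v)))))"
    using c u by (simp add: adj_e ip_sc_right tinv_f closed linearity v_def tinv_tinv[of j i] power_int_minus power2_eq_square)
  have "ip x (f i (f i (f j v))) - (qq + inverse qq) * ip x (f i (f j (f i v)))
      + ip x (f j (f i (f i v))) = 0"
    using arg_cong[OF serre_near_f[OF v ij], of "ip x"]
    by (simp add: ip_add_right ip_diff_right ip_sc_right)
  then have "qq * (qq * (qq * (ip x (f i (f i (f j v))) - (qq + inverse qq) * ip x (f i (f j (f i v)))
      + ip x (f j (f i (f i v)))))) = 0" by simp
  then show "ip (e i (e i (e j x)) - sc (qq + inverse qq) (e i (e j (e i x))) + e j (e i (e i x))) u = 0"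
    unfolding ip_add_left ip_diff_left ip_sc_left 1 2 3 by (simp add: algebra_simps)
qed (intro keys_subset_diff keys_subset_add keys_subset_sc e_closed x)

theorem uq_module_rep: "uq_module rep"
proof (rule uq_module.intro)
  show "vector_space (uq_scale rep)" by (simp add: rep_def vector_space_sc)
  show "uq_submodule rep (uq_carrier rep)"
    by (auto simp: uq_submodule_def rep_def subspace_sc_iff
        dest: keys_subset_add keys_subset_sc e_closed f_closed t_closed tinv_closed)
  show "linear_between (uq_carrier rep) (uq_scale rep) (uq_scale rep) (uq_e rep j)"
    "linear_between (uq_carrier rep) (uq_scale rep) (uq_scale rep) (uq_f rep j)"
    "linear_between (uq_carrier rep) (uq_scale rep) (uq_scale rep) (uq_t rep j)"
    "linear_between (uq_carrier rep) (uq_scale rep) (uq_scale rep) (uq_tinv rep j)" for j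
    by (auto simp: linear_between_def rep_def linearity)
  show "uq_e rep i (uq_f rep j x) - uq_f rep j (uq_e rep i x) =
        (if i = j then uq_scale rep (1 / (qq - inverse qq)) (uq_t rep i x - uq_tinv rep i x) else 0)"
    if "x \<in> uq_carrier rep" for x i j
  proof -
    have "h 0 i x = sc (1 / (qq - inverse qq)) (t i x - tinv i x)"
      by (rule poly_mapping_eqI) (simp add: h_def t_def tinv_def qint_def lookup_minus left_diff_distrib)
    then show ?thesis using that by (cases "i = j") (simp_all add: rep_def e_f)
  qed
  show "uq_t rep i (uq_t rep j x) = uq_t rep j (uq_t rep i x)" for i j x
    by (auto intro!: poly_mapping_eqI simp: rep_def t_def)
qed (simp_all add: rep_def t_tinv t_e t_f serre_far_e serre_far_f serre_near_e serre_near_f)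

end

section \<open>Submodules generated by singular vectors\<close>

lemma uq_submodule_restrict:
  "uq_submodule (M\<lparr>uq_carrier := U\<rparr>) V \<longleftrightarrow> V \<subseteq> U \<and> uq_submodule M V" if "U \<subseteq> uq_carrier M"
  using that by (auto simp: uq_submodule_def)

lemma uq_module_restrict:
  assumes "uq_module M" "uq_submodule M U"
  shows "uq_module (M\<lparr>uq_carrier := U\<rparr>)"
proof -
  interpret uq_module M by fact
  have U: "x \<in> U \<Longrightarrow> x \<in> uq_carrier M" for x using assms(2) by (auto simp: uq_submodule_def)
  show ?thesis
  proof (rule uq_module.intro)
    show "uq_submodule (M\<lparr>uq_carrier := U\<rparr>) (uq_carrier (M\<lparr>uq_carrier := U\<rparr>))"
      using assms(2) by (auto simp: uq_submodule_def)
  qed (use linear U in \<open>auto simp: vector_space t_inverse t_e t_f e_f serre_far serre_near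
        linear_between_def intro: t_t\<close>)
qed

definition prepend :: "int \<Rightarrow> (int list \<Rightarrow>\<^sub>0 ratfun) \<Rightarrow> (int list \<Rightarrow>\<^sub>0 ratfun)" where
  "prepend i = lext (\<lambda>u. single (i # u) 1)"

definition word_weight :: "(int \<Rightarrow> int) \<Rightarrow> int list \<Rightarrow> int \<Rightarrow> int" where
  "word_weight \<Lambda> w j = \<Lambda> j - (\<Sum>i\<leftarrow>w. cartan j i)"

text \<open>
  For a word \<open>w\<close> let \<open>f\<^sub>w\<close> be the product of the corresponding \<open>f j\<close>. If \<open>x\<close> is singular of weight
  \<open>\<Lambda>\<close>, then \<open>e j f\<^sub>w x\<close> is a combination of vectors \<open>f\<^sub>u x\<close>, whose coefficients, recorded by
  \<open>e_word\<close>, depend on \<open>\<Lambda>\<close> only. Hence so do the inner products of the \<open>f\<^sub>w x\<close>, up to the common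
  factor \<open>ip x x\<close>; they are recorded by \<open>gram\<close>.
\<close>

primrec e_word :: "(int \<Rightarrow> int) \<Rightarrow> int \<Rightarrow> int list \<Rightarrow> (int list \<Rightarrow>\<^sub>0 ratfun)" where
  "e_word \<Lambda> j [] = 0"
| "e_word \<Lambda> j (i # w) = prepend i (e_word \<Lambda> j w)
     + (if i = j then single w (qint (word_weight \<Lambda> w j)) else 0)"

primrec gram :: "(int \<Rightarrow> int) \<Rightarrow> int list \<Rightarrow> int list \<Rightarrow> ratfun" where
  "gram \<Lambda> [] w' = (if w' = [] then 1 else 0)"
| "gram \<Lambda> (j # w) w' = inverse qq * qq powi word_weight \<Lambda> w j *
     (\<Sum>u\<in>keys (e_word \<Lambda> j w'). lookup (e_word \<Lambda> j w') u * gram \<Lambda> w u)"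

definition gram_norm :: "(int \<Rightarrow> int) \<Rightarrow> (int list \<Rightarrow>\<^sub>0 ratfun) \<Rightarrow> ratfun" where
  "gram_norm \<Lambda> a = (\<Sum>w\<in>keys a. \<Sum>w'\<in>keys a. lookup a w * lookup a w' * gram \<Lambda> w w')"

context contravariant
begin

definition fw :: "int list \<Rightarrow> ('b \<Rightarrow>\<^sub>0 ratfun) \<Rightarrow> ('b \<Rightarrow>\<^sub>0 ratfun)" where
  "fw w x = foldr f w x"

lemma fw_simps [simp]: "fw [] x = x" "fw (j # w) x = f j (fw w x)"
  by (simp_all add: fw_def)

definition ev :: "('b \<Rightarrow>\<^sub>0 ratfun) \<Rightarrow> (int list \<Rightarrow>\<^sub>0 ratfun) \<Rightarrow> ('b \<Rightarrow>\<^sub>0 ratfun)" where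
  "ev x = lext (\<lambda>w. fw w x)"

definition singular_of_weight :: "(int \<Rightarrow> int) \<Rightarrow> ('b \<Rightarrow>\<^sub>0 ratfun) \<Rightarrow> bool" where
  "singular_of_weight \<Lambda> x \<longleftrightarrow> singular x \<and> (\<forall>b\<in>keys x. wt b = \<Lambda>)"

lemma lin_ev: "lin (ev x)" by (simp add: ev_def lin_lext)

lemma fw_closed: "keys x \<subseteq> B \<Longrightarrow> keys (fw w x) \<subseteq> B"
  by (induction w) (auto dest: f_closed)

lemma ev_closed: "keys x \<subseteq> B \<Longrightarrow> keys (ev x a) \<subseteq> B"
  unfolding ev_def using keys_lext[of "\<lambda>w. fw w x" a] fw_closed by blast

lemma f_ev: "f i (ev x a) = ev x (prepend i a)"
  unfolding ev_def prepend_def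
  by (simp add: lin_lext_compose[OF lin_f] lin_lext_compose[OF lin_lext])

context
  fixes \<Lambda> x assumes sing: "singular_of_weight \<Lambda> x"
begin

lemma x_closed: "keys x \<subseteq> B" and x_singular: "singular x" and e_x: "e j x = 0"
  and wt_x: "b \<in> keys x \<Longrightarrow> wt b = \<Lambda>"
  using sing by (auto simp: singular_of_weight_def singular_def)

lemma wt_fw: "b \<in> keys (fw w x) \<Longrightarrow> wt b j = word_weight \<Lambda> w j"
proof (induction w arbitrary: b)
  case Nil
  then show ?case using wt_x by (simp add: word_weight_def)
next
  case (Cons i w)
  then obtain b' where b': "b' \<in> keys (fw w x)" "b \<in> keys (f i (single b' 1))"
    using lin_keys_le[OF lin_f, of i "fw w x"] by auto
  moreover have "b' \<in> B" using b'(1) fw_closed[OF x_closed] by blast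
  ultimately have "wt b j = wt b' j - cartan j i" using f_basis_wt by blast
  then show ?case using Cons.IH[OF b'(1)] by (simp add: word_weight_def)
qed

lemma t_fw: "t j (fw w x) = sc (qq powi word_weight \<Lambda> w j) (fw w x)"
  unfolding t_def using wt_fw by (intro diag_eq_sc) simp

lemma tinv_fw: "tinv j (fw w x) = sc (qq powi (- word_weight \<Lambda> w j)) (fw w x)"
  unfolding tinv_def using wt_fw by (intro diag_eq_sc) simp

lemma e_fw: "e j (fw w x) = ev x (e_word \<Lambda> j w)"
proof (induction w)
  case Nil
  then show ?case by (simp add: e_x lin_zero[OF lin_ev])
next
  case (Cons i w)
  have "h 0 j (fw w x) = sc (qint (word_weight \<Lambda> w j)) (fw w x)"
    unfolding h_def using wt_fw by (intro diag_eq_sc) simp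
  then have "e j (fw (i # w) x) = ev x (prepend i (e_word \<Lambda> j w))
      + (if i = j then sc (qint (word_weight \<Lambda> w j)) (fw w x) else 0)"
    by (cases "i = j") (simp_all add: e_f fw_closed[OF x_closed] Cons f_ev)
  then show ?case by (simp add: lin_add[OF lin_ev] lin_zero[OF lin_ev]) (simp add: ev_def)
qed

lemma e_ev: "e j (ev x a) = ev x (lext (e_word \<Lambda> j) a)"
  unfolding lin_lext_compose[OF lin_ev]
  by (simp add: ev_def lin_lext_compose[OF lin_e] e_fw[unfolded ev_def])

lemma t_ev: "t j (ev x a) = ev x (diag (\<lambda>w. qq powi word_weight \<Lambda> w j) a)"
  unfolding diag_def lin_lext_compose[OF lin_ev]
  by (simp add: ev_def lin_lext_compose[OF lin_t] t_fw)

lemma tinv_ev: "tinv j (ev x a) = ev x (diag (\<lambda>w. qq powi (- word_weight \<Lambda> w j)) a)"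
  unfolding diag_def lin_lext_compose[OF lin_ev]
  by (simp add: ev_def lin_lext_compose[OF lin_tinv] tinv_fw)

lemma ip_fw: "ip (fw w x) (fw w' x) = gram \<Lambda> w w' * ip x x"
proof (induction w arbitrary: w')
  case Nil
  show ?case
  proof (cases w')
    case (Cons j u)
    then show ?thesis using singular_orthogonal[OF fw_closed[OF x_closed] x_singular, of j u]
      by (simp add: ip_commute[of x "f j (fw u x)"])
  qed simp
next
  case (Cons j w)
  have "ip (fw (j # w) x) (fw w' x) = inverse qq * ip (t j (fw w x)) (e j (fw w' x))"
    using adj_f[OF fw_closed[OF x_closed] fw_closed[OF x_closed]] by (simp only: fw_simps)
  also have "\<dots> = inverse qq * qq powi word_weight \<Lambda> w j * ip (fw w x) (ev x (e_word \<Lambda> j w'))"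
    by (simp add: t_fw e_fw ip_sc_left)
  also have "ip (fw w x) (ev x (e_word \<Lambda> j w'))
      = (\<Sum>u\<in>keys (e_word \<Lambda> j w'). lookup (e_word \<Lambda> j w') u * gram \<Lambda> w u) * ip x x"
    by (simp add: ev_def ip_lext_right Cons sum_distrib_right mult.assoc)
  finally show ?case by (simp add: mult.assoc)
qed

lemma ip_ev: "ip (ev x a) (ev x a) = gram_norm \<Lambda> a * ip x x"
proof -
  have "ip (ev x a) (ev x a)
      = (\<Sum>w\<in>keys a. \<Sum>w'\<in>keys a. lookup a w * (lookup a w' * ip (fw w x) (fw w' x)))"
    unfolding ev_def by (subst ip_lext_left) (simp add: ip_lext_right sum_distrib_left)
  then show ?thesis by (simp add: ip_fw gram_norm_def sum_distrib_left sum_distrib_right mult_ac)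
qed

lemma ev_eq_0_iff: "x \<noteq> 0 \<Longrightarrow> ev x a = 0 \<longleftrightarrow> gram_norm \<Lambda> a = 0"
  using ip_ev[of a] ip_self_eq_0[of "ev x a"] ip_self_eq_0[of x] by simp

lemma x_in_range_ev: "x \<in> range (ev x)"
  using lext_single[of "\<lambda>w. fw w x" "[]" 1, folded ev_def] by (metis fw_simps(1) rangeI sc_simps(3))

lemma range_ev_submodule: "uq_submodule rep (range (ev x))"
proof -
  have "module.subspace sc (range (ev x))"
    unfolding subspace_sc_iff
    by (auto simp flip: lin_add[OF lin_ev] lin_sc[OF lin_ev] intro!: range_eqI[of 0 "ev x" 0]
        simp: lin_zero[OF lin_ev])
  then show ?thesis
    using ev_closed[OF x_closed] by (auto simp: uq_submodule_def rep_def e_ev f_ev t_ev tinv_ev)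
qed

lemma range_ev_minimal: "uq_submodule rep U \<Longrightarrow> x \<in> U \<Longrightarrow> range (ev x) \<subseteq> U"
proof
  fix y assume U: "uq_submodule rep U" "x \<in> U" and "y \<in> range (ev x)"
  then obtain a where y: "y = ev x a" by auto
  have cl: "0 \<in> U" "\<And>u v. u \<in> U \<Longrightarrow> v \<in> U \<Longrightarrow> u + v \<in> U" "\<And>c u. u \<in> U \<Longrightarrow> sc c u \<in> U"
    "\<And>j u. u \<in> U \<Longrightarrow> f j u \<in> U"
    using U by (auto simp: uq_submodule_def rep_def subspace_sc_iff)
  have "fw w x \<in> U" for w by (induction w) (use U cl in auto)
  then have "(\<Sum>w\<in>A. sc (lookup a w) (fw w x)) \<in> U" for A
    by (induction A rule: infinite_finite_induct) (use cl in auto)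
  then show "y \<in> U" by (simp add: y ev_def lext_def)
qed

lemma generated_singular: "uq_generated rep {x} = range (ev x)"
  unfolding uq_generated_def
  using range_ev_submodule range_ev_minimal x_in_range_ev by (intro equalityI) blast+

text \<open>
  Subtracting a multiple of \<open>x\<close> leaves a singular vector in the span of the images of the \<open>f j\<close>. Singular
  vectors are orthogonal to these images, so the difference vanishes.
\<close>

lemma singular_in_range_ev:
  assumes z: "singular z" "z \<in> range (ev x)"
  shows "\<exists>c. z = sc c x"
proof -
  obtain a where a: "z = ev x a" using z by auto
  define a' where "a' = a - single [] (lookup a [])"
  define z' where "z' = z - sc (lookup a []) x"
  have z': "z' = ev x a'"
    unfolding z'_def a'_def lin_diff[OF lin_ev] a by (simp add: ev_def)
  have sing': "singular z'"
    using z(1) x_singular unfolding singular_def z'_def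
    by (intro conjI keys_subset_diff keys_subset_sc allI) (auto simp: linearity)
  have "ip (fw w x) z' = 0" if w: "w \<in> keys a'" for w
  proof -
    have "w \<noteq> []" using w by (auto simp: a'_def in_keys_iff lookup_minus)
    then obtain j u where "w = j # u" by (cases w) auto
    then show ?thesis using singular_orthogonal[OF fw_closed[OF x_closed] sing'] by simp
  qed
  then have "ip (ev x a') z' = 0" by (simp add: ev_def ip_lext_left)
  then have "z' = 0" by (simp add: z')
  then show ?thesis unfolding z'_def by auto
qed

end

end

context graded_contravariant
begin

text \<open>Apply operators \<open>e k\<close> as long as the result is non-zero; the degree bounds the number of steps.\<close>

lemma singular_vector_exists:
  assumes U: "\<And>k y. y \<in> U \<Longrightarrow> e k y \<in> U" and y: "y \<in> U" "keys y \<subseteq> B" "y \<noteq> 0"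
  shows "\<exists>z\<in>U. z \<noteq> 0 \<and> singular z"
proof -
  have "y \<in> U \<Longrightarrow> y \<noteq> 0 \<Longrightarrow> keys y \<subseteq> {b \<in> B. deg b < n} \<Longrightarrow> \<exists>z\<in>U. z \<noteq> 0 \<and> singular z" for n y
  proof (induction n arbitrary: y)
    case 0
    then have "y = 0" by simp
    then show ?case using 0 by simp
  next
    case (Suc n)
    show ?case
    proof (cases "\<forall>k. e k y = 0")
      case True
      then have "singular y" using Suc.prems by (auto simp: singular_def)
      then show ?thesis using Suc.prems by blast
    next
      case False
      then obtain k where "e k y \<noteq> 0" by blast
      then show ?thesis using Suc.IH[of "e k y"] U Suc.prems e_lowers by blast
    qed
  qed
  then show ?thesis using y degree_bound[OF y(2)] by blast
qed

text \<open>A non-zero submodule contains a singular vector, that is, a multiple of the generator \<open>x\<close>.\<close>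

lemma irreducible_range_ev:
  assumes x: "singular_of_weight \<Lambda> x" "x \<noteq> 0"
  shows "irreducible_highest_weight (rep\<lparr>uq_carrier := range (ev x)\<rparr>) \<Lambda>"
proof -
  let ?M = "rep\<lparr>uq_carrier := range (ev x)\<rparr>"
  note sub = range_ev_submodule[OF x(1)] and min = range_ev_minimal[OF x(1)]
  have le: "range (ev x) \<subseteq> uq_carrier rep" using sub by (simp add: uq_submodule_def)
  have 1: "uq_module ?M" by (rule uq_module_restrict[OF uq_module_rep sub])
  have xin: "x \<in> range (ev x)" by (rule x_in_range_ev[OF x(1)])
  have 2: "uq_generated ?M {x} = range (ev x)"
    unfolding uq_generated_def uq_submodule_restrict[OF le]
    using sub min xin by (intro equalityI) blast+
  have 3: "U = {0} \<or> U = range (ev x)" if U: "U \<subseteq> range (ev x)" "uq_submodule rep U" for U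
  proof (cases "\<exists>y\<in>U. y \<noteq> 0")
    case True
    then obtain y where y: "y \<in> U" "y \<noteq> 0" by blast
    have cl: "0 \<in> U" "\<And>u v. u \<in> U \<Longrightarrow> v \<in> U \<Longrightarrow> u + v \<in> U" "\<And>c u. u \<in> U \<Longrightarrow> sc c u \<in> U"
      "\<And>j u. u \<in> U \<Longrightarrow> e j u \<in> U" "\<And>u. u \<in> U \<Longrightarrow> keys u \<subseteq> B"
      using U by (auto simp: uq_submodule_def rep_def subspace_sc_iff)
    obtain z where z: "z \<in> U" "z \<noteq> 0" "singular z"
      using singular_vector_exists[OF cl(4) y(1) cl(5)[OF y(1)] y(2)] by blast
    then obtain c where c: "z = sc c x" using singular_in_range_ev[OF x(1)] U(1) by blast
    then have "c \<noteq> 0" using z by auto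
    then have "x = sc (1 / c) z" by (simp add: c)
    then have "x \<in> U" using cl(3)[OF z(1)] by metis
    then show ?thesis using min[OF U(2)] U(1) by blast
  next
    case False
    moreover have "0 \<in> U" using U by (simp add: uq_submodule_def rep_def subspace_sc_iff)
    ultimately show ?thesis by blast
  qed
  have "t j x = sc (qq powi \<Lambda> j) x" for j
    using t_fw[OF x(1), of j "[]"] by (simp add: word_weight_def)
  then have "\<exists>y\<in>uq_carrier ?M. y \<noteq> 0 \<and> (\<forall>j. uq_e ?M j y = 0) \<and>
        (\<forall>j. uq_t ?M j y = uq_scale ?M (qq powi \<Lambda> j) y) \<and>
        uq_generated ?M {y} = uq_carrier ?M"
    using 2 x xin e_x[OF x(1)] by (intro bexI[of _ x]) (auto simp: rep_def)
  then show ?thesis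
    unfolding irreducible_highest_weight_def using 1 3 uq_submodule_restrict[OF le] by auto
qed

text \<open>
  By induction on the degree bound \<open>n\<close>, a vector of degree below \<open>n\<close> that is orthogonal to the part of \<open>U\<close>
  of degree below \<open>n\<close> is zero: the \<open>e j\<close> take it to vectors of the same kind with a smaller bound, so
  it is singular, hence in \<open>U\<close> and orthogonal to itself. Since the parts of bounded degree are
  finite-dimensional, orthogonal projection to \<open>U\<close> then shows that \<open>U\<close> contains everything.
\<close>

lemma submodule_with_all_singular:
  assumes U: "uq_submodule rep U" and sing: "\<And>z. singular z \<Longrightarrow> z \<in> U"
  shows "U = uq_carrier rep"
proof
  show "U \<subseteq> uq_carrier rep" using U by (simp add: uq_submodule_def)
  have cl: "0 \<in> U" "\<And>u v. u \<in> U \<Longrightarrow> v \<in> U \<Longrightarrow> u + v \<in> U" "\<And>c u. u \<in> U \<Longrightarrow> sc c u \<in> U"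
    "\<And>j u. u \<in> U \<Longrightarrow> f j u \<in> U" "\<And>j u. u \<in> U \<Longrightarrow> tinv j u \<in> U" "\<And>u. u \<in> U \<Longrightarrow> keys u \<subseteq> B"
    using U by (auto simp: uq_submodule_def rep_def subspace_sc_iff)
  define D where "D n = {b \<in> B. deg b < n}" for n
  have perp: "y = 0" if "keys y \<subseteq> D n" "\<And>u. u \<in> U \<Longrightarrow> keys u \<subseteq> D n \<Longrightarrow> ip y u = 0" for n y
    using that
  proof (induction n arbitrary: y)
    case 0
    then show ?case by (simp add: D_def)
  next
    case (Suc n)
    have y: "keys y \<subseteq> B" using Suc.prems(1) by (auto simp: D_def)
    have "e k y = 0" for k
    proof (rule Suc.IH)
      show "keys (e k y) \<subseteq> D n" using Suc.prems(1) e_lowers unfolding D_def by blast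
      fix u assume u: "u \<in> U" "keys u \<subseteq> D n"
      have "keys (tinv k u) \<subseteq> D n" using u(2) unfolding tinv_def by (rule order_trans[OF keys_diag])
      then have "keys (f k (tinv k u)) \<subseteq> D (Suc n)" using f_raises unfolding D_def by blast
      then have "ip y (f k (tinv k u)) = 0" using u cl by (intro Suc.prems(2)) auto
      then show "ip (e k y) u = 0" using adj_e[OF cl(6)[OF u(1)] y, of k] by simp
    qed
    then have "y \<in> U" using y by (intro sing) (simp add: singular_def)
    then have "ip y y = 0" using Suc.prems by blast
    then show ?case by simp
  qed
  show "uq_carrier rep \<subseteq> U"
  proof
    fix y assume "y \<in> uq_carrier rep"
    then obtain n where n: "keys y \<subseteq> D n" using degree_bound[of y] by (auto simp: rep_def D_def)
    let ?W = "{u \<in> U. keys u \<subseteq> D n}"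
    have "module.subspace sc ?W"
      using cl by (auto simp: subspace_sc_iff dest: keys_subset_add keys_subset_sc)
    moreover have "finite (D n)" using finite_deg by (simp add: D_def)
    ultimately have "\<exists>w\<in>?W. \<forall>u\<in>?W. ip (y - w) u = 0"
      by (intro orthogonal_projection[where S = "D n"]) auto
    then obtain w where w: "w \<in> ?W" "\<And>u. u \<in> ?W \<Longrightarrow> ip (y - w) u = 0" by blast
    have "y - w = 0"
    proof (rule perp[of _ n])
      show "keys (y - w) \<subseteq> D n" using n w(1) by (intro keys_subset_diff) auto
    qed (use w(2) in auto)
    then show "y \<in> U" using w by simp
  qed
qed

end

section \<open>Assembling a direct sum decomposition\<close>

lemma keys_subset_sum: "(\<And>i. i \<in> A \<Longrightarrow> keys (h i) \<subseteq> S) \<Longrightarrow> keys (sum h A) \<subseteq> S"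
  by (induction A rule: infinite_finite_induct) (simp_all add: keys_subset_add)

lemma lookup_mapp_if: "lookup (Poly_Mapping.mapp g x) i = (if i \<in> keys x then g i (lookup x i) else 0)"
  by (simp add: lookup_mapp when_def)

text \<open>All relations are checked in each component separately.\<close>

lemma uq_module_direct_sum:
  assumes mod: "\<And>i. i \<in> I \<Longrightarrow> uq_module (M i)" and vs: "\<And>i. vector_space (uq_scale (M i))"
  shows "uq_module (uq_direct_sum I M)"
proof -
  let ?D = "uq_direct_sum I M"
  have modM: "module (uq_scale (M i))" for i using vs by (simp add: module_iff_vector_space)
  have modM: "module (uq_scale (M i))" for i using vs by (simp add: module_iff_vector_space)
  have scale: "lookup (uq_scale ?D a x) i = uq_scale (M i) a (lookup x i)" for a x i
    using module.scale_zero_right[OF modM]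
    by (auto simp: uq_direct_sum_def lookup_mapp_if in_keys_iff)
  have vsD: "vector_space (uq_scale ?D)"
    by (rule vector_space.intro; (intro poly_mapping_eqI)?)
      (auto simp: scale lookup_add vector_space.vector_space_assms[OF vs])
  have modD: "module (uq_scale ?D)" using vsD by (simp add: module_iff_vector_space)
  have carrier: "x \<in> uq_carrier ?D \<longleftrightarrow> (\<forall>i\<in>I. lookup x i \<in> uq_carrier (M i)) \<and> (\<forall>i. i \<notin> I \<longrightarrow> lookup x i = 0)"
    for x by (auto simp: uq_direct_sum_def in_keys_iff)
  have sub: "module.subspace (uq_scale (M i)) (uq_carrier (M i))" if "i \<in> I" for i
    using uq_module.closed[OF mod[OF that]] by (simp add: uq_submodule_def)
  have z: "0 \<in> uq_carrier (M i)" if "i \<in> I" for i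
    using module.subspace_0[OF modM sub[OF that]] .
  have ops0: "uq_e (M i) j 0 = 0" "uq_f (M i) j 0 = 0" "uq_t (M i) j 0 = 0" "uq_tinv (M i) j 0 = 0"
    if "i \<in> I" for i j
    using uq_module.linear[OF mod[OF that], of j] z[OF that] module.scale_zero_left[OF modM, of i 0]
      module.scale_zero_left[OF modM, of i]
    unfolding linear_between_def by metis+
  have ops: "lookup (uq_e ?D j x) i = uq_e (M i) j (lookup x i)"
      "lookup (uq_f ?D j x) i = uq_f (M i) j (lookup x i)"
      "lookup (uq_t ?D j x) i = uq_t (M i) j (lookup x i)"
      "lookup (uq_tinv ?D j x) i = uq_tinv (M i) j (lookup x i)" if "i \<in> I" for i j x
    using ops0[OF that] by (auto simp: uq_direct_sum_def lookup_mapp_if in_keys_iff)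
  have out: "lookup (uq_e ?D j x) i = 0" "lookup (uq_f ?D j x) i = 0" "lookup (uq_t ?D j x) i = 0"
      "lookup (uq_tinv ?D j x) i = 0" if "i \<notin> I" "x \<in> uq_carrier ?D" for i j x
    using that by (auto simp: uq_direct_sum_def lookup_mapp_if in_keys_iff)
  have closedM: "uq_e (M i) j x \<in> uq_carrier (M i)" "uq_f (M i) j x \<in> uq_carrier (M i)"
      "uq_t (M i) j x \<in> uq_carrier (M i)" "uq_tinv (M i) j x \<in> uq_carrier (M i)"
    if "i \<in> I" "x \<in> uq_carrier (M i)" for i j x
    using uq_module.closed[OF mod[OF that(1)]] that(2) by (auto simp: uq_submodule_def)
  have closed: "uq_e ?D j x \<in> uq_carrier ?D" "uq_f ?D j x \<in> uq_carrier ?D"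
      "uq_t ?D j x \<in> uq_carrier ?D" "uq_tinv ?D j x \<in> uq_carrier ?D" if "x \<in> uq_carrier ?D" for j x
    using that ops out closedM unfolding carrier by auto
  have subD: "module.subspace (uq_scale ?D) (uq_carrier ?D)"
    unfolding module.subspace_def[OF modD]
    using z module.subspace_add[OF modM sub] module.subspace_scale[OF modM sub]
      module.scale_zero_right[OF modM]
    by (auto simp: carrier scale lookup_add)
  have linM: "linear_between (uq_carrier (M i)) (uq_scale (M i)) (uq_scale (M i)) (uq_e (M i) j)"
      "linear_between (uq_carrier (M i)) (uq_scale (M i)) (uq_scale (M i)) (uq_f (M i) j)"
      "linear_between (uq_carrier (M i)) (uq_scale (M i)) (uq_scale (M i)) (uq_t (M i) j)"
      "linear_between (uq_carrier (M i)) (uq_scale (M i)) (uq_scale (M i)) (uq_tinv (M i) j)"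
    if "i \<in> I" for i j
    using uq_module.linear[OF mod[OF that]] by auto
  have eqI: "x = y" if "\<And>i. i \<in> I \<Longrightarrow> lookup x i = lookup y i" "x \<in> uq_carrier ?D" "y \<in> uq_carrier ?D"
    for x y using that by (intro poly_mapping_eqI) (metis carrier)
  note cl = closed module.subspace_add[OF modD subD] module.subspace_scale[OF modD subD]
    module.subspace_diff[OF modD subD] module.subspace_0[OF modD subD]
  have inM: "lookup x i \<in> uq_carrier (M i)" if "x \<in> uq_carrier ?D" "i \<in> I" for x i
    using that by (simp add: carrier)
  have lin: "linear_between (uq_carrier ?D) (uq_scale ?D) (uq_scale ?D) T"
    if T: "\<And>x i. i \<in> I \<Longrightarrow> lookup (T x) i = S i (lookup x i)"
      and TC: "\<And>x. x \<in> uq_carrier ?D \<Longrightarrow> T x \<in> uq_carrier ?D"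
      and L: "\<And>i. i \<in> I \<Longrightarrow> linear_between (uq_carrier (M i)) (uq_scale (M i)) (uq_scale (M i)) (S i)"
    for T S
    unfolding linear_between_def
  proof (intro conjI ballI allI)
    fix x y a assume x: "x \<in> uq_carrier ?D"
    show "T (uq_scale ?D a x) = uq_scale ?D a (T x)"
    proof (rule eqI)
      show "lookup (T (uq_scale ?D a x)) i = lookup (uq_scale ?D a (T x)) i" if i: "i \<in> I" for i
        using L[OF i] inM[OF x i] by (simp add: T[OF i] scale linear_between_def)
    qed (intro cl TC x)+
    assume y: "y \<in> uq_carrier ?D"
    show "T (x + y) = T x + T y"
    proof (rule eqI)
      show "lookup (T (x + y)) i = lookup (T x + T y) i" if i: "i \<in> I" for i
        using L[OF i] inM[OF x i] inM[OF y i] by (simp add: T[OF i] lookup_add linear_between_def)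
    qed (intro cl TC x y)+
  qed
  note simps = ops lookup_add lookup_minus scale
  show ?thesis
  proof (rule uq_module.intro)
    show "linear_between (uq_carrier ?D) (uq_scale ?D) (uq_scale ?D) (uq_e ?D j)" for j
      by (rule lin[where S = "\<lambda>i. uq_e (M i) j"]) (use ops closed linM in auto)
    show "linear_between (uq_carrier ?D) (uq_scale ?D) (uq_scale ?D) (uq_f ?D j)" for j
      by (rule lin[where S = "\<lambda>i. uq_f (M i) j"]) (use ops closed linM in auto)
    show "linear_between (uq_carrier ?D) (uq_scale ?D) (uq_scale ?D) (uq_t ?D j)" for j
      by (rule lin[where S = "\<lambda>i. uq_t (M i) j"]) (use ops closed linM in auto)
    show "linear_between (uq_carrier ?D) (uq_scale ?D) (uq_scale ?D) (uq_tinv ?D j)" for j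
      by (rule lin[where S = "\<lambda>i. uq_tinv (M i) j"]) (use ops closed linM in auto)
    show "uq_submodule ?D (uq_carrier ?D)" using subD closed by (auto simp: uq_submodule_def)
    fix x i j assume x: "x \<in> uq_carrier ?D"
    show "uq_t ?D j (uq_tinv ?D j x) = x" "uq_tinv ?D j (uq_t ?D j x) = x"
      "uq_t ?D i (uq_t ?D j x) = uq_t ?D j (uq_t ?D i x)"
      "uq_t ?D i (uq_e ?D j (uq_tinv ?D i x)) = uq_scale ?D (qq powi cartan i j) (uq_e ?D j x)"
      "uq_t ?D i (uq_f ?D j (uq_tinv ?D i x)) = uq_scale ?D (qq powi (- cartan i j)) (uq_f ?D j x)"
      by (rule eqI, simp_all add: simps uq_module.t_inverse[OF mod] uq_module.t_t[OF mod]
          uq_module.t_e[OF mod] uq_module.t_f[OF mod] inM x cl)+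
    have "uq_e ?D i (uq_f ?D i x) - uq_f ?D i (uq_e ?D i x) =
        uq_scale ?D (1 / (qq - inverse qq)) (uq_t ?D i x - uq_tinv ?D i x)"
      by (rule eqI, simp_all add: simps uq_module.e_f[OF mod] inM x cl)
    moreover have "uq_e ?D i (uq_f ?D j x) - uq_f ?D j (uq_e ?D i x) = 0" if "i \<noteq> j"
      by (rule eqI, simp_all add: simps uq_module.e_f[OF mod] inM x cl that del: right_minus_eq)
    ultimately show "uq_e ?D i (uq_f ?D j x) - uq_f ?D j (uq_e ?D i x) =
        (if i = j then uq_scale ?D (1 / (qq - inverse qq)) (uq_t ?D i x - uq_tinv ?D i x) else 0)"
      by (cases "i = j") simp_all
    show "uq_e ?D i (uq_e ?D j x) = uq_e ?D j (uq_e ?D i x)"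
      "uq_f ?D i (uq_f ?D j x) = uq_f ?D j (uq_f ?D i x)" if "\<bar>i - j\<bar> > 1"
      using uq_module.serre_far[OF mod inM[OF x] that]
      by (rule_tac [!] eqI) (simp_all add: simps x cl)
    show "uq_e ?D i (uq_e ?D i (uq_e ?D j x))
        - uq_scale ?D (qq + inverse qq) (uq_e ?D i (uq_e ?D j (uq_e ?D i x)))
        + uq_e ?D j (uq_e ?D i (uq_e ?D i x)) = 0"
      "uq_f ?D i (uq_f ?D i (uq_f ?D j x))
        - uq_scale ?D (qq + inverse qq) (uq_f ?D i (uq_f ?D j (uq_f ?D i x)))
        + uq_f ?D j (uq_f ?D i (uq_f ?D i x)) = 0" if "\<bar>i - j\<bar> = 1"
      by (rule eqI, simp_all add: simps uq_module.serre_near[OF mod] inM x that cl)+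
  qed (rule vsD)
qed

lemma uq_isomorphicI_inverse:
  assumes mod: "uq_module M" "uq_module N" and bij: "bij_betw \<Phi> (uq_carrier N) (uq_carrier M)"
    and lin: "linear_between (uq_carrier N) (uq_scale N) (uq_scale M) \<Phi>"
    and int: "\<And>j x. x \<in> uq_carrier N \<Longrightarrow> \<Phi> (uq_e N j x) = uq_e M j (\<Phi> x)"
      "\<And>j x. x \<in> uq_carrier N \<Longrightarrow> \<Phi> (uq_f N j x) = uq_f M j (\<Phi> x)"
      "\<And>j x. x \<in> uq_carrier N \<Longrightarrow> \<Phi> (uq_t N j x) = uq_t M j (\<Phi> x)"
      "\<And>j x. x \<in> uq_carrier N \<Longrightarrow> \<Phi> (uq_tinv N j x) = uq_tinv M j (\<Phi> x)"
  shows "uq_isomorphic M N"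
proof -
  define \<Psi> where "\<Psi> = inv_into (uq_carrier N) \<Phi>"
  have bij': "bij_betw \<Psi> (uq_carrier M) (uq_carrier N)"
    unfolding \<Psi>_def by (rule bij_betw_inv_into[OF bij])
  have \<Phi>\<Psi>: "\<Phi> (\<Psi> x) = x" and \<Psi>in: "\<Psi> x \<in> uq_carrier N" if "x \<in> uq_carrier M" for x
    using that bij bij' unfolding \<Psi>_def
    by (auto simp: bij_betw_inv_into_right dest: bij_betwE)
  have \<Psi>\<Phi>: "\<Psi> y = z" if "y = \<Phi> z" "z \<in> uq_carrier N" for y z
    using that bij unfolding \<Psi>_def by (simp add: bij_betw_inv_into_left)
  have sub: "uq_submodule N (uq_carrier N)" by (rule uq_module.closed[OF mod(2)])
  have modN: "module (uq_scale N)"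
    using uq_module.vector_space[OF mod(2)] by (simp add: module_iff_vector_space)
  have cl: "uq_e N j z \<in> uq_carrier N" "uq_f N j z \<in> uq_carrier N" "uq_t N j z \<in> uq_carrier N"
    "uq_tinv N j z \<in> uq_carrier N" "uq_scale N a z \<in> uq_carrier N"
    "z' \<in> uq_carrier N \<Longrightarrow> z + z' \<in> uq_carrier N"
    if "z \<in> uq_carrier N" for j z z' a
    using that sub module.subspace_add[OF modN] module.subspace_scale[OF modN]
    by (auto simp: uq_submodule_def)
  show ?thesis
    unfolding uq_isomorphic_def
  proof (intro conjI exI[of _ \<Psi>] mod bij' allI ballI)
    show "linear_between (uq_carrier M) (uq_scale M) (uq_scale N) \<Psi>"
      using lin unfolding linear_between_def by (intro conjI ballI allI \<Psi>\<Phi>) (simp_all add: \<Phi>\<Psi> \<Psi>in cl)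
  qed (rule \<Psi>\<Phi>; simp add: int \<Phi>\<Psi> \<Psi>in cl)+
qed

text \<open>
  The map \<open>\<phi> i\<close> sends \<open>f\<^sub>w (vac i)\<close> to \<open>f\<^sub>w (hw i)\<close>. It is well defined because for singular vectors of the
  same weight the same combinations of the \<open>f\<^sub>w\<close> annihilate both. The sum \<open>\<Phi>\<close> of these maps is
  surjective because its image is a submodule with all singular vectors. If its kernel were not zero,
  it would contain a non-zero vector killed by all \<open>e j\<close>; the components of such a vector are multiples of
  the \<open>vac i\<close>, so there would be a linear relation between the \<open>hw i\<close>.
\<close>

theorem decomposition_from_singular_basis:
  fixes B :: "'b set" and B' :: "'i \<Rightarrow> 'c set"
    and hw :: "'i \<Rightarrow> 'b \<Rightarrow>\<^sub>0 ratfun" and vac :: "'i \<Rightarrow> 'c \<Rightarrow>\<^sub>0 ratfun"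
  assumes F: "graded_contravariant B e f wt deg"
    and F': "\<And>i. i \<in> I \<Longrightarrow> graded_contravariant (B' i) (e' i) (f' i) (wt' i) (deg' i)"
    and vac: "\<And>i. i \<in> I \<Longrightarrow> contravariant.singular_of_weight (B' i) (e' i) (wt' i) (\<Lambda> i) (vac i)"
      "\<And>i. i \<in> I \<Longrightarrow> vac i \<noteq> 0"
    and hw: "\<And>i. i \<in> I \<Longrightarrow> contravariant.singular_of_weight B e wt (\<Lambda> i) (hw i)"
    and indep: "\<And>c. keys c \<subseteq> I \<Longrightarrow> lext hw c = 0 \<Longrightarrow> c = 0"
    and span: "\<And>z. contravariant.singular B e z \<Longrightarrow> \<exists>c. keys c \<subseteq> I \<and> z = lext hw c"
    and M: "\<And>i. i \<in> I \<Longrightarrow> M i = (contravariant.rep (B' i) (e' i) (f' i) (wt' i))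
        \<lparr>uq_carrier := range (contravariant.ev (f' i) (vac i))\<rparr>"
    and vs: "\<And>i. vector_space (uq_scale (M i))"
  shows "uq_isomorphic (contravariant.rep B e f wt) (uq_direct_sum I M)"
proof -
  interpret graded_contravariant B e f wt deg by (rule F)
  let ?D = "uq_direct_sum I M"
  let ?ev = "\<lambda>i. contravariant.ev (f' i) (vac i)"
  have C': "contravariant (B' i) (e' i) (f' i) (wt' i)" if "i \<in> I" for i
    using F'[OF that] by (simp add: graded_contravariant_def)
  have hw0: "hw i \<noteq> 0" if "i \<in> I" for i
  proof
    assume "hw i = 0"
    then have "single i 1 = (0 :: 'i \<Rightarrow>\<^sub>0 ratfun)" using that by (intro indep) auto
    then show False by (metis lookup_single_eq lookup_zero zero_neq_one)
  qed
  have linev': "lin (?ev i)" if "i \<in> I" for i by (rule contravariant.lin_ev[OF C'[OF that]])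
  have kernel: "ev (hw i) a = ev (hw i) b" if i: "i \<in> I" and eq: "?ev i a = ?ev i b" for i a b
  proof -
    have k: "?ev i a = 0 \<longleftrightarrow> ev (hw i) a = 0" for a
      using contravariant.ev_eq_0_iff[OF C'[OF i] vac(1)[OF i] vac(2)[OF i]]
        ev_eq_0_iff[OF hw[OF i] hw0[OF i]] by simp
    show ?thesis
      using k[of "a - b"] eq by (simp add: lin_diff[OF linev'[OF i]] lin_diff[OF lin_ev])
  qed
  define \<phi> where "\<phi> i y = ev (hw i) (SOME a. ?ev i a = y)" for i y
  have \<phi>: "\<phi> i (?ev i a) = ev (hw i) a" if "i \<in> I" for i a
    unfolding \<phi>_def by (rule kernel[OF that]) (rule someI[of _ a], simp)
  have \<phi>0: "\<phi> i 0 = 0" if "i \<in> I" for i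
    using \<phi>[OF that, of 0] by (simp add: lin_zero[OF linev'[OF that]] lin_zero[OF lin_ev])
  define \<Phi> where "\<Phi> z = (\<Sum>i\<in>keys z. \<phi> i (lookup z i))" for z
  have carrier: "z \<in> uq_carrier ?D \<longleftrightarrow> keys z \<subseteq> I \<and> (\<forall>i\<in>I. lookup z i \<in> range (?ev i))" for z
    by (auto simp: uq_direct_sum_def M)
  have \<Phi>_superset: "\<Phi> z = (\<Sum>i\<in>A. \<phi> i (lookup z i))" if "finite A" "keys z \<subseteq> A" "A \<subseteq> I" for z A
    unfolding \<Phi>_def using that \<phi>0 by (intro sum.mono_neutral_left) (auto simp: in_keys_iff)
  have scale: "lookup (uq_scale ?D a z) i = sc a (lookup z i)" if "i \<in> I" for a z i
    using M[OF that] contravariant.rep_def[OF C'[OF that]]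
    by (auto simp: uq_direct_sum_def lookup_mapp_if in_keys_iff)
  have scale_keys: "keys (uq_scale ?D a z) \<subseteq> keys z" for a z
    by (simp add: uq_direct_sum_def keys_mapp_subset)
  have ops0: "e' i j 0 = 0" "f' i j 0 = 0" "contravariant.t (wt' i) j 0 = 0"
      "contravariant.tinv (wt' i) j 0 = 0" if "i \<in> I" for i j
    using contravariant.lin_e[OF C'[OF that]] contravariant.lin_f[OF C'[OF that]]
      contravariant.lin_t[OF C'[OF that]] contravariant.lin_tinv[OF C'[OF that]] by (auto intro: lin_zero)
  have ops: "lookup (uq_e ?D j z) i = e' i j (lookup z i)" "lookup (uq_f ?D j z) i = f' i j (lookup z i)"
      "lookup (uq_t ?D j z) i = contravariant.t (wt' i) j (lookup z i)"
      "lookup (uq_tinv ?D j z) i = contravariant.tinv (wt' i) j (lookup z i)" if "i \<in> I" for j z i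
    using M[OF that] contravariant.rep_def[OF C'[OF that]] ops0[OF that]
    by (auto simp: uq_direct_sum_def lookup_mapp_if in_keys_iff)
  have ops_keys: "keys (uq_e ?D j z) \<subseteq> keys z" "keys (uq_f ?D j z) \<subseteq> keys z"
      "keys (uq_t ?D j z) \<subseteq> keys z" "keys (uq_tinv ?D j z) \<subseteq> keys z" for j z
    by (simp_all add: uq_direct_sum_def keys_mapp_subset)
  have int: "\<phi> i (e' i j y) = e j (\<phi> i y)" "\<phi> i (f' i j y) = f j (\<phi> i y)"
      "\<phi> i (contravariant.t (wt' i) j y) = t j (\<phi> i y)"
      "\<phi> i (contravariant.tinv (wt' i) j y) = tinv j (\<phi> i y)"
    if i: "i \<in> I" and yy: "y \<in> range (?ev i)" for i j y
  proof -
    obtain a where y: "y = ?ev i a" using yy by auto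
    note c = C'[OF i] vac(1)[OF i]
    show "\<phi> i (e' i j y) = e j (\<phi> i y)" "\<phi> i (f' i j y) = f j (\<phi> i y)"
      "\<phi> i (contravariant.t (wt' i) j y) = t j (\<phi> i y)"
      "\<phi> i (contravariant.tinv (wt' i) j y) = tinv j (\<phi> i y)"
      unfolding y contravariant.e_ev[OF c] contravariant.f_ev[OF c(1)] contravariant.t_ev[OF c]
        contravariant.tinv_ev[OF c] \<phi>[OF i] e_ev[OF hw[OF i]] f_ev t_ev[OF hw[OF i]] tinv_ev[OF hw[OF i]]
      by (rule refl)+
  qed
  have modM: "uq_module (M i)" if "i \<in> I" for i
    unfolding M[OF that]
    by (rule uq_module_restrict[OF graded_contravariant.uq_module_rep[OF F'[OF that]]
          contravariant.range_ev_submodule[OF C'[OF that] vac(1)[OF that]]])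
  have modD: "uq_module ?D" by (rule uq_module_direct_sum[OF modM vs])
  have subD: "uq_submodule ?D (uq_carrier ?D)" by (rule uq_module.closed[OF modD])
  have mD: "module (uq_scale ?D)"
    using uq_module.vector_space[OF modD] by (simp add: module_iff_vector_space)
  have cl: "uq_e ?D j z \<in> uq_carrier ?D" "uq_f ?D j z \<in> uq_carrier ?D" "uq_t ?D j z \<in> uq_carrier ?D"
    "uq_tinv ?D j z \<in> uq_carrier ?D" "uq_scale ?D a z \<in> uq_carrier ?D"
    "z' \<in> uq_carrier ?D \<Longrightarrow> z + z' \<in> uq_carrier ?D" "z' \<in> uq_carrier ?D \<Longrightarrow> z - z' \<in> uq_carrier ?D"
    if "z \<in> uq_carrier ?D" for j z z' a
    using that subD module.subspace_add[OF mD] module.subspace_scale[OF mD] module.subspace_diff[OF mD]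
    by (auto simp: uq_submodule_def)
  have \<Phi>_int: "\<Phi> (uq_e ?D j z) = e j (\<Phi> z)" "\<Phi> (uq_f ?D j z) = f j (\<Phi> z)"
      "\<Phi> (uq_t ?D j z) = t j (\<Phi> z)" "\<Phi> (uq_tinv ?D j z) = tinv j (\<Phi> z)"
    if z: "z \<in> uq_carrier ?D" for j z
  proof -
    have k: "keys z \<subseteq> I" "\<And>i. i \<in> keys z \<Longrightarrow> lookup z i \<in> range (?ev i)" using z carrier by blast+
    have I: "i \<in> keys z \<Longrightarrow> i \<in> I" for i using k(1) by blast
    note S = \<Phi>_superset[OF finite_keys _ k(1)] \<Phi>_def[of z]
    show "\<Phi> (uq_e ?D j z) = e j (\<Phi> z)"
      unfolding S(1)[OF ops_keys(1)] S(2) lin_sum[OF lin_e] by (intro sum.cong refl) (simp add: ops int I k)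
    show "\<Phi> (uq_f ?D j z) = f j (\<Phi> z)"
      unfolding S(1)[OF ops_keys(2)] S(2) lin_sum[OF lin_f] by (intro sum.cong refl) (simp add: ops int I k)
    show "\<Phi> (uq_t ?D j z) = t j (\<Phi> z)"
      unfolding S(1)[OF ops_keys(3)] S(2) lin_sum[OF lin_t] by (intro sum.cong refl) (simp add: ops int I k)
    show "\<Phi> (uq_tinv ?D j z) = tinv j (\<Phi> z)"
      unfolding S(1)[OF ops_keys(4)] S(2) lin_sum[OF lin_tinv] by (intro sum.cong refl) (simp add: ops int I k)
  qed
  have \<phi>_add: "\<phi> i (y + y') = \<phi> i y + \<phi> i y'" and \<phi>_sc: "\<phi> i (sc a y) = sc a (\<phi> i y)"
    if i: "i \<in> I" and yy: "y \<in> range (?ev i)" "y' \<in> range (?ev i)" for i y y' a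
  proof -
    obtain b b' where y: "y = ?ev i b" "y' = ?ev i b'" using yy by auto
    show "\<phi> i (y + y') = \<phi> i y + \<phi> i y'" "\<phi> i (sc a y) = sc a (\<phi> i y)"
      unfolding y lin_add[OF linev'[OF i], symmetric] lin_sc[OF linev'[OF i], symmetric] \<phi>[OF i]
      by (simp_all add: lin_add[OF lin_ev] lin_sc[OF lin_ev])
  qed
  have \<Phi>_add: "\<Phi> (z + z') = \<Phi> z + \<Phi> z'" if z: "z \<in> uq_carrier ?D" "z' \<in> uq_carrier ?D" for z z'
  proof -
    let ?A = "keys z \<union> keys z'"
    have A: "?A \<subseteq> I" "finite ?A" using z carrier by auto
    have I: "i \<in> ?A \<Longrightarrow> i \<in> I" for i using A by blast
    have r: "lookup z i \<in> range (?ev i)" "lookup z' i \<in> range (?ev i)" if "i \<in> ?A" for i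
      using z I[OF that] carrier by blast+
    show ?thesis
      unfolding \<Phi>_superset[OF A(2) keys_add A(1)] \<Phi>_superset[OF A(2) Un_upper1 A(1)]
        \<Phi>_superset[OF A(2) Un_upper2 A(1)] sum.distrib[symmetric]
      by (intro sum.cong refl) (simp only: lookup_add \<phi>_add[OF I r])
  qed
  have \<Phi>_sc: "\<Phi> (uq_scale ?D a z) = sc a (\<Phi> z)" if z: "z \<in> uq_carrier ?D" for a z
  proof -
    have k: "keys z \<subseteq> I" "\<And>i. i \<in> keys z \<Longrightarrow> lookup z i \<in> range (?ev i)" using z carrier by blast+
    have I: "i \<in> keys z \<Longrightarrow> i \<in> I" for i using k(1) by blast
    show ?thesis
      unfolding \<Phi>_superset[OF finite_keys scale_keys k(1)] \<Phi>_def[of z] sc_sum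
      by (intro sum.cong refl) (simp add: scale I \<phi>_sc[OF I k(2) k(2)])
  qed
  have \<Phi>_closed: "\<Phi> z \<in> uq_carrier rep" if z: "z \<in> uq_carrier ?D" for z
  proof -
    have "keys (\<phi> i (lookup z i)) \<subseteq> B" if "i \<in> I" for i
      unfolding \<phi>_def by (rule ev_closed[OF x_closed[OF hw[OF that]]])
    then have "keys (\<Phi> z) \<subseteq> B"
      unfolding \<Phi>_def using z carrier by (intro keys_subset_sum) blast
    then show ?thesis by (simp add: rep_def)
  qed
  have ev1: "?ev i (single [] a) = sc a (vac i)" "ev (hw i) (single [] a) = sc a (hw i)" if "i \<in> I" for i a
    using contravariant.ev_def[OF C'[OF that]] contravariant.fw_simps(1)[OF C'[OF that]]
    by (simp_all add: ev_def)
  \<comment> \<open>The \<open>e j\<close> lower the degree bound and preserve the kernel; so by induction they kill \<open>z\<close>, and the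
    components of \<open>z\<close> are singular, hence multiples of the vectors \<open>vac i\<close>.\<close>
  have kernel_0: "z = 0" if "z \<in> uq_carrier ?D" "\<Phi> z = 0"
      "\<And>i. i \<in> I \<Longrightarrow> keys (lookup z i) \<subseteq> {b \<in> B' i. deg' i b < n}" for z n
    using that
  proof (induction n arbitrary: z)
    case 0
    have "lookup z i = 0" for i
    proof (cases "i \<in> I")
      case True
      then show ?thesis using 0(3) by force
    next
      case False
      then show ?thesis using 0(1) carrier by (auto simp: in_keys_iff)
    qed
    then show ?case by (intro poly_mapping_eqI) simp
  next
    case (Suc n)
    have k: "keys z \<subseteq> I" "\<And>i. i \<in> I \<Longrightarrow> lookup z i \<in> range (?ev i)" using Suc.prems(1) carrier by blast+
    have ez: "uq_e ?D j z = 0" for j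
    proof (rule Suc.IH)
      show "uq_e ?D j z \<in> uq_carrier ?D" using cl Suc.prems by blast
      show "\<Phi> (uq_e ?D j z) = 0" using Suc.prems by (simp add: \<Phi>_int lin_zero[OF lin_e])
      show "keys (lookup (uq_e ?D j z) i) \<subseteq> {b \<in> B' i. deg' i b < n}" if "i \<in> I" for i
        unfolding ops[OF that]
        by (rule graded_contravariant.e_lowers[OF F'[OF that] Suc.prems(3)[OF that]])
    qed
    have "\<exists>c. lookup z i = sc c (vac i)" if i: "i \<in> I" for i
    proof (rule contravariant.singular_in_range_ev[OF C'[OF i] vac(1)[OF i] _ k(2)[OF i]])
      have "e' i j (lookup z i) = 0" for j using ops(1)[OF i, of j z] by (simp add: ez)
      then show "contravariant.singular (B' i) (e' i) (lookup z i)"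
        unfolding contravariant.singular_def[OF C'[OF i]] using Suc.prems(3)[OF i] by auto
    qed
    then obtain c where c: "\<And>i. i \<in> I \<Longrightarrow> lookup z i = sc (c i) (vac i)" by metis
    define c' where "c' = (\<Sum>i\<in>keys z. single i (c i))"
    have "\<Phi> z = (\<Sum>i\<in>keys z. \<phi> i (?ev i (single [] (c i))))"
      unfolding \<Phi>_def using k(1) by (intro sum.cong refl) (auto simp: c ev1)
    also have "\<dots> = (\<Sum>i\<in>keys z. sc (c i) (hw i))"
      using k(1) by (intro sum.cong refl) (auto simp: \<phi> ev1(2))
    also have "\<dots> = lext hw c'" by (simp add: c'_def lin_sum[OF lin_lext])
    finally have "lext hw c' = 0" using Suc.prems by simp
    moreover have "keys c' \<subseteq> I"
      unfolding c'_def by (rule keys_subset_sum) (use k(1) in auto)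
    ultimately have "c' = 0" using indep by blast
    have "lookup c' i = c i" if "i \<in> keys z" for i
    proof -
      have "lookup c' i = (\<Sum>i'\<in>keys z. if i' = i then c i' else 0)"
        unfolding c'_def lookup_sum by (intro sum.cong) (auto simp: lookup_single when_def)
      then show ?thesis using that by simp
    qed
    then have c0: "c i = 0" if "i \<in> keys z" for i using \<open>c' = 0\<close> that by simp
    show ?case
    proof (rule poly_mapping_eqI)
      fix i show "lookup z i = lookup 0 i"
      proof (cases "i \<in> keys z")
        case True
        then show ?thesis using c[of i] c0[of i] k(1) by auto
      qed (simp add: in_keys_iff)
    qed
  qed
  have inj: "z = 0" if z: "z \<in> uq_carrier ?D" "\<Phi> z = 0" for z
  proof -
    have k: "keys z \<subseteq> I" "\<And>i. i \<in> I \<Longrightarrow> lookup z i \<in> range (?ev i)" using z(1) carrier by blast+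
    have "\<exists>n. keys (lookup z i) \<subseteq> {b \<in> B' i. deg' i b < n}" if i: "i \<in> I" for i
    proof (rule graded_contravariant.degree_bound[OF F'[OF i]])
      show "keys (lookup z i) \<subseteq> B' i"
        using k(2)[OF i] contravariant.ev_closed[OF C'[OF i] contravariant.x_closed[OF C'[OF i] vac(1)[OF i]]]
        by (metis imageE)
    qed
    then obtain m where m: "\<And>i. i \<in> I \<Longrightarrow> keys (lookup z i) \<subseteq> {b \<in> B' i. deg' i b < m i}" by metis
    obtain n where n: "\<And>i. i \<in> keys z \<Longrightarrow> m i \<le> n"
      using finite_nat_set_iff_bounded_le[of "m ` keys z"] by auto
    have "keys (lookup z i) \<subseteq> {b \<in> B' i. deg' i b < n}" if "i \<in> I" for i
    proof (cases "i \<in> keys z")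
      case True
      then show ?thesis using order_trans[OF m[OF that]] n[OF True] by (auto intro: less_le_trans)
    qed (simp add: in_keys_iff)
    then show ?thesis using kernel_0 z by blast
  qed
  have "inj_on \<Phi> (uq_carrier ?D)"
  proof (rule inj_onI)
    fix z z' assume z: "z \<in> uq_carrier ?D" "z' \<in> uq_carrier ?D" and eq: "\<Phi> z = \<Phi> z'"
    have "\<Phi> z = \<Phi> (z - z') + \<Phi> z'" using \<Phi>_add[OF cl(7)[OF z] z(2)] by simp
    then have "z - z' = 0" using eq by (intro inj cl(7) z) simp
    then show "z = z'" by simp
  qed
  moreover have "\<Phi> ` uq_carrier ?D = uq_carrier rep"
  proof (rule submodule_with_all_singular)
    have "0 \<in> \<Phi> ` uq_carrier ?D"
      using module.subspace_0[OF mD, of "uq_carrier ?D"] subD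
      by (intro image_eqI[of _ _ 0]) (auto simp: uq_submodule_def \<Phi>_def)
    then show "uq_submodule rep (\<Phi> ` uq_carrier ?D)"
      unfolding uq_submodule_def
      using \<Phi>_closed by (auto simp: rep_def subspace_sc_iff cl intro!: imageI
          simp flip: \<Phi>_int \<Phi>_add \<Phi>_sc)
    fix x assume "singular x"
    then obtain c where c: "keys c \<subseteq> I" "x = lext hw c" using span by blast
    have I: "i \<in> keys c \<Longrightarrow> i \<in> I" for i using c by blast
    define z where "z = (\<Sum>i\<in>keys c. single i (sc (lookup c i) (vac i)))"
    have z: "lookup z i = sc (lookup c i) (vac i)" for i
    proof -
      have "lookup z i = (\<Sum>i'\<in>keys c. if i' = i then sc (lookup c i') (vac i') else 0)"
        unfolding z_def lookup_sum by (intro sum.cong) (auto simp: lookup_single when_def)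
      then show ?thesis by (simp add: in_keys_iff)
    qed
    have kz: "keys z \<subseteq> keys c" by (auto simp: in_keys_iff z)
    have "lookup z i \<in> range (?ev i)" if "i \<in> I" for i
      unfolding z using ev1(1)[OF that, symmetric] by (rule range_eqI)
    then have "z \<in> uq_carrier ?D" unfolding carrier using kz c(1) by blast
    moreover have "\<Phi> z = x"
      unfolding \<Phi>_superset[OF finite_keys kz c(1)] c(2) lext_def z
      by (intro sum.cong refl) (simp add: ev1(1)[symmetric] \<phi> ev1(2) I)
    ultimately show "x \<in> \<Phi> ` uq_carrier ?D" by blast
  qed
  ultimately have bij: "bij_betw \<Phi> (uq_carrier ?D) (uq_carrier rep)" by (simp add: bij_betw_def)
  show ?thesis
  proof (rule uq_isomorphicI_inverse[OF uq_module_rep modD bij])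
    show "linear_between (uq_carrier ?D) (uq_scale ?D) (uq_scale rep) \<Phi>"
      by (simp add: linear_between_def \<Phi>_add \<Phi>_sc rep_def)
  qed (simp_all add: \<Phi>_int rep_def)
qed

section \<open>Bead configurations\<close>

text \<open>
  A configuration assigns a set of positions, the beads, to every component. The operators below act on
  the first \<open>l\<close> components only. Leaving the other components in place allows one to pass from \<open>l + 1\<close> to \<open>l\<close>
  components without changing the space.
\<close>

type_synonym config = "nat \<Rightarrow> int set"

definition nb :: "int \<Rightarrow> int set \<Rightarrow> int" where
  "nb j A = of_bool (j \<in> A) - of_bool (j + 1 \<in> A)"

definition up :: "int \<Rightarrow> int set \<Rightarrow> int set" where "up j A = insert (j + 1) (A - {j})"
definition dn :: "int \<Rightarrow> int set \<Rightarrow> int set" where "dn j A = insert j (A - {j + 1})"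

definition can_up :: "int \<Rightarrow> int set \<Rightarrow> bool" where "can_up j A \<longleftrightarrow> j \<in> A \<and> j + 1 \<notin> A"
definition can_dn :: "int \<Rightarrow> int set \<Rightarrow> bool" where "can_dn j A \<longleftrightarrow> j \<notin> A \<and> j + 1 \<in> A"

definition up_at :: "nat \<Rightarrow> int \<Rightarrow> config \<Rightarrow> config \<Rightarrow>\<^sub>0 ratfun" where
  "up_at c j X = (if can_up j (X c) then single (X(c := up j (X c))) 1 else 0)"
definition dn_at :: "nat \<Rightarrow> int \<Rightarrow> config \<Rightarrow> config \<Rightarrow>\<^sub>0 ratfun" where
  "dn_at c j X = (if can_dn j (X c) then single (X(c := dn j (X c))) 1 else 0)"

text \<open>
  In terms of beads, an addable or removable \<open>j\<close>-node of a component is a bead that can move from \<open>j\<close> to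
  \<open>j + 1\<close> or back. So \<open>nb j\<close> is the number of addable minus that of removable \<open>j\<close>-nodes, and the following
  are the operators \<open>f\<^sub>j\<close>, \<open>e\<^sub>j\<close> and the weight of the Fock space.
\<close>

definition fE :: "nat \<Rightarrow> int \<Rightarrow> (config \<Rightarrow>\<^sub>0 ratfun) \<Rightarrow> (config \<Rightarrow>\<^sub>0 ratfun)" where
  "fE l j = lext (\<lambda>X. \<Sum>c<l. sc (qq powi (\<Sum>c'\<in>{..<c}. nb j (X c'))) (up_at c j X))"
definition eE :: "nat \<Rightarrow> int \<Rightarrow> (config \<Rightarrow>\<^sub>0 ratfun) \<Rightarrow> (config \<Rightarrow>\<^sub>0 ratfun)" where
  "eE l j = lext (\<lambda>X. \<Sum>c<l. sc (qq powi (- (\<Sum>c'\<in>{c<..<l}. nb j (X c')))) (dn_at c j X))"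
definition wtE :: "nat \<Rightarrow> config \<Rightarrow> int \<Rightarrow> int" where
  "wtE l X j = (\<Sum>c<l. nb j (X c))"

lemma nb_up: "can_up j A \<Longrightarrow> nb i (up j A) = nb i A - cartan i j"
  and nb_dn: "can_dn j A \<Longrightarrow> nb i (dn j A) = nb i A + cartan i j"
  by (cases "i = j"; cases "i = j + 1"; cases "i = j - 1";
      auto simp: nb_def up_def dn_def can_up_def can_dn_def cartan_def)+

lemma nb_can_up: "can_up j A \<Longrightarrow> nb j A = 1" and nb_can_dn: "can_dn j A \<Longrightarrow> nb j A = - 1"
  and nb_neither: "\<not> can_up j A \<Longrightarrow> \<not> can_dn j A \<Longrightarrow> nb j A = 0"
  by (auto simp: nb_def can_up_def can_dn_def)

lemma dn_up: "can_up j A \<Longrightarrow> dn j (up j A) = A" and up_dn: "can_dn j A \<Longrightarrow> up j (dn j A) = A"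
  and can_dn_up: "can_up j A \<Longrightarrow> can_dn j (up j A)" and can_up_dn: "can_dn j A \<Longrightarrow> can_up j (dn j A)"
  by (auto simp: dn_def up_def can_up_def can_dn_def)

lemma sum_nb_update:
  assumes "finite S" "nb i A = nb i (X d) + k"
  shows "(\<Sum>c'\<in>S. nb i ((X(d := A)) c')) = (\<Sum>c'\<in>S. nb i (X c')) + (if d \<in> S then k else 0)"
proof (cases "d \<in> S")
  case True
  have "(\<Sum>c'\<in>S - {d}. nb i ((X(d := A)) c')) = (\<Sum>c'\<in>S - {d}. nb i (X c'))"
    by (rule sum.cong) auto
  then show ?thesis using assms True by (simp add: sum.remove[of S d])
next
  case False
  then have "(\<Sum>c'\<in>S. nb i ((X(d := A)) c')) = (\<Sum>c'\<in>S. nb i (X c'))" by (intro sum.cong) auto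
  then show ?thesis using False by simp
qed

lemmas sum_nb_up = sum_nb_update[where A = "up j (X d)" and X = X and d = d and k = "- cartan i j" for j X d i]
lemmas sum_nb_dn = sum_nb_update[where A = "dn j (X d)" and X = X and d = d and k = "cartan i j" for j X d i]

lemma cartan_sym: "cartan i j = cartan j i" by (auto simp: cartan_def)

text \<open>
  The contributions of a fixed pair of components to \<open>e i (f j X)\<close> and to \<open>f j (e i X)\<close>. They agree
  unless the components coincide and \<open>i = j\<close>.
\<close>

definition ef_term where
  "ef_term l i j X c d = sc (qq powi (\<Sum>c'\<in>{..<d}. nb j (X c')))
     (if can_up j (X d) then sc (qq powi (- (\<Sum>c'\<in>{c<..<l}. nb i ((X(d := up j (X d))) c'))))
        (dn_at c i (X(d := up j (X d)))) else 0)"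
definition fe_term where
  "fe_term l i j X c d = sc (qq powi (- (\<Sum>c'\<in>{c<..<l}. nb i (X c'))))
     (if can_dn i (X c) then sc (qq powi (\<Sum>c'\<in>{..<d}. nb j ((X(c := dn i (X c))) c')))
        (up_at d j (X(c := dn i (X c)))) else 0)"

lemma eE_fE_single: "eE l i (fE l j (single X 1)) = (\<Sum>c<l. \<Sum>d<l. ef_term l i j X c d)"
proof -
  have "eE l i (up_at d j X) = (if can_up j (X d) then (\<Sum>c<l. sc (qq powi (- (\<Sum>c'\<in>{c<..<l}.
      nb i ((X(d := up j (X d))) c')))) (dn_at c i (X(d := up j (X d))))) else 0)" for d
    by (simp add: eE_def up_at_def lin_zero[OF lin_lext])
  then show ?thesis
    unfolding fE_def lext_single
    by (subst sum.swap) (simp add: eE_def lin_sum[OF lin_lext] lin_sc[OF lin_lext],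
        intro sum.cong refl, auto simp: ef_term_def sc_sum)
qed

lemma fE_eE_single: "fE l j (eE l i (single X 1)) = (\<Sum>c<l. \<Sum>d<l. fe_term l i j X c d)"
proof -
  have "fE l j (dn_at c i X) = (if can_dn i (X c) then (\<Sum>d<l. sc (qq powi (\<Sum>c'\<in>{..<d}.
      nb j ((X(c := dn i (X c))) c'))) (up_at d j (X(c := dn i (X c))))) else 0)" for c
    by (simp add: fE_def dn_at_def lin_zero[OF lin_lext])
  then show ?thesis
    unfolding eE_def lext_single
    by (simp add: fE_def lin_sum[OF lin_lext] lin_sc[OF lin_lext])
      (intro sum.cong refl, auto simp: fe_term_def sc_sum)
qed

lemma ef_term_eq_fe_term:
  assumes "c < l" "d < l" "c \<noteq> d \<or> i \<noteq> j"
  shows "ef_term l i j X c d = fe_term l i j X c d"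
proof (cases "c = d")
  case False
  show ?thesis
  proof (cases "can_up j (X d) \<and> can_dn i (X c)")
    case True
    have 1: "(\<Sum>c'\<in>{c<..<l}. nb i ((X(d := up j (X d))) c'))
        = (\<Sum>c'\<in>{c<..<l}. nb i (X c')) + (if c < d then - cartan i j else 0)"
      using sum_nb_up[of "{c<..<l}" i j X d] True assms by (simp add: nb_up)
    have 2: "(\<Sum>c'\<in>{..<d}. nb j ((X(c := dn i (X c))) c'))
        = (\<Sum>c'\<in>{..<d}. nb j (X c')) + (if c < d then cartan i j else 0)"
      using sum_nb_dn[of "{..<d}" j i X c] True assms by (simp add: nb_dn cartan_sym)
    show ?thesis unfolding ef_term_def fe_term_def 1 2
      using True False
      by (simp add: dn_at_def up_at_def fun_upd_twist[of c d] add_diff_eq diff_add_eq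
          flip: power_int_add)
  qed (use False in \<open>auto simp: ef_term_def fe_term_def dn_at_def up_at_def\<close>)
next
  case True
  then have "i \<noteq> j" using assms by simp
  then have "can_up j (X c) \<and> can_dn i (up j (X c)) \<longleftrightarrow> can_dn i (X c) \<and> can_up j (dn i (X c))"
    and "can_up j (X c) \<Longrightarrow> can_dn i (up j (X c)) \<Longrightarrow> dn i (up j (X c)) = up j (dn i (X c))"
    by (auto simp: can_up_def can_dn_def up_def dn_def)
  moreover have "(\<Sum>c'\<in>{c<..<l}. nb i (if c' = c then A else X c')) = (\<Sum>c'\<in>{c<..<l}. nb i (X c'))"
    "(\<Sum>c'\<in>{..<c}. nb j (if c' = c then A else X c')) = (\<Sum>c'\<in>{..<c}. nb j (X c'))" for A
    by (auto intro!: sum.cong)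
  ultimately show ?thesis using True
    by (auto simp: ef_term_def fe_term_def dn_at_def up_at_def mult.commute)
qed

lemma ef_term_diagonal:
  assumes "c < l"
  shows "ef_term l j j X c c - fe_term l j j X c c
    = single X (qq powi (\<Sum>c'\<in>{..<c}. nb j (X c')) * qq powi (- (\<Sum>c'\<in>{c<..<l}. nb j (X c')))
        * qint (nb j (X c)))"
proof -
  have "(\<Sum>c'\<in>{c<..<l}. nb j (if c' = c then A else X c')) = (\<Sum>c'\<in>{c<..<l}. nb j (X c'))"
    "(\<Sum>c'\<in>{..<c}. nb j (if c' = c then A else X c')) = (\<Sum>c'\<in>{..<c}. nb j (X c'))" for A
    by (auto intro!: sum.cong)
  note sums = this[folded fun_upd_apply[abs_def]]
  consider "can_up j (X c)" "\<not> can_dn j (X c)" | "can_dn j (X c)" "\<not> can_up j (X c)"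
    | "\<not> can_up j (X c)" "\<not> can_dn j (X c)"
    by (auto simp: can_up_def can_dn_def)
  then show ?thesis
  proof cases
    case 1
    then show ?thesis
      by (simp add: ef_term_def fe_term_def dn_at_def can_dn_up dn_up nb_can_up sums)
  next
    case 2
    then show ?thesis
      by (simp add: ef_term_def fe_term_def up_at_def can_up_dn up_dn nb_can_dn qint_m1 sums mult.commute
          flip: single_uminus)
  qed (simp add: ef_term_def fe_term_def nb_neither)
qed

text \<open>A telescoping sum: by \<open>qint_add\<close> each summand is the contribution of one more component.\<close>

lemma qint_sum:
  fixes l :: nat
  shows "(\<Sum>c<l. qq powi (\<Sum>c'\<in>{..<c}. n c') * qq powi (- (\<Sum>c'\<in>{c<..<l}. n c')) * qint (n c))
    = qint (\<Sum>c<l. n c)"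
proof (induction l)
  case (Suc l)
  have "(\<Sum>c'\<in>{c<..<Suc l}. n c') = (\<Sum>c'\<in>{c<..<l}. n c') + n l" if "c < l" for c
  proof -
    have "{c<..<Suc l} = insert l {c<..<l}" using that by auto
    then show ?thesis by simp
  qed
  then have "(\<Sum>c<l. qq powi (\<Sum>c'\<in>{..<c}. n c') * qq powi (- (\<Sum>c'\<in>{c<..<Suc l}. n c')) * qint (n c))
    = (\<Sum>c<l. qq powi (\<Sum>c'\<in>{..<c}. n c') * qq powi (- (\<Sum>c'\<in>{c<..<l}. n c')) * qint (n c))
        * qq powi (- n l)"
    unfolding sum_distrib_right
    by (intro sum.cong refl) (simp add: power_int_diff power_int_minus field_simps)
  moreover have "{l<..<Suc l} = {}" by auto
  ultimately show ?case
    using Suc qint_add[of "n l" "\<Sum>c<l. n c"] by (simp add: algebra_simps)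
qed simp

lemma single_sum: "single k (sum h A) = (\<Sum>i\<in>A. single k (h i))"
  by (induction A rule: infinite_finite_induct) (auto simp: single_add)

lemma in_keys_sum_sc: "Z \<in> keys (\<Sum>c\<in>A. sc (a c) (h c)) \<Longrightarrow> \<exists>c\<in>A. Z \<in> keys (h c)"
  by (rule ccontr) (auto simp: in_keys_iff lookup_sum)

text \<open>
  In \<open>[e i, f j]\<close> the contributions of two different components cancel, because moving a bead in one of them
  changes the exponent of \<open>q\<close> in the other by the same amount on both sides. The diagonal
  contributions add up to a quantum integer by \<open>qint_sum\<close>.
\<close>

lemma contravariant_config: "contravariant UNIV (eE l) (fE l) (wtE l)"
proof
  show "lin (eE l j)" "lin (fE l j)" for j by (simp_all add: eE_def fE_def lin_lext)
  show "keys (fE l j (single b 1)) \<subseteq> UNIV" for j and b :: config by simp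
  show "b' \<in> UNIV \<and> (\<forall>i. wtE l b' i = wtE l b i + cartan i j)"
    if b': "b' \<in> keys (eE l j (single b 1))" for b b' :: config and j
  proof -
    have "b' \<in> keys (\<Sum>c<l. sc (qq powi (- (\<Sum>c'\<in>{c<..<l}. nb j (b c')))) (dn_at c j b))"
      using b' by (simp add: eE_def)
    then obtain c where c: "c < l" "b' \<in> keys (dn_at c j b)"
      by (auto dest: in_keys_sum_sc)
    then have "can_dn j (b c)" "b' = b(c := dn j (b c))"
      by (auto simp: dn_at_def split: if_splits)
    then show ?thesis
      using sum_nb_dn[of "{..<l}" _ j b c] c(1) by (simp add: wtE_def nb_dn)
  qed
  show "eE l i (fE l j (single X 1)) - fE l j (eE l i (single X 1))
      = (if i = j then single X (qint (wtE l X i)) else 0)" for i j and X :: config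
  proof (cases "i = j")
    case True
    have "eE l i (fE l j (single X 1)) - fE l j (eE l i (single X 1))
        = (\<Sum>c<l. \<Sum>d<l. ef_term l j j X c d - fe_term l j j X c d)"
      by (simp add: eE_fE_single fE_eE_single sum_subtractf True)
    also have "\<dots> = (\<Sum>c<l. \<Sum>d<l. if d = c then ef_term l j j X c c - fe_term l j j X c c else 0)"
      by (intro sum.cong refl) (auto simp: ef_term_eq_fe_term)
    also have "\<dots> = (\<Sum>c<l. ef_term l j j X c c - fe_term l j j X c c)"
      by (intro sum.cong refl) auto
    also have "\<dots> = single X (qint (wtE l X j))"
      unfolding wtE_def qint_sum[symmetric]
      by (simp add: ef_term_diagonal single_sum)
    finally show ?thesis using True by simp
  next
    case False
    then show ?thesis by (simp add: eE_fE_single fE_eE_single ef_term_eq_fe_term)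
  qed
  show "lookup (fE l j (single X 1)) Y = qq powi (wtE l X j - 1) * lookup (eE l j (single Y 1)) X"
    for X Y :: config and j
  proof -
    have "qq powi (\<Sum>c'\<in>{..<c}. nb j (X c')) * lookup (up_at c j X) Y = qq powi (wtE l X j - 1) *
        (qq powi (- (\<Sum>c'\<in>{c<..<l}. nb j (Y c'))) * lookup (dn_at c j Y) X)" if c: "c < l" for c
    proof (cases "can_up j (X c) \<and> Y = X(c := up j (X c))")
      case True
      then have 1: "can_dn j (Y c)" "Y(c := dn j (Y c)) = X" by (auto simp: can_dn_up dn_up)
      have split: "{..<l} = {..<c} \<union> insert c {c<..<l}" using c by auto
      have "wtE l X j = (\<Sum>c'\<in>{..<c}. nb j (X c')) + (\<Sum>c'\<in>insert c {c<..<l}. nb j (X c'))"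
        unfolding wtE_def split by (rule sum.union_disjoint) auto
      then have "wtE l X j = (\<Sum>c'\<in>{..<c}. nb j (X c')) + (nb j (X c) + (\<Sum>c'\<in>{c<..<l}. nb j (X c')))"
        by simp
      moreover have "(\<Sum>c'\<in>{c<..<l}. nb j (Y c')) = (\<Sum>c'\<in>{c<..<l}. nb j (X c'))"
        by (intro sum.cong) (auto simp: True)
      ultimately have "(\<Sum>c'\<in>{..<c}. nb j (X c')) = wtE l X j - 1 + (- (\<Sum>c'\<in>{c<..<l}. nb j (Y c')))"
        using True by (simp add: nb_can_up)
      then show ?thesis using True 1 by (simp add: up_at_def dn_at_def flip: power_int_add)
    next
      case False
      have "\<not> (can_dn j (Y c) \<and> X = Y(c := dn j (Y c)))"
      proof
        assume "can_dn j (Y c) \<and> X = Y(c := dn j (Y c))"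
        then have "can_up j (X c)" "Y = X(c := up j (X c))" by (auto simp: can_up_dn up_dn)
        then show False using False by simp
      qed
      then show ?thesis using False by (auto simp: up_at_def dn_at_def lookup_single when_def)
    qed
    then show ?thesis by (simp add: fE_def eE_def lookup_sum sum_distrib_left)
  qed
qed

interpretation config: contravariant UNIV "eE l" "fE l" "wtE l" for l
  by (rule contravariant_config)

section \<open>Leading terms of singular vectors\<close>

text \<open>
  Dominance is required of all initial segments of the components. In the language of crystals, and with a
  suitable rule for tensor products, the dominant configurations are the highest weight elements.
\<close>

definition occ :: "nat \<Rightarrow> config \<Rightarrow> int \<Rightarrow> nat" where
  "occ k X p = (\<Sum>c<k. of_bool (p \<in> X c))"

definition dominant :: "nat \<Rightarrow> config \<Rightarrow> bool" where
  "dominant l X \<longleftrightarrow> (\<forall>k\<le>l. \<forall>p. occ k X (p + 1) \<le> occ k X p)"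

text \<open>Bead sets of partitions contain all small and no large positions (Maya diagrams).\<close>

definition maya :: "int set \<Rightarrow> bool" where
  "maya A \<longleftrightarrow> (\<exists>m n. {..m} \<subseteq> A \<and> A \<subseteq> {..n})"

definition beads_above :: "int set \<Rightarrow> int \<Rightarrow> nat" where
  "beads_above A n = card {r \<in> A. n < r}"

text \<open>
  For bead sets of partitions with equal charge, \<open>dless\<close> is strict inclusion of Young diagrams.
\<close>

definition dless :: "int set \<Rightarrow> int set \<Rightarrow> bool" where
  "dless A B \<longleftrightarrow> A \<noteq> B \<and> (\<forall>n. beads_above A n \<le> beads_above B n)"

text \<open>
  The last components are compared first, since the last component is the one that is split off in inductions
  on \<open>l\<close>.
\<close>

definition lexless :: "nat \<Rightarrow> config \<Rightarrow> config \<Rightarrow> bool" where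
  "lexless l Y X \<longleftrightarrow> (\<exists>k<l. (\<forall>c. k < c \<and> c < l \<longrightarrow> Y c = X c) \<and> dless (Y k) (X k))"

lemma wtE_occ: "wtE l X j = int (occ l X j) - int (occ l X (j + 1))"
  by (simp add: wtE_def nb_def occ_def sum_subtractf of_nat_sum)

lemma maya_finite: "maya A \<Longrightarrow> finite {r \<in> A. n < r}"
proof -
  assume "maya A"
  then obtain N where "A \<subseteq> {..N}" by (auto simp: maya_def)
  then have "{r \<in> A. n < r} \<subseteq> {n..N}" by auto
  then show ?thesis by (rule finite_subset) simp
qed

lemma above_pred: "maya A \<Longrightarrow> beads_above A (p - 1) = beads_above A p + of_bool (p \<in> A)"
proof -
  assume A: "maya A"
  have "p - 1 < r \<longleftrightarrow> r = p \<or> p < r" for r by auto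
  then have "{r \<in> A. p - 1 < r} = (if p \<in> A then insert p {r \<in> A. p < r} else {r \<in> A. p < r})"
    by auto
  then show ?thesis using maya_finite[OF A, of p] by (simp add: beads_above_def)
qed

lemma above_inject: "maya A \<Longrightarrow> maya B \<Longrightarrow> (\<And>n. beads_above A n = beads_above B n) \<Longrightarrow> A = B"
proof (rule set_eqI)
  fix p assume "maya A" "maya B" "\<And>n. beads_above A n = beads_above B n"
  then have "of_bool (p \<in> A) = (of_bool (p \<in> B) :: nat)"
    using above_pred[of A p] above_pred[of B p] by simp
  then show "p \<in> A \<longleftrightarrow> p \<in> B" by (cases "p \<in> A"; cases "p \<in> B") auto
qed

lemma dless_trans: "maya A \<Longrightarrow> maya B \<Longrightarrow> dless A B \<Longrightarrow> dless B C \<Longrightarrow> dless A C"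
  unfolding dless_def using above_inject[of A B] by (metis le_antisym le_trans)

lemma dless_irrefl: "\<not> dless A A" by (simp add: dless_def)

lemma dless_dn: "maya A \<Longrightarrow> can_dn j A \<Longrightarrow> dless (dn j A) A"
proof -
  assume A: "maya A" and j: "can_dn j A"
  have "beads_above (dn j A) n \<le> beads_above A n" for n
    unfolding beads_above_def
    by (rule card_inj_on_le[of "\<lambda>r. if r = j then j + 1 else r"])
      (use j maya_finite[OF A] in \<open>auto simp: inj_on_def dn_def can_dn_def split: if_splits\<close>)
  then show ?thesis using j by (auto simp: dless_def dn_def can_dn_def)
qed

definition maya_config :: "nat \<Rightarrow> config \<Rightarrow> bool" where
  "maya_config l X \<longleftrightarrow> (\<forall>c<l. maya (X c))"

lemma lexless_irrefl: "\<not> lexless l X X" by (simp add: lexless_def dless_irrefl)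

lemma lexless_trans:
  assumes "maya_config l X" "maya_config l Y" "lexless l X Y" "lexless l Y Z"
  shows "lexless l X Z"
proof -
  obtain k where k: "k < l" "\<And>c. k < c \<Longrightarrow> c < l \<Longrightarrow> X c = Y c" "dless (X k) (Y k)"
    using assms(3) by (auto simp: lexless_def)
  obtain m where m: "m < l" "\<And>c. m < c \<Longrightarrow> c < l \<Longrightarrow> Y c = Z c" "dless (Y m) (Z m)"
    using assms(4) by (auto simp: lexless_def)
  consider "k < m" | "k = m" | "m < k" by linarith
  then show ?thesis
  proof cases
    case 1
    then show ?thesis unfolding lexless_def using k m by (intro exI[of _ m]) auto
  next
    case 2
    then show ?thesis unfolding lexless_def using k m assms dless_trans[of "X k" "Y k" "Z k"]
      by (intro exI[of _ m]) (auto simp: maya_config_def)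
  next
    case 3
    then show ?thesis unfolding lexless_def using k m by (intro exI[of _ k]) auto
  qed
qed

lemma lexless_maximal_exists:
  assumes "finite S" "S \<noteq> {}" "\<And>X. X \<in> S \<Longrightarrow> maya_config l X"
  shows "\<exists>X\<in>S. \<forall>Y\<in>S. \<not> lexless l X Y"
proof -
  have trans: "transp_on S (lexless l)"
    by (rule transp_onI) (use lexless_trans assms(3) in blast)
  moreover have "asymp_on S (lexless l)"
    using lexless_trans lexless_irrefl assms(3) by (metis asymp_onI)
  ultimately show ?thesis
    using Finite_Set.bex_max_element[OF assms(1) _ _ assms(2), of "lexless l"] lexless_irrefl by metis
qed

lemma eE_Suc_single:
  "eE (Suc l) j (single X 1) = sc (qq powi (- nb j (X l))) (eE l j (single X 1)) + dn_at l j X"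
proof -
  have "qq powi (- (\<Sum>c'\<in>{c<..<Suc l}. nb j (X c')))
      = qq powi (- nb j (X l)) * qq powi (- (\<Sum>c'\<in>{c<..<l}. nb j (X c')))" if "c < l" for c
  proof -
    have "{c<..<Suc l} = insert l {c<..<l}" using that by auto
    then show ?thesis by (simp flip: power_int_add)
  qed
  moreover have "{l<..<Suc l} = {}" by auto
  ultimately show ?thesis by (simp add: eE_def sc_sum)
qed

lemma keys_eE_single:
  assumes "Z \<in> keys (eE l j (single X 1))"
  obtains c where "c < l" "can_dn j (X c)" "Z = X(c := dn j (X c))"
proof -
  have "Z \<in> keys (\<Sum>c<l. sc (qq powi (- (\<Sum>c'\<in>{c<..<l}. nb j (X c')))) (dn_at c j X))"
    using assms by (simp add: eE_def)
  then obtain c where c: "c < l" "Z \<in> keys (dn_at c j X)"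
    by (auto dest: in_keys_sum_sc)
  then show ?thesis using that by (auto simp: dn_at_def split: if_splits)
qed

lemma rst_eq_self: "(\<And>Z. Z \<in> keys y \<Longrightarrow> P Z) \<Longrightarrow> rst P y = y"
  and rst_eq_0: "(\<And>Z. Z \<in> keys y \<Longrightarrow> \<not> P Z) \<Longrightarrow> rst P y = 0"
  by (intro poly_mapping_eqI, metis in_keys_iff lookup_rst lookup_zero)+

text \<open>
  The total occupation decreases because the weight of a singular vector is dominant. For the partial
  occupations, consider the part of the vector in which the last component is that of the largest
  configuration \<open>Y\<close>. An operator \<open>e j\<close> acting in the last component contributes to this part only from
  configurations whose last component is larger than that of \<open>Y\<close>. There are none, so this part is singular for
  the action on the other components.
\<close>

lemma dominant_of_maximal:
  assumes "\<And>X. X \<in> keys x \<Longrightarrow> maya_config l X" "\<And>j. eE l j x = 0" "Y \<in> keys x"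
    and "\<And>Z. Z \<in> keys x \<Longrightarrow> \<not> lexless l Y Z"
  shows "dominant l Y"
  using assms
proof (induction l arbitrary: x)
  case 0
  then show ?case by (simp add: dominant_def occ_def)
next
  case (Suc l)
  have "occ (Suc l) Y (j + 1) \<le> occ (Suc l) Y j" for j
  proof -
    define n where "n = wtE (Suc l) Y j"
    define x' where "x' = rst (\<lambda>X. wtE (Suc l) X j = n) x"
    have "eE (Suc l) j x' = diag (\<lambda>X. of_bool (wtE (Suc l) X j = n + 2)) (eE (Suc l) j x)"
      unfolding x'_def rst_def by (rule config.diag_e[symmetric]) (simp_all add: cartan_def)
    then have "eE (Suc l) j x' = 0" using Suc.prems(2) lin_zero[OF lin_diag] by simp
    moreover have "Y \<in> keys x'" using Suc.prems(3) by (simp add: x'_def keys_rst n_def)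
    then have "x' \<noteq> 0" by auto
    ultimately have "n \<ge> 0"
      by (intro config.singular_weight_nonneg[of x' "Suc l" j]) (auto simp: x'_def keys_rst)
    then show ?thesis by (simp add: n_def wtE_occ)
  qed
  moreover have "dominant l Y"
  proof -
    define P where "P X \<longleftrightarrow> X l = Y l" for X :: config
    have keys_P: "P Z \<longleftrightarrow> P X" if "Z \<in> keys (eE l j (single X 1))" for X Z j
      using that by (rule keys_eE_single) (auto simp: P_def)
    have comm: "rst P (eE l j (single X 1)) = eE l j (rst P (single X 1))" for j X
    proof (cases "P X")
      case True
      then have "rst P (eE l j (single X 1)) = eE l j (single X 1)"
        using keys_P by (intro rst_eq_self) blast
      then show ?thesis using True by (simp add: rst_single)
    next
      case False
      then have "rst P (eE l j (single X 1)) = 0"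
        using keys_P by (intro rst_eq_0) blast
      then show ?thesis using False by (simp add: rst_single config.linearity)
    qed
    have dn0: "rst P (dn_at l j X) = 0" if "X \<in> keys x" for j X
    proof (rule ccontr)
      assume "rst P (dn_at l j X) \<noteq> 0"
      then have "can_dn j (X l)" "dn j (X l) = Y l"
        by (auto simp: dn_at_def rst_single lin_zero[OF lin_rst] P_def split: if_splits)
      then have "dless (Y l) (X l)"
        using dless_dn Suc.prems(1)[OF that] by (metis lessI maya_config_def)
      then have "lexless (Suc l) Y X" unfolding lexless_def by (intro exI[of _ l]) auto
      then show False using Suc.prems(4)[OF that] by simp
    qed
    show ?thesis
    proof (rule Suc.IH)
      show "eE l j (rst P x) = 0" for j
      proof -
        have "0 = rst P (eE (Suc l) j x)" using Suc.prems(2) lin_zero[OF lin_rst] by simp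
        also have "\<dots> = sc (qq powi (- nb j (Y l))) (eE l j (rst P x))"
        proof (rule lin_eq_on[OF lin_compose[OF lin_rst config.lin_e]
              lin_compose[OF lin_sc_op lin_compose[OF config.lin_e lin_rst]]])
          fix X assume "X \<in> keys x"
          then show "rst P (eE (Suc l) j (single X 1))
              = sc (qq powi (- nb j (Y l))) (eE l j (rst P (single X 1)))"
            by (cases "P X") (simp_all add: eE_Suc_single lin_add[OF lin_rst] lin_sc[OF lin_rst] dn0 comm,
                simp_all add: P_def rst_single config.linearity)
        qed
        finally have "sc (qq powi (nb j (Y l))) (sc (qq powi (- nb j (Y l))) (eE l j (rst P x))) = 0"
          by simp
        then show ?thesis by (simp add: power_int_minus)
      qed
      show "Y \<in> keys (rst P x)" using Suc.prems(3) by (simp add: keys_rst P_def)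
      show "maya_config l X" if "X \<in> keys (rst P x)" for X
        using Suc.prems(1) that by (simp add: keys_rst maya_config_def)
      show "\<not> lexless l Y Z" if "Z \<in> keys (rst P x)" for Z
      proof
        assume "lexless l Y Z"
        moreover have Z: "Z \<in> keys x" "Y l = Z l" using that by (auto simp: keys_rst P_def)
        ultimately have "lexless (Suc l) Y Z"
          unfolding lexless_def by (metis less_Suc_eq)
        then show False using Suc.prems(4) Z by blast
      qed
    qed
  qed
  ultimately show ?case by (auto simp: dominant_def le_Suc_eq)
qed

section \<open>Operators commuting with the action\<close>

text \<open>
  The operator \<open>FE c\<close> moves a bead from component \<open>c + 1\<close> to the same position in component \<open>c\<close>, with a
  coefficient that depends on the beads in larger positions. It is a Chevalley generator of the quantum
  group of type \<open>gl\<close> that acts on the components, transported to a basis in which the components,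
  not the positions, are taken one after the other; this reordering of fermions causes the sign.
\<close>

definition mv :: "nat \<Rightarrow> int \<Rightarrow> config \<Rightarrow> config" where
  "mv c p X = X(c := insert p (X c), Suc c := X (Suc c) - {p})"

definition mv_coeff :: "nat \<Rightarrow> int \<Rightarrow> config \<Rightarrow> ratfun" where
  "mv_coeff c p X = (-1) ^ (beads_above (X c) p + beads_above (X (Suc c)) p)
     * qq powi (int (beads_above (X c) p) - int (beads_above (X (Suc c)) p))"

definition mv_at :: "nat \<Rightarrow> int \<Rightarrow> config \<Rightarrow> config \<Rightarrow>\<^sub>0 ratfun" where
  "mv_at c p X = (if p \<in> X (Suc c) - X c then single (mv c p X) (mv_coeff c p X) else 0)"

definition FE :: "nat \<Rightarrow> (config \<Rightarrow>\<^sub>0 ratfun) \<Rightarrow> (config \<Rightarrow>\<^sub>0 ratfun)" where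
  "FE c = lext (\<lambda>X. \<Sum>p\<in>X (Suc c) - X c. single (mv c p X) (mv_coeff c p X))"

lemma lin_FE: "lin (FE c)" by (simp add: FE_def lin_lext)

lemma maya_Diff_finite: "maya A \<Longrightarrow> maya B \<Longrightarrow> finite (B - A)"
proof -
  assume "maya A" "maya B"
  then obtain m n where m: "{..m} \<subseteq> A" and n: "B \<subseteq> {..n}" by (auto simp: maya_def)
  have "m \<le> x \<and> x \<le> n" if "x \<in> B - A" for x
    using m n that by (metis DiffE atMost_iff linear subsetD)
  then have "B - A \<subseteq> {m..n}" by auto
  then show ?thesis by (rule finite_subset) simp
qed

lemma maya_insert: "maya A \<Longrightarrow> maya (insert p A)"
proof -
  assume "maya A"
  then obtain m n where "{..m} \<subseteq> A" "A \<subseteq> {..n}" by (auto simp: maya_def)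
  then have "{..m} \<subseteq> insert p A" "insert p A \<subseteq> {..max n p}" by (auto simp: subset_iff le_max_iff_disj)
  then show ?thesis unfolding maya_def by blast
qed

lemma maya_remove: "maya A \<Longrightarrow> maya (A - {p})"
proof -
  assume "maya A"
  then obtain m n where "{..m} \<subseteq> A" "A \<subseteq> {..n}" by (auto simp: maya_def)
  then have "{..min m (p - 1)} \<subseteq> A - {p}" "A - {p} \<subseteq> {..n}" by (auto simp: subset_iff)
  then show ?thesis unfolding maya_def by blast
qed

lemma maya_dn: "maya A \<Longrightarrow> maya (dn j A)"
  by (simp add: dn_def maya_insert maya_remove)

lemma FE_single:
  assumes "finite W" "X (Suc c) - X c \<subseteq> W"
  shows "FE c (single X 1) = (\<Sum>p\<in>W. mv_at c p X)"
proof -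
  have "(\<Sum>p\<in>W. mv_at c p X) = (\<Sum>p\<in>X (Suc c) - X c. mv_at c p X)"
    using assms by (intro sum.mono_neutral_right) (auto simp: mv_at_def)
  also have "\<dots> = FE c (single X 1)" by (simp add: FE_def mv_at_def)
  finally show ?thesis by simp
qed

lemma above_dn: assumes A: "maya A" and "can_dn j A" and "p \<noteq> j" shows "beads_above (dn j A) p = beads_above A p"
proof (cases "p < j")
  case True
  have "{r \<in> dn j A. p < r} = insert j ({r \<in> A. p < r} - {j + 1})"
    using True assms(2) by (auto simp: dn_def can_dn_def)
  moreover have "card ({r \<in> A. p < r} - {j + 1}) = card {r \<in> A. p < r} - 1"
    "card {r \<in> A. p < r} > 0"
    using True assms(2) maya_finite[OF A, of p]
    by (auto simp: can_dn_def card_gt_0_iff intro!: card_Diff_singleton)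
  ultimately show ?thesis
    using assms(2) maya_finite[OF A, of p] by (simp add: beads_above_def can_dn_def)
next
  case False
  then have "p < r \<longleftrightarrow> j < r \<and> p < r" for r using assms(3) by auto
  have "{r \<in> dn j A. p < r} = {r \<in> A. p < r}" using False assms(2,3) by (auto simp: dn_def)
  then show ?thesis by (simp add: beads_above_def)
qed

lemma mv_coeff_pred:
  assumes "maya (X c)" "maya (X (Suc c))"
  shows "mv_coeff c j X = mv_coeff c (j + 1) X
    * ((-1) ^ (of_bool (j + 1 \<in> X c) + of_bool (j + 1 \<in> X (Suc c)))
      * qq powi (of_bool (j + 1 \<in> X c) - of_bool (j + 1 \<in> X (Suc c))))"
proof -
  have "beads_above (X c) j = beads_above (X c) (j + 1) + of_bool (j + 1 \<in> X c)"
    "beads_above (X (Suc c)) j = beads_above (X (Suc c)) (j + 1) + of_bool (j + 1 \<in> X (Suc c))"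
    using above_pred[OF assms(1), of "j + 1"] above_pred[OF assms(2), of "j + 1"] by simp_all
  then show ?thesis
    by (simp add: mv_coeff_def power_add power_int_add power_int_diff mult_ac)
qed

text \<open>The contributions of a bead \<open>p\<close> and a component \<open>d\<close> to the two products.\<close>

definition eF_term where
  "eF_term l j c X p d = (if p \<in> X (Suc c) - X c then
     sc (mv_coeff c p X * qq powi (- (\<Sum>c'\<in>{d<..<l}. nb j (mv c p X c')))) (dn_at d j (mv c p X)) else 0)"
definition Fe_term where
  "Fe_term l j c X p d = (if can_dn j (X d) then
     sc (qq powi (- (\<Sum>c'\<in>{d<..<l}. nb j (X c')))) (mv_at c p (X(d := dn j (X d)))) else 0)"

lemma nb_mv:
  assumes "p \<in> X (Suc c) - X c"
  shows "nb j (mv c p X c') = nb j (X c') + (of_bool (p = j) - of_bool (p = j + 1))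
    * (of_bool (c' = c) - of_bool (c' = Suc c))"
  using assms by (cases "c' = c"; cases "c' = Suc c"; cases "p = j"; cases "p = j + 1")
    (simp_all add: nb_def mv_def)

lemma sum_nb_mv:
  assumes "p \<in> X (Suc c) - X c" "Suc c < l"
  shows "(\<Sum>c'\<in>{d<..<l}. nb j (mv c p X c')) = (\<Sum>c'\<in>{d<..<l}. nb j (X c'))
    - (if d = c then of_bool (p = j) - of_bool (p = j + 1) else 0)"
proof -
  have "(\<Sum>c'\<in>{d<..<l}. of_bool (c' = c) - of_bool (c' = Suc c)) = (if d = c then - 1 else (0::int))"
    using assms(2) by (simp add: sum_subtractf of_bool_def)
  then show ?thesis
    unfolding nb_mv[OF assms(1)] sum.distrib sum_distrib_left[symmetric] by simp
qed

text \<open>A move away from the beads that \<open>e j\<close> moves does not interfere with it.\<close>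

lemma eF_term_eq_Fe_term:
  assumes X: "maya (X c)" "maya (X (Suc c))" and l: "Suc c < l"
    and away: "(p \<noteq> j \<and> p \<noteq> j + 1) \<or> (d \<noteq> c \<and> d \<noteq> Suc c)"
  shows "eF_term l j c X p d = Fe_term l j c X p d"
proof -
  define X' where "X' = X(d := dn j (X d))"
  have mem: "p \<in> X' (Suc c) - X' c \<longleftrightarrow> p \<in> X (Suc c) - X c"
    using away by (auto simp: X'_def dn_def)
  have can: "can_dn j (mv c p X d) \<longleftrightarrow> can_dn j (X d)"
    using away by (auto simp: mv_def can_dn_def)
  have conf: "(mv c p X)(d := dn j (mv c p X d)) = mv c p X'" if "can_dn j (X d)"
    using away that by (auto simp: mv_def X'_def dn_def fun_eq_iff)
  have "beads_above (X' c) p = beads_above (X c) p" "beads_above (X' (Suc c)) p = beads_above (X (Suc c)) p" if "can_dn j (X d)"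
    using away that X above_dn by (auto simp: X'_def)
  then have coeff: "mv_coeff c p X' = mv_coeff c p X" if "can_dn j (X d)"
    using that by (simp add: mv_coeff_def)
  show ?thesis
  proof (cases "p \<in> X (Suc c) - X c \<and> can_dn j (X d)")
    case True
    have "(\<Sum>c'\<in>{d<..<l}. nb j (mv c p X c')) = (\<Sum>c'\<in>{d<..<l}. nb j (X c'))"
      using sum_nb_mv[where l = l and j = j] True l away by auto
    then show ?thesis
      unfolding eF_term_def Fe_term_def dn_at_def mv_at_def X'_def[symmetric]
      using True conf can coeff mem by (simp add: mult.commute)
  next
    case False
    then show ?thesis
      unfolding eF_term_def Fe_term_def dn_at_def mv_at_def X'_def[symmetric] using can mem by auto
  qed
qed

lemma adjacent_beads_cases:
  fixes A :: "int set"
  obtains A0 a b where "j \<notin> A0" "j + 1 \<notin> A0"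
    "A = (if a then {j} else {}) \<union> ((if b then {j + 1} else {}) \<union> A0)"
proof
  show "j \<notin> A - {j, j + 1}" "j + 1 \<notin> A - {j, j + 1}" by auto
  show "A = (if j \<in> A then {j} else {}) \<union> ((if j + 1 \<in> A then {j + 1} else {}) \<union> (A - {j, j + 1}))"
    by auto
qed

text \<open>
  Here only the beads in the positions \<open>j\<close> and \<open>j + 1\<close> of the components \<open>c\<close> and \<open>c + 1\<close> matter, which leaves
  sixteen cases. For instance, if both components have a bead in \<open>j + 1\<close> and none in \<open>j\<close>, then the left hand
  side is zero. On the right, either bead can be lowered before the bead of component \<open>c + 1\<close> is moved;
  the result is the same, and the sign and the power of \<open>q\<close> in \<open>mv_coeff\<close> make the two terms cancel.
\<close>

lemma eF_Fe_local:
  assumes X: "maya (X c)" "maya (X (Suc c))" and l: "Suc c < l"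
  shows "eF_term l j c X j c + eF_term l j c X j (Suc c)
      + (eF_term l j c X (j + 1) c + eF_term l j c X (j + 1) (Suc c))
    = Fe_term l j c X j c + Fe_term l j c X j (Suc c)
      + (Fe_term l j c X (j + 1) c + Fe_term l j c X (j + 1) (Suc c))"
proof -
  define A B where "A = X c" and "B = X (Suc c)"
  define s where "s = (\<Sum>c'\<in>{Suc c<..<l}. nb j (X c'))"
  define \<sigma> where "\<sigma> = mv_coeff c (j + 1) X"
  have "{c<..<l} = insert (Suc c) {Suc c<..<l}" using l by auto
  then have sum_c: "(\<Sum>c'\<in>{c<..<l}. nb j (X c')) = nb j B + s" by (simp add: s_def B_def)
  have coeff: "mv_coeff c j X = \<sigma> * ((-1) ^ (of_bool (j + 1 \<in> A) + of_bool (j + 1 \<in> B))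
      * qq powi (of_bool (j + 1 \<in> A) - of_bool (j + 1 \<in> B)))"
    unfolding \<sigma>_def A_def B_def by (rule mv_coeff_pred[OF X])
  have above1: "beads_above (dn j A) (j + 1) = beads_above A (j + 1)" if "can_dn j A"
    using above_dn[of A j "j + 1"] that X by (simp add: A_def)
  have above2: "beads_above (dn j B) (j + 1) = beads_above B (j + 1)" if "can_dn j B"
    using above_dn[of B j "j + 1"] that X by (simp add: B_def)
  have coeffA: "mv_coeff c (j + 1) (X(c := dn j A)) = \<sigma>"
    "mv_coeff c j (X(c := dn j A)) = \<sigma> * ((-1) ^ of_bool (j + 1 \<in> B) * qq powi (- of_bool (j + 1 \<in> B)))"
    if "can_dn j A"
  proof -
    show 1: "mv_coeff c (j + 1) (X(c := dn j A)) = \<sigma>"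
      using above1[OF that] by (simp add: mv_coeff_def \<sigma>_def A_def)
    show "mv_coeff c j (X(c := dn j A)) = \<sigma> * ((-1) ^ of_bool (j + 1 \<in> B) * qq powi (- of_bool (j + 1 \<in> B)))"
      using mv_coeff_pred[of "X(c := dn j A)" c j] X maya_dn 1
      by (simp add: dn_def B_def A_def)
  qed
  have coeffB: "mv_coeff c (j + 1) (X(Suc c := dn j B)) = \<sigma>"
    "mv_coeff c j (X(Suc c := dn j B)) = \<sigma> * ((-1) ^ of_bool (j + 1 \<in> A) * qq powi of_bool (j + 1 \<in> A))"
    if "can_dn j B"
  proof -
    show 1: "mv_coeff c (j + 1) (X(Suc c := dn j B)) = \<sigma>"
      using above2[OF that] by (simp add: mv_coeff_def \<sigma>_def B_def)
    show "mv_coeff c j (X(Suc c := dn j B)) = \<sigma> * ((-1) ^ of_bool (j + 1 \<in> A) * qq powi of_bool (j + 1 \<in> A))"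
      using mv_coeff_pred[of "X(Suc c := dn j B)" c j] X maya_dn 1
      by (simp add: dn_def B_def A_def)
  qed
  have sums: "(\<Sum>c'\<in>{Suc c<..<l}. nb j (mv c p X c')) = s"
    "(\<Sum>c'\<in>{c<..<l}. nb j (mv c p X c')) = nb j B + s - (of_bool (p = j) - of_bool (p = j + 1))"
    if "p \<in> B - A" for p
    using sum_nb_mv[where l = l and j = j] that l by (auto simp: A_def B_def s_def sum_c[unfolded B_def])
  define C where "C P Q = X(c := P, Suc c := Q)" for P Q
  have eF: "eF_term l j c X p c = (if p \<in> B - A \<and> can_dn j (insert p A) then
        single (C (dn j (insert p A)) (B - {p})) (mv_coeff c p X * qq powi (- (nb j B + s - (of_bool (p = j) - of_bool (p = j + 1))))) else 0)"
    "eF_term l j c X p (Suc c) = (if p \<in> B - A \<and> can_dn j (B - {p}) then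
        single (C (insert p A) (dn j (B - {p}))) (mv_coeff c p X * qq powi (- s)) else 0)" for p
  proof -
    have 1: "mv c p X c = insert p A" "mv c p X (Suc c) = B - {p}"
      "(mv c p X)(c := P) = C P (B - {p})" "(mv c p X)(Suc c := Q) = C (insert p A) Q" for P Q
      by (auto simp: mv_def A_def B_def C_def fun_eq_iff)
    show "eF_term l j c X p c = (if p \<in> B - A \<and> can_dn j (insert p A) then
        single (C (dn j (insert p A)) (B - {p})) (mv_coeff c p X * qq powi (- (nb j B + s - (of_bool (p = j) - of_bool (p = j + 1))))) else 0)"
      unfolding eF_term_def dn_at_def 1 A_def[symmetric] B_def[symmetric]
      by (cases "p \<in> B - A") (simp_all only: sums sc_simps if_True if_False simp_thms, simp_all)
    show "eF_term l j c X p (Suc c) = (if p \<in> B - A \<and> can_dn j (B - {p}) then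
        single (C (insert p A) (dn j (B - {p}))) (mv_coeff c p X * qq powi (- s)) else 0)"
      unfolding eF_term_def dn_at_def 1 A_def[symmetric] B_def[symmetric]
      by (cases "p \<in> B - A") (simp_all only: sums sc_simps if_True if_False simp_thms, simp_all)
  qed
  have Fe: "Fe_term l j c X p c = (if can_dn j A \<and> p \<in> B - dn j A then
        single (C (insert p (dn j A)) (B - {p})) (qq powi (- (nb j B + s)) * mv_coeff c p (X(c := dn j A))) else 0)"
    "Fe_term l j c X p (Suc c) = (if can_dn j B \<and> p \<in> dn j B - A then
        single (C (insert p A) (dn j B - {p})) (qq powi (- s) * mv_coeff c p (X(Suc c := dn j B))) else 0)" for p
  proof -
    have 1: "mv c p (X(c := dn j A)) = C (insert p (dn j A)) (B - {p})"
      "mv c p (X(Suc c := dn j B)) = C (insert p A) (dn j B - {p})"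
      by (auto simp: mv_def A_def B_def C_def)
    show "Fe_term l j c X p c = (if can_dn j A \<and> p \<in> B - dn j A then
        single (C (insert p (dn j A)) (B - {p})) (qq powi (- (nb j B + s)) * mv_coeff c p (X(c := dn j A))) else 0)"
      unfolding Fe_term_def mv_at_def sum_c A_def[symmetric] 1 by (simp add: B_def)
    show "Fe_term l j c X p (Suc c) = (if can_dn j B \<and> p \<in> dn j B - A then
        single (C (insert p A) (dn j B - {p})) (qq powi (- s) * mv_coeff c p (X(Suc c := dn j B))) else 0)"
      unfolding Fe_term_def mv_at_def s_def[symmetric] B_def[symmetric] 1 by (simp add: A_def)
  qed
  obtain A0 a1 a2 where A0: "j \<notin> A0" "j + 1 \<notin> A0"
    "A = (if a1 then {j} else {}) \<union> ((if a2 then {j + 1} else {}) \<union> A0)"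
    by (rule adjacent_beads_cases)
  obtain B0 b1 b2 where B0: "j \<notin> B0" "j + 1 \<notin> B0"
    "B = (if b1 then {j} else {}) \<union> ((if b2 then {j + 1} else {}) \<union> B0)"
    by (rule adjacent_beads_cases)
  have cA: "can_dn j A \<longleftrightarrow> \<not> a1 \<and> a2" and cB: "can_dn j B \<longleftrightarrow> \<not> b1 \<and> b2"
    using A0 B0 by (auto simp: can_dn_def)
  note norm = can_dn_def dn_def insert_Diff_if insert_commute nb_def
  show ?thesis
    unfolding eF Fe
    apply (cases a1; cases a2; cases b1; cases b2)
    using coeffA coeffB coeff unfolding cA cB
    by (simp_all add: A0 B0 norm \<sigma>_def[symmetric] power_int_diff power_int_add power_int_minus
        divide_inverse mult_ac flip: single_add)
qed

theorem FE_commutes_e_single: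
  assumes X: "maya (X c)" "maya (X (Suc c))" and l: "Suc c < l"
  shows "eE l j (FE c (single X 1)) = FE c (eE l j (single X 1))"
proof -
  define W where "W = insert j (insert (j + 1) (X (Suc c) - X c))"
  have W: "finite W" "X (Suc c) - X c \<subseteq> W"
    using maya_Diff_finite[OF X] by (auto simp: W_def)
  have W_dn: "(X(d := dn j (X d))) (Suc c) - (X(d := dn j (X d))) c \<subseteq> W" for d
    by (auto simp: W_def dn_def split: if_splits)
  have "eE l j (mv_at c p X) = (\<Sum>d<l. eF_term l j c X p d)" for p
    by (auto simp: mv_at_def eE_def eF_term_def sc_sum lin_zero[OF lin_lext])
  then have 1: "eE l j (FE c (single X 1)) = (\<Sum>p\<in>W. \<Sum>d<l. eF_term l j c X p d)"
    by (simp only: FE_single[OF W] lin_sum[OF config.lin_e])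
  have "FE c (dn_at d j X) = (if can_dn j (X d) then (\<Sum>p\<in>W. mv_at c p (X(d := dn j (X d)))) else 0)" for d
    by (simp only: dn_at_def FE_single[OF W(1) W_dn[of d]] lin_zero[OF lin_FE] if_distrib[of "FE c"])
  then have "FE c (eE l j (single X 1)) = (\<Sum>d<l. \<Sum>p\<in>W. Fe_term l j c X p d)"
    by (simp add: eE_def lin_sum[OF lin_FE] lin_sc[OF lin_FE])
      (intro sum.cong refl, auto simp: Fe_term_def sc_sum)
  then have 2: "FE c (eE l j (single X 1)) = (\<Sum>p\<in>W. \<Sum>d<l. Fe_term l j c X p d)"
    by (subst sum.swap) simp
  define g where "g p d = eF_term l j c X p d - Fe_term l j c X p d" for p d
  have g0: "g p d = 0" if "(p \<noteq> j \<and> p \<noteq> j + 1) \<or> (d \<noteq> c \<and> d \<noteq> Suc c)" for p d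
    using eF_term_eq_Fe_term[OF X l that] by (simp add: g_def)
  have in_d: "(\<Sum>d<l. g p d) = g p c + g p (Suc c)" for p
  proof -
    have "(\<Sum>d<l. g p d) = (\<Sum>d\<in>{c, Suc c}. g p d)"
      using l g0 by (intro sum.mono_neutral_right) auto
    then show ?thesis by simp
  qed
  have "(\<Sum>p\<in>W. \<Sum>d<l. g p d) = (\<Sum>p\<in>{j, j + 1}. \<Sum>d<l. g p d)"
    using W(1) g0 by (intro sum.mono_neutral_right) (auto simp: W_def intro!: sum.neutral)
  also have "\<dots> = 0"
    unfolding in_d using eF_Fe_local[OF X l, of j] by (simp add: g_def algebra_simps)
  finally show ?thesis unfolding 1 2 by (simp add: g_def sum_subtractf)
qed

section \<open>Charges of bead sets\<close>

text \<open>The charge of the bead set of a partition is the shift of the contents, see \<open>charge_beads\<close>.\<close>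

definition charge :: "int set \<Rightarrow> int" where
  "charge A = int (beads_above A 0) - int (card {r. r \<notin> A \<and> r \<le> 0})"

lemma maya_finite_holes: "maya A \<Longrightarrow> finite {r. r \<notin> A \<and> r \<le> n}"
proof -
  assume "maya A"
  then obtain m where "{..m} \<subseteq> A" by (auto simp: maya_def)
  then have "m \<le> r" if "r \<notin> A" for r using that by (meson atMost_iff linear subsetD)
  then have "{r. r \<notin> A \<and> r \<le> n} \<subseteq> {m..n}" by auto
  then show ?thesis by (rule finite_subset) simp
qed

text \<open>
  Passing from \<open>n - 1\<close> to \<open>n\<close>, there is either one bead less above or one hole more below, so the value of
  the right hand side stays the same.
\<close>

lemma charge_eq:
  assumes A: "maya A"
  shows "charge A = n + int (beads_above A n) - int (card {r. r \<notin> A \<and> r \<le> n})"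
proof -
  define g where "g n = n + int (beads_above A n) - int (card {r. r \<notin> A \<and> r \<le> n})" for n
  have step: "g (n - 1) = g n" for n
  proof -
    have "{r. r \<notin> A \<and> r \<le> n} = (if n \<in> A then {r. r \<notin> A \<and> r \<le> n - 1}
        else insert n {r. r \<notin> A \<and> r \<le> n - 1})"
    proof -
      have "r \<le> n \<longleftrightarrow> r = n \<or> r \<le> n - 1" for r by auto
      then show ?thesis by auto
    qed
    then show ?thesis
      using maya_finite_holes[OF A, of "n - 1"] above_pred[OF A, of n] by (simp add: g_def)
  qed
  have "g n = g 0"
  proof (induction n rule: int_induct[where k = 0])
    case (step1 i)
    then show ?case using step[of "i + 1"] by simp
  next
    case (step2 i)
    then show ?case using step[of i] by simp
  qed simp
  then show ?thesis by (simp add: g_def charge_def)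
qed

lemma maya_atMost [simp]: "maya {..v}" by (auto simp: maya_def)

lemma above_atMost: "beads_above {..v} n = nat (v - n)"
proof -
  have "{r \<in> {..v}. n < r} = {n<..v}" by auto
  then show ?thesis by (simp add: beads_above_def)
qed

lemma charge_atMost [simp]: "charge {..v} = v"
proof -
  have "{r. r \<notin> {..v} \<and> r \<le> v} = {}" by auto
  then show ?thesis using charge_eq[of "{..v}" v] by (simp add: above_atMost)
qed

text \<open>Among the bead sets of a given charge, the ray is the least one.\<close>

lemma above_ge: "maya A \<Longrightarrow> beads_above {..charge A} n \<le> beads_above A n"
  using charge_eq[of A n] by (simp add: above_atMost)

lemma above_insert: "maya A \<Longrightarrow> p \<notin> A \<Longrightarrow> beads_above (insert p A) n = beads_above A n + of_bool (n < p)"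
proof -
  assume A: "maya A" "p \<notin> A"
  have "{r \<in> insert p A. n < r} = (if n < p then insert p {r \<in> A. n < r} else {r \<in> A. n < r})" by auto
  then show ?thesis using A maya_finite[OF A(1), of n] by (simp add: beads_above_def)
qed

lemma charge_insert: "maya A \<Longrightarrow> p \<notin> A \<Longrightarrow> charge (insert p A) = charge A + 1"
proof -
  assume A: "maya A" "p \<notin> A"
  have "{r. r \<notin> insert p A \<and> r \<le> p - 1} = {r. r \<notin> A \<and> r \<le> p - 1}" by auto
  then show ?thesis
    using A charge_eq[of A "p - 1"] charge_eq[of "insert p A" "p - 1"]
    by (simp add: maya_insert above_insert)
qed

lemma charge_remove: "maya A \<Longrightarrow> p \<in> A \<Longrightarrow> charge (A - {p}) = charge A - 1"
  using charge_insert[of "A - {p}" p] by (simp add: maya_remove insert_absorb)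

lemma above_remove: "maya A \<Longrightarrow> p \<in> A \<Longrightarrow> beads_above (A - {p}) n + of_bool (n < p) = beads_above A n"
  using above_insert[of "A - {p}" p n] by (simp add: maya_remove insert_absorb)

lemma maya_config_bounds:
  "maya_config l X \<Longrightarrow> \<exists>m N. \<forall>c<l. {..m} \<subseteq> X c \<and> X c \<subseteq> {..N}"
proof (induction l)
  case (Suc l)
  then obtain m N where mN: "\<forall>c<l. {..m} \<subseteq> X c \<and> X c \<subseteq> {..N}" by (auto simp: maya_config_def)
  have "maya (X l)" using Suc.prems by (simp add: maya_config_def)
  then obtain m' N' where mN': "{..m'} \<subseteq> X l" "X l \<subseteq> {..N'}" unfolding maya_def by blast
  have "{..min m m'} \<subseteq> X c \<and> X c \<subseteq> {..max N N'}" if "c < Suc l" for c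
  proof (cases "c = l")
    case True
    then show ?thesis using mN' by (auto simp: subset_iff le_max_iff_disj)
  next
    case False
    then have "{..m} \<subseteq> X c \<and> X c \<subseteq> {..N}" using mN that by auto
    then show ?thesis by (auto simp: subset_iff le_max_iff_disj)
  qed
  then show ?case by blast
qed simp

text \<open>Both sides are the sum of the occupation numbers of the positions beyond \<open>n\<close>.\<close>

lemma above_occ:
  assumes "maya_config l X" "maya_config l Y" "\<And>p. occ l X p = occ l Y p"
  shows "(\<Sum>c<l. beads_above (X c) n) = (\<Sum>c<l. beads_above (Y c) n)"
proof -
  obtain N1 where N1: "\<And>c. c < l \<Longrightarrow> X c \<subseteq> {..N1}" using maya_config_bounds[OF assms(1)] by blast
  obtain N2 where N2: "\<And>c. c < l \<Longrightarrow> Y c \<subseteq> {..N2}" using maya_config_bounds[OF assms(2)] by blast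
  define N where "N = max N1 N2"
  have "{..N1} \<subseteq> {..N}" "{..N2} \<subseteq> {..N}" by (simp_all add: N_def)
  then have N: "X c \<subseteq> {..N}" "Y c \<subseteq> {..N}" if "c < l" for c
    using order_trans[OF N1[OF that]] order_trans[OF N2[OF that]] by blast+
  have beads_above: "beads_above A n = (\<Sum>p\<in>{n<..N}. of_bool (p \<in> A))" if "A \<subseteq> {..N}" for A
  proof -
    have "{r \<in> A. n < r} = {n<..N} \<inter> {p. p \<in> A}" using that by auto
    then show ?thesis by (simp add: beads_above_def sum_of_bool_eq)
  qed
  have "(\<Sum>c<l. beads_above (Z c) n) = (\<Sum>p\<in>{n<..N}. occ l Z p)" if "\<And>c. c < l \<Longrightarrow> Z c \<subseteq> {..N}" for Z
    unfolding occ_def by (subst sum.swap) (simp add: beads_above that)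
  then show ?thesis using N assms(3) by simp
qed

section \<open>Singular vectors with prescribed leading term\<close>

definition FW :: "nat list \<Rightarrow> (config \<Rightarrow>\<^sub>0 ratfun) \<Rightarrow> (config \<Rightarrow>\<^sub>0 ratfun)" where
  "FW w x = foldr FE w x"

lemma FW_simps [simp]: "FW [] x = x" "FW (c # w) x = FE c (FW w x)"
  by (simp_all add: FW_def)

lemma FW_append: "FW (u @ w) x = FW u (FW w x)" by (simp add: FW_def)

lemma lin_FW: "lin (FW w)"
  by (induction w) (auto intro: lin_id lin_compose[OF lin_FE] simp: lin_def lin_add[OF lin_FE] lin_sc[OF lin_FE])

lemma in_keys_sum: "Z \<in> keys (\<Sum>c\<in>A. h c) \<Longrightarrow> \<exists>c\<in>A. Z \<in> keys (h c)"
  by (rule ccontr) (auto simp: in_keys_iff lookup_sum)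

lemma keys_FE_single:
  assumes "Z \<in> keys (FE c (single X 1))"
  obtains p where "p \<in> X (Suc c) - X c" "Z = mv c p X"
proof -
  have "Z \<in> keys (\<Sum>p\<in>X (Suc c) - X c. single (mv c p X) (mv_coeff c p X))"
    using assms by (simp add: FE_def)
  then obtain p where "p \<in> X (Suc c) - X c" "Z \<in> keys (single (mv c p X) (mv_coeff c p X))"
    by (auto dest!: in_keys_sum simp del: keys_single)
  then show ?thesis using that by (auto split: if_splits)
qed

lemma keys_FE:
  assumes "Z \<in> keys (FE c x)"
  obtains X p where "X \<in> keys x" "p \<in> X (Suc c) - X c" "Z = mv c p X"
proof -
  obtain X where "X \<in> keys x" "Z \<in> keys (FE c (single X 1))"
    using assms lin_keys_le[OF lin_FE, of c x] by blast
  then show ?thesis using that keys_FE_single by metis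
qed

lemma keys_FW_induct [consumes 2, case_names base step]:
  assumes "Z \<in> keys (FW w x)" "set w \<subseteq> C" "\<And>X. X \<in> keys x \<Longrightarrow> P X"
    and "\<And>X c p. P X \<Longrightarrow> c \<in> C \<Longrightarrow> p \<in> X (Suc c) - X c \<Longrightarrow> P (mv c p X)"
  shows "P Z"
  using assms(1,2)
proof (induction w arbitrary: Z)
  case Nil
  then show ?case using assms(3) by simp
next
  case (Cons c w)
  then show ?case using assms(4) by (auto elim!: keys_FE)
qed

lemma maya_config_mv: "maya_config l X \<Longrightarrow> Suc c < l \<Longrightarrow> maya_config l (mv c p X)"
  by (auto simp: maya_config_def mv_def maya_insert maya_remove)

lemma occ_Suc: "occ (Suc l) X p = occ l X p + of_bool (p \<in> X l)"
  by (simp add: occ_def)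

lemma occ_mv: "Suc c < l \<Longrightarrow> p \<in> X (Suc c) - X c \<Longrightarrow> occ l (mv c p X) r = occ l X r"
proof -
  assume c: "Suc c < l" and p: "p \<in> X (Suc c) - X c"
  have "{..<l} = insert c (insert (Suc c) ({..<l} - {c, Suc c}))" using c by auto
  then have split: "(\<Sum>d<l. h d) = h c + (h (Suc c) + (\<Sum>d\<in>{..<l} - {c, Suc c}. h d))" for h :: "nat \<Rightarrow> nat"
    by (metis (no_types, lifting) Diff_iff finite_Diff finite_insert finite_lessThan insert_iff n_not_Suc_n
        singletonI sum.insert)
  have "(\<Sum>d\<in>{..<l} - {c, Suc c}. of_bool (r \<in> mv c p X d)) = (\<Sum>d\<in>{..<l} - {c, Suc c}. of_bool (r \<in> X d) :: nat)"
    by (intro sum.cong) (auto simp: mv_def)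
  then show ?thesis unfolding occ_def split using p by (auto simp: mv_def)
qed

lemma FW_maya: "Z \<in> keys (FW w x) \<Longrightarrow> set w \<subseteq> {c. Suc c < l} \<Longrightarrow> (\<And>X. X \<in> keys x \<Longrightarrow> maya_config l X)
    \<Longrightarrow> maya_config l Z"
  by (induction rule: keys_FW_induct) (auto simp: maya_config_mv)

lemma FW_occ: "Z \<in> keys (FW w (single X 1)) \<Longrightarrow> set w \<subseteq> {c. Suc c < l} \<Longrightarrow> occ l Z = occ l X"
  by (induction rule: keys_FW_induct) (auto simp: occ_mv fun_eq_iff split: if_splits)

lemma FW_untouched: "Z \<in> keys (FW w (single X 1)) \<Longrightarrow> set w \<subseteq> {c. Suc c < l} \<Longrightarrow> d \<ge> l \<Longrightarrow> Z d = X d"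
  by (induction rule: keys_FW_induct) (auto simp: mv_def split: if_splits)

text \<open>The charges are determined by the number of occurrences of the letters of the word.\<close>

lemma FW_charge:
  assumes "Z \<in> keys (FW w (single X 1))" "set w \<subseteq> {c. Suc c < l}" "maya_config l X"
  shows "charge (Z c) = charge (X c) + int (count_list w c) - int (if c = 0 then 0 else count_list w (c - 1))"
  using assms(1,2)
proof (induction w arbitrary: Z c)
  case Nil
  then show ?case by (simp split: if_splits)
next
  case (Cons d w)
  then obtain Y p where Y: "Y \<in> keys (FW w (single X 1))" "p \<in> Y (Suc d) - Y d" "Z = mv d p Y"
    by (auto elim: keys_FE)
  have "maya_config l Y"
    using FW_maya[OF Y(1), of l] Cons.prems assms(3) by auto
  then have "maya (Y d)" "maya (Y (Suc d))" using Cons.prems by (auto simp: maya_config_def)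
  then have "charge (Z c) = charge (Y c) + of_bool (c = d) - of_bool (c = Suc d)"
    using Y(2) by (auto simp: Y(3) mv_def charge_insert charge_remove)
  then show ?case using Cons.IH[OF Y(1), of c] Cons.prems by (auto split: nat_diff_split)
qed

lemma FW_commutes_e:
  assumes "\<And>X. X \<in> keys x \<Longrightarrow> maya_config l X" "set w \<subseteq> {c. Suc c < l}"
  shows "eE l j (FW w x) = FW w (eE l j x)"
  using assms(2)
proof (induction w)
  case (Cons c w)
  have "eE l j (FE c (FW w x)) = FE c (eE l j (FW w x))"
  proof (rule lin_eq_on[OF lin_compose[OF config.lin_e lin_FE] lin_compose[OF lin_FE config.lin_e]])
    fix X assume "X \<in> keys (FW w x)"
    then have "maya_config l X" using Cons.prems assms(1) by (auto intro: FW_maya)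
    then show "eE l j (FE c (single X 1)) = FE c (eE l j (single X 1))"
      using Cons.prems by (intro FE_commutes_e_single) (auto simp: maya_config_def)
  qed
  then show ?case using Cons by simp
qed simp

definition mv_set :: "nat \<Rightarrow> int set \<Rightarrow> config \<Rightarrow> config" where
  "mv_set c S X = X(c := X c \<union> S, Suc c := X (Suc c) - S)"

lemma mv_mv_set: "mv c p (mv_set c S X) = mv_set c (insert p S) X"
  by (auto simp: mv_def mv_set_def fun_eq_iff)

lemma mv_set_inject:
  assumes "S \<subseteq> X (Suc c) - X c" "S' \<subseteq> X (Suc c) - X c"
  shows "mv_set c S X = mv_set c S' X \<longleftrightarrow> S = S'"
proof
  assume "mv_set c S X = mv_set c S' X"
  then have "X c \<union> S = X c \<union> S'" unfolding mv_set_def by (metis fun_upd_apply n_not_Suc_n)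
  then show "S = S'" using assms by blast
qed simp

lemma keys_FE_power:
  "Z \<in> keys (FW (replicate k c) (single X 1))
    \<Longrightarrow> \<exists>S. S \<subseteq> X (Suc c) - X c \<and> finite S \<and> card S = k \<and> Z = mv_set c S X"
proof (induction k arbitrary: Z)
  case 0
  then have "Z = mv_set c {} X" by (auto simp: mv_set_def fun_eq_iff split: if_splits)
  then show ?case by (intro exI[of _ "{}"]) simp
next
  case (Suc k)
  then obtain Y p where Y: "Y \<in> keys (FW (replicate k c) (single X 1))" "p \<in> Y (Suc c) - Y c" "Z = mv c p Y"
    by (auto elim: keys_FE)
  then obtain S where S: "S \<subseteq> X (Suc c) - X c" "finite S" "card S = k" "Y = mv_set c S X"
    using Suc.IH by blast
  have "p \<notin> S" "p \<in> X (Suc c) - X c" using Y(2) S(4) by (auto simp: mv_set_def)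
  then show ?case
    using S Y(3) by (intro exI[of _ "insert p S"]) (auto simp: mv_mv_set)
qed

text \<open>
  Moving the beads of a set \<open>S\<close> one after the other in different orders gives coefficients of the same
  sign, because the number of beads above a position in the two components together does not change.
  So they do not cancel.
\<close>

definition mv_sign :: "nat \<Rightarrow> config \<Rightarrow> int set \<Rightarrow> ratfun" where
  "mv_sign c X S = (\<Prod>p\<in>S. (-1) ^ (beads_above (X c) p + beads_above (X (Suc c)) p))"

lemma above_mv_set:
  assumes "maya (X c)" "maya (X (Suc c))" "finite S" "S \<subseteq> X (Suc c) - X c"
  shows "maya (mv_set c S X c) \<and> maya (mv_set c S X (Suc c)) \<and>
    beads_above (mv_set c S X c) n + beads_above (mv_set c S X (Suc c)) n = beads_above (X c) n + beads_above (X (Suc c)) n"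
  using assms(3,4)
proof (induction S rule: finite_induct)
  case empty
  then show ?case using assms by (simp add: mv_set_def)
next
  case (insert p S)
  let ?Y = "mv_set c S X"
  have Y: "maya (?Y c)" "maya (?Y (Suc c))" "p \<in> ?Y (Suc c) - ?Y c"
    "beads_above (?Y c) n + beads_above (?Y (Suc c)) n = beads_above (X c) n + beads_above (X (Suc c)) n"
    using insert by (auto simp: mv_set_def)
  have "mv c p ?Y c = insert p (?Y c)" "mv c p ?Y (Suc c) = ?Y (Suc c) - {p}" by (auto simp: mv_def)
  then show ?case
    unfolding mv_mv_set[symmetric]
    using Y above_insert[OF Y(1), of p n] above_remove[OF Y(2), of p n]
    by (simp add: maya_insert maya_remove)
qed

lemma lookup_FE:
  "lookup (FE c y) Z = (\<Sum>Y\<in>keys y. \<Sum>p\<in>Y (Suc c) - Y c. if mv c p Y = Z then lookup y Y * mv_coeff c p Y else 0)"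
  unfolding FE_def lookup_lext lookup_sum sum_distrib_left
  by (intro sum.cong refl) (simp add: lookup_single when_def)

lemma mv_sign_insert: "finite S \<Longrightarrow> p \<notin> S \<Longrightarrow>
    mv_sign c X (insert p S) = (-1) ^ (beads_above (X c) p + beads_above (X (Suc c)) p) * mv_sign c X S"
  by (simp add: mv_sign_def)

lemma FE_power_coefficient:
  assumes X: "maya (X c)" "maya (X (Suc c))"
  shows "S \<subseteq> X (Suc c) - X c \<Longrightarrow> card S = k
    \<Longrightarrow> mv_sign c X S * lookup (FW (replicate k c) (single X 1)) (mv_set c S X) > 0"
proof (induction k arbitrary: S)
  case 0
  have "finite S" using 0(1) maya_Diff_finite[OF X] by (rule finite_subset)
  then have "S = {}" using 0 by simp
  then show ?case by (simp add: mv_sign_def mv_set_def)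
next
  case (Suc k)
  have fin: "finite S'" if "S' \<subseteq> X (Suc c) - X c" for S'
    using that maya_Diff_finite[OF X] by (rule finite_subset)
  define y where "y = FW (replicate k c) (single X 1)"
  define g where "g Y p = mv_sign c X S *
      (if mv c p Y = mv_set c S X then lookup y Y * mv_coeff c p Y else 0)" for Y p
  have eq: "mv_sign c X S * lookup (FW (replicate (Suc k) c) (single X 1)) (mv_set c S X)
      = (\<Sum>Y\<in>keys y. \<Sum>p\<in>Y (Suc c) - Y c. g Y p)"
    by (simp add: lookup_FE y_def[symmetric] g_def sum_distrib_left)
  have pos: "g (mv_set c S' X) p > 0" if S': "p \<notin> S'" "insert p S' = S" for S' p
  proof -
    have sub: "S' \<subseteq> X (Suc c) - X c" and card: "card S' = k" and f: "finite S'"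
      using S' Suc.prems fin[OF Suc.prems(1)] by auto
    let ?Y = "mv_set c S' X"
    let ?k = "qq powi (int (beads_above (?Y c) p) - int (beads_above (?Y (Suc c)) p))"
    have 1: "g ?Y p = mv_sign c X S * (lookup y ?Y * mv_coeff c p ?Y)"
      by (simp add: g_def mv_mv_set S'(2))
    have 2: "mv_sign c X S = (-1) ^ (beads_above (X c) p + beads_above (X (Suc c)) p) * mv_sign c X S'"
      using mv_sign_insert[OF f S'(1), of c X] unfolding S'(2) .
    have 3: "mv_coeff c p ?Y = (-1) ^ (beads_above (X c) p + beads_above (X (Suc c)) p) * ?k"
      unfolding mv_coeff_def using above_mv_set[OF X f sub, of p] by simp
    have 4: "(-1) ^ n * ((-1) ^ n :: ratfun) = 1" for n by (simp flip: power_add)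
    have "g ?Y p = ((-1) ^ (beads_above (X c) p + beads_above (X (Suc c)) p) * (-1) ^ (beads_above (X c) p + beads_above (X (Suc c)) p))
        * ((mv_sign c X S' * lookup y ?Y) * ?k)"
      unfolding 1 2 3 by (simp only: mult_ac)
    also have "\<dots> = (mv_sign c X S' * lookup y ?Y) * ?k" unfolding 4 by simp
    also have "\<dots> > 0"
      using Suc.IH[OF sub card] qq_powi_pos unfolding y_def by (rule mult_pos_pos)
    finally show ?thesis .
  qed
  have nonneg: "g Y p \<ge> 0" if Y: "Y \<in> keys y" "p \<in> Y (Suc c) - Y c" for Y p
  proof (cases "mv c p Y = mv_set c S X")
    case True
    obtain S' where S': "S' \<subseteq> X (Suc c) - X c" "Y = mv_set c S' X"
      using keys_FE_power[OF Y(1)[unfolded y_def]] by blast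
    have p: "p \<notin> S'" "insert p S' \<subseteq> X (Suc c) - X c"
      using Y(2)[unfolded S'(2)] S'(1) by (auto simp: mv_set_def)
    have "mv_set c (insert p S') X = mv_set c S X" using True unfolding S'(2) mv_mv_set .
    then have "insert p S' = S" using mv_set_inject[OF p(2) Suc.prems(1)] by simp
    from pos[OF p(1) this] show ?thesis unfolding S'(2) by (rule less_imp_le)
  qed (simp add: g_def)
  have "S \<noteq> {}" using Suc.prems(2) by auto
  then obtain p where p: "p \<in> S" by blast
  define S' where "S' = S - {p}"
  have S': "p \<notin> S'" "insert p S' = S" using p by (auto simp: S'_def)
  have "lookup y (mv_set c S' X) \<noteq> 0"
    using pos[OF S'] by (auto simp: g_def split: if_splits)
  then have Y: "mv_set c S' X \<in> keys y" by (simp add: in_keys_iff)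
  have pY: "p \<in> mv_set c S' X (Suc c) - mv_set c S' X c"
    using p Suc.prems(1) S'(1) by (auto simp: mv_set_def)
  have finY: "finite (Y (Suc c) - Y c)" if Yy: "Y \<in> keys y" for Y
  proof -
    obtain S' where "S' \<subseteq> X (Suc c) - X c" "Y = mv_set c S' X"
      using keys_FE_power[OF Yy[unfolded y_def]] by blast
    then have "Y (Suc c) - Y c \<subseteq> X (Suc c) - X c" by (auto simp: mv_set_def)
    then show ?thesis by (rule fin)
  qed
  show ?case unfolding eq
  proof (rule sum_pos2[OF _ Y])
    show "(\<Sum>p\<in>mv_set c S' X (Suc c) - mv_set c S' X c. g (mv_set c S' X) p) > 0"
      by (rule sum_pos2[where i = p]) (use finY[OF Y] pY pos[OF S'] nonneg Y in auto)
    show "(\<Sum>p\<in>Y (Suc c) - Y c. g Y p) \<ge> 0" if "Y \<in> keys y" for Y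
      using nonneg[OF that] by (intro sum_nonneg) auto
  qed simp
qed

text \<open>
  For a dominant occupation function \<open>g\<close> with values at most \<open>l\<close>, \<open>charges_of l g\<close> says that \<open>v\<close> lists
  the charges of the vacuum configuration with occupation \<open>g\<close>.
\<close>

definition charges_of :: "nat \<Rightarrow> (int \<Rightarrow> nat) \<Rightarrow> (nat \<Rightarrow> int) \<Rightarrow> bool" where
  "charges_of l g v \<longleftrightarrow> (\<forall>c<l. \<forall>p. p \<le> v c \<longleftrightarrow> l \<le> g p + c)"

definition vac :: "nat \<Rightarrow> (nat \<Rightarrow> int) \<Rightarrow> config \<Rightarrow> config" where
  "vac l v X = (\<lambda>c. if c < l then {..v c} else X c)"

lemma occ_le: "occ l X p \<le> l"
  unfolding occ_def using sum_mono[of "{..<l}" "\<lambda>c. of_bool (p \<in> X c)" "\<lambda>_. 1 :: nat"] by simp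

lemma occ_cong: "(\<And>c. c < l \<Longrightarrow> X c = Y c) \<Longrightarrow> occ l X = occ l Y"
  by (auto simp: occ_def fun_eq_iff intro!: sum.cong)

lemma occ_vac:
  assumes "charges_of l g v" "g p \<le> l"
  shows "occ l (vac l v X) p = g p"
proof -
  have "occ l (vac l v X) p = (\<Sum>c<l. of_bool (l \<le> g p + c))"
    unfolding occ_def using assms(1) by (intro sum.cong) (auto simp: vac_def charges_of_def)
  also have "\<dots> = card ({..<l} \<inter> {c. l \<le> g p + c})" by (simp add: sum_of_bool_eq)
  also have "{..<l} \<inter> {c. l \<le> g p + c} = {l - g p..<l}" by auto
  also have "card \<dots> = g p" using assms(2) by simp
  finally show ?thesis .
qed

text \<open>The maximum of the part of \<open>D\<close> beyond \<open>m\<close>, which is finite, is the end of the ray.\<close>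

lemma down_closed_ray:
  fixes D :: "int set"
  assumes "m \<in> D" "\<And>p. p \<in> D \<Longrightarrow> p \<le> N" "\<And>p. p + 1 \<in> D \<Longrightarrow> p \<in> D"
  shows "\<exists>v. D = {..v}"
proof -
  have fin: "finite (D \<inter> {m..})"
    by (rule finite_subset[of _ "{m..N}"]) (use assms(2) in auto)
  define v where "v = Max (D \<inter> {m..})"
  have v: "v \<in> D" "m \<le> v" using Max_in[OF fin] assms(1) unfolding v_def by auto
  have "p \<le> v" if "p \<in> D" for p
  proof (cases "m \<le> p")
    case True
    then show ?thesis unfolding v_def using fin that by (intro Max_ge) auto
  qed (use v in simp)
  moreover have "p \<in> D" if "p \<le> v" for p
    using that
  proof (induction p rule: int_le_induct)
    case (step i)
    then show ?case using assms(3)[of "i - 1"] by simp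
  qed (rule v)
  ultimately show ?thesis by (intro exI[of _ v]) auto
qed

lemma charges_of_exists:
  assumes X: "maya_config l X" and dec: "\<And>p. occ l X (p + 1) \<le> occ l X p"
  shows "\<exists>v. charges_of l (occ l X) v"
proof -
  obtain m N where m: "\<And>c. c < l \<Longrightarrow> m \<in> X c" and N: "\<And>c. c < l \<Longrightarrow> X c \<subseteq> {..N}"
    using maya_config_bounds[OF X] by (metis atMost_iff order_refl subsetD)
  have "\<exists>v. {p. l \<le> occ l X p + c} = {..v}" if c: "c < l" for c
  proof (rule down_closed_ray)
    have "occ l X m = l" using m by (simp add: occ_def)
    then show "m \<in> {p. l \<le> occ l X p + c}" by simp
    show "p \<le> N" if "p \<in> {p. l \<le> occ l X p + c}" for p
    proof (rule ccontr)
      assume "\<not> p \<le> N"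
      then have "p \<notin> X c" if "c < l" for c using N[OF that] by auto
      then have "occ l X p = 0" by (simp add: occ_def)
      then show False using that c by simp
    qed
    show "p \<in> {p. l \<le> occ l X p + c}" if "p + 1 \<in> {p. l \<le> occ l X p + c}" for p
      using that dec[of p] by simp
  qed
  then have "\<exists>w. \<forall>c. c < l \<longrightarrow> {p. l \<le> occ l X p + c} = {..w c}" by (intro choice) blast
  then obtain w where "\<And>c. c < l \<Longrightarrow> {p. l \<le> occ l X p + c} = {..w c}" by blast
  then have "charges_of l (occ l X) w" unfolding charges_of_def by (metis atMost_iff mem_Collect_eq)
  then show ?thesis by blast
qed

lemma lookup_FW:
  "lookup (FW w y) Z = (\<Sum>Y\<in>keys y. lookup y Y * lookup (FW w (single Y 1)) Z)"
  using lin_expand[OF lin_FW, of w y] by (simp add: lookup_lext)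

lemma keys_FW_single:
  assumes "Z \<in> keys (FW w y)" obtains Y where "Y \<in> keys y" "Z \<in> keys (FW w (single Y 1))"
  using assms lin_keys_le[OF lin_FW, of w y] by blast

text \<open>
  Let \<open>v\<close> and \<open>v'\<close> be interlacing charges. Moving beads from component 1 to component 0, then from 2
  to 1, and so on, the vacuum of charges \<open>v\<close> reaches a configuration whose first \<open>l\<close> components are the
  vacuum of charges \<open>v'\<close>. Each step is forced by its effect on the component that it completes, so
  there is just one way to get there and the coefficient does not vanish. The sets \<open>T m\<close> are the
  unfinished components.
\<close>

lemma interlacing_path:
  assumes inter: "\<And>c. c < l \<Longrightarrow> v c \<le> v' c \<and> v' c \<le> v (Suc c)"
  shows "\<exists>w T. set w \<subseteq> {c. Suc c < Suc l} \<and>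
    lookup (FW w (single (vac (Suc l) v X) 1)) (\<lambda>c. if c < l then {..v' c} else if c = l then T else X c) \<noteq> 0"
proof -
  \<comment> \<open>\<open>T m\<close> is what is left of component \<open>m\<close> when component \<open>m - 1\<close>, if there is one, is complete. It then
    receives from component \<open>m + 1\<close> exactly the beads that it lacks for the vacuum of charge \<open>v' m\<close>.\<close>
  define T where "T = rec_nat {..v 0} (\<lambda>m T. {..v (Suc m)} - ({..v' m} - T))"
  have T0: "T 0 = {..v 0}" and TS: "T (Suc m) = {..v (Suc m)} - ({..v' m} - T m)" for m
    by (simp_all add: T_def)
  define Y where "Y m = (\<lambda>c. if c < m then {..v' c} else if c = m then T m
      else if c < Suc l then {..v c} else X c)" for m
  have T_sub: "T m \<subseteq> {..v m}" for m by (cases m) (auto simp: T0 TS)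
  have T_maya: "maya (T m) \<and> finite ({..v' m} - T m)" for m
  proof (induction m)
    case 0
    then show ?case using maya_Diff_finite[of "T 0" "{..v' 0}"] by (simp add: T0)
  next
    case (Suc m)
    have rem: "maya (A - S)" if "finite S" "maya A" for A S
      using that by (induction S rule: finite_induct) (auto simp: maya_remove Diff_insert[of A _ "_"])
    have "maya (T (Suc m))" unfolding TS using Suc by (intro rem) auto
    then show ?case using maya_Diff_finite[of "T (Suc m)" "{..v' (Suc m)}"] by simp
  qed
  have step: "Y (Suc m) = mv_set m ({..v' m} - T m) (Y m)" if "m < l" for m
    using that inter[OF that] T_sub[of m] by (auto simp: Y_def mv_set_def fun_eq_iff TS)
  have "m \<le> l \<Longrightarrow> \<exists>w. set w \<subseteq> {c. Suc c < Suc l} \<and> lookup (FW w (single (Y 0) 1)) (Y m) \<noteq> 0 \<and>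
      (\<forall>Z\<in>keys (FW w (single (Y 0) 1)). (\<forall>c<m. Z c = {..v' c}) \<longrightarrow> Z = Y m)" for m
  proof (induction m)
    case 0
    show ?case by (intro exI[of _ "[]"]) simp
  next
    case (Suc m)
    then obtain w where w: "set w \<subseteq> {c. Suc c < Suc l}" "lookup (FW w (single (Y 0) 1)) (Y m) \<noteq> 0"
      "\<And>Z. Z \<in> keys (FW w (single (Y 0) 1)) \<Longrightarrow> (\<And>c. c < m \<Longrightarrow> Z c = {..v' c}) \<Longrightarrow> Z = Y m"
      by auto
    have m: "m < l" using Suc.prems by simp
    define S where "S = {..v' m} - T m"
    define y where "y = FW w (single (Y 0) 1)"
    let ?r = "replicate (card S) m"
    have Sub: "S \<subseteq> Y m (Suc m) - Y m m" using inter[OF m] m by (auto simp: S_def Y_def)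
    have maya: "maya (Y m m)" "maya (Y m (Suc m))" using T_maya m by (auto simp: Y_def)
    have unique: "Y' = Y m \<and> Z = Y (Suc m)"
      if Y': "Y' \<in> keys y" and Z: "Z \<in> keys (FW ?r (single Y' 1))" "\<And>c. c < Suc m \<Longrightarrow> Z c = {..v' c}"
      for Y' Z
    proof -
      obtain S' where S': "S' \<subseteq> Y' (Suc m) - Y' m" "Z = mv_set m S' Y'" using keys_FE_power[OF Z(1)] by blast
      have "Y' c = {..v' c}" if "c < m" for c
        using Z(2)[of c] that by (simp add: S'(2) mv_set_def)
      then have eq: "Y' = Y m" using w(3) Y' unfolding y_def by blast
      have "T m \<union> S' = {..v' m}" using Z(2)[of m] by (simp add: S'(2) mv_set_def eq Y_def)
      moreover have "S' \<inter> T m = {}" using S'(1) by (auto simp: eq Y_def)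
      ultimately have "S' = S" by (auto simp: S_def)
      then show ?thesis using step[OF m] eq S'(2) by (simp add: S_def)
    qed
    have Ym: "Y (Suc m) c = {..v' c}" if "c < Suc m" for c using that by (simp add: Y_def)
    have in_y: "Y m \<in> keys y" using w(2) by (simp add: y_def in_keys_iff)
    have "lookup (FW ?r y) (Y (Suc m)) = (\<Sum>Y'\<in>keys y. if Y' = Y m then
        lookup y (Y m) * lookup (FW ?r (single (Y m) 1)) (Y (Suc m)) else 0)"
      unfolding lookup_FW[of ?r y]
    proof (intro sum.cong refl)
      fix Y' assume Y': "Y' \<in> keys y"
      show "lookup y Y' * lookup (FW ?r (single Y' 1)) (Y (Suc m)) = (if Y' = Y m then
        lookup y (Y m) * lookup (FW ?r (single (Y m) 1)) (Y (Suc m)) else 0)"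
      proof (cases "Y' = Y m")
        case False
        then have "Y (Suc m) \<notin> keys (FW ?r (single Y' 1))" using unique[OF Y' _ Ym] by blast
        then show ?thesis using False by (simp add: in_keys_iff)
      qed simp
    qed
    also have "\<dots> = lookup y (Y m) * lookup (FW ?r (single (Y m) 1)) (Y (Suc m))"
      using in_y by simp
    also have "\<dots> \<noteq> 0"
    proof -
      have "lookup (FW ?r (single (Y m) 1)) (Y (Suc m)) \<noteq> 0"
        using FE_power_coefficient[OF maya Sub refl] step[OF m, folded S_def] by auto
      then show ?thesis using w(2) by (simp add: y_def)
    qed
    finally have 1: "lookup (FW (?r @ w) (single (Y 0) 1)) (Y (Suc m)) \<noteq> 0"
      by (simp add: FW_append y_def)
    have 2: "Z = Y (Suc m)" if "Z \<in> keys (FW (?r @ w) (single (Y 0) 1))" "\<And>c. c < Suc m \<Longrightarrow> Z c = {..v' c}" for Z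
    proof -
      have "Z \<in> keys (FW ?r y)" using that(1) by (simp add: FW_append y_def)
      then obtain Y' where "Y' \<in> keys y" "Z \<in> keys (FW ?r (single Y' 1))" by (rule keys_FW_single)
      then show ?thesis using unique that(2) by blast
    qed
    have 3: "set (?r @ w) \<subseteq> {c. Suc c < Suc l}" using w(1) m by (auto split: if_splits)
    show ?case using 1 2 3 by blast
  qed
  from this[of l] obtain w where w: "set w \<subseteq> {c. Suc c < Suc l}" "lookup (FW w (single (Y 0) 1)) (Y l) \<noteq> 0"
    by auto
  have "Y 0 = vac (Suc l) v X" by (auto simp: Y_def vac_def T0 fun_eq_iff)
  moreover have "Y l = (\<lambda>c. if c < l then {..v' c} else if c = l then T l else X c)"
    by (auto simp: Y_def fun_eq_iff)
  ultimately show ?thesis using w by auto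
qed

lemma maya_config_vac: "maya_config l (vac l v X)"
  by (simp add: maya_config_def vac_def)

text \<open>
  The induction on \<open>l\<close> goes through the vacuum \<open>vac l v' X\<close>, whose last component is already that of \<open>X\<close>.
  It is reached from \<open>vac (Suc l) v X\<close> by an interlacing path, and the word for \<open>l\<close> components then leads from it
  to \<open>X\<close>. All other configurations \<open>Y\<close> after the first step have the charges \<open>v'\<close> in the first \<open>l\<close>
  components without being a vacuum there. So these components have beads in larger positions than in the vacuum,
  while the total occupation is the same; hence the last component of \<open>Y\<close> is smaller than that of \<open>X\<close>.
\<close>

lemma singular_path:
  "maya_config l X \<Longrightarrow> dominant l X \<Longrightarrow> \<exists>w v. set w \<subseteq> {c. Suc c < l} \<and> charges_of l (occ l X) v \<and>
    lookup (FW w (single (vac l v X) 1)) X \<noteq> 0 \<and>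
    (\<forall>Z\<in>keys (FW w (single (vac l v X) 1)). Z \<noteq> X \<longrightarrow> lexless l Z X)"
proof (induction l)
  case 0
  show ?case by (intro exI[of _ "[]"]) (auto simp: vac_def charges_of_def)
next
  case (Suc l)
  have "maya_config l X" "dominant l X"
    using Suc.prems by (auto simp: maya_config_def dominant_def)
  from Suc.IH[OF this] obtain w' v' where w': "set w' \<subseteq> {c. Suc c < l}" and v': "charges_of l (occ l X) v'"
    and w'X: "lookup (FW w' (single (vac l v' X) 1)) X \<noteq> 0"
    and w'Z: "\<And>Z. Z \<in> keys (FW w' (single (vac l v' X) 1)) \<Longrightarrow> Z \<noteq> X \<Longrightarrow> lexless l Z X" by blast
  obtain v where v: "charges_of (Suc l) (occ (Suc l) X) v"
    using charges_of_exists[OF Suc.prems(1)] Suc.prems(2) by (auto simp: dominant_def)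
  have "v c \<le> v' c \<and> v' c \<le> v (Suc c)" if c: "c < l" for c
  proof -
    have "l \<le> occ l X p + c" if "Suc l \<le> occ (Suc l) X p + c" for p
      using that by (cases "p \<in> X l") (auto simp: occ_Suc)
    then have "v c \<le> v' c" using c v v' unfolding charges_of_def by (metis less_SucI order_refl)
    moreover have "Suc l \<le> occ (Suc l) X p + Suc c" if "l \<le> occ l X p + c" for p
      using that by (simp add: occ_Suc)
    then have "v' c \<le> v (Suc c)" using c v v' unfolding charges_of_def by (metis Suc_less_eq order_refl)
    ultimately show ?thesis by simp
  qed
  from interlacing_path[of l v v' X, OF this] obtain w T where w: "set w \<subseteq> {c. Suc c < Suc l}"
    and wT: "lookup (FW w (single (vac (Suc l) v X) 1)) (\<lambda>c. if c < l then {..v' c} else if c = l then T else X c) \<noteq> 0"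
    by blast
  define V where "V = vac (Suc l) v X"
  define z where "z = FW w (single V 1)"
  define Z0 where "Z0 = vac l v' X"
  have mayaV: "maya_config (Suc l) V" by (simp add: V_def maya_config_vac)
  have occV: "occ (Suc l) V = occ (Suc l) X"
    using occ_vac[OF v occ_le] by (auto simp: V_def)
  have occ_z: "occ (Suc l) Y = occ (Suc l) X" if "Y \<in> keys z" for Y
    using FW_occ[of Y w V "Suc l"] that w occV by (simp add: z_def)
  have occ_Z0: "occ l Z0 = occ l X"
    using occ_vac[OF v' occ_le] by (auto simp: Z0_def)
  have Z0z: "Z0 \<in> keys z"
  proof -
    define Y where "Y = (\<lambda>c. if c < l then {..v' c} else if c = l then T else X c)"
    have Yz: "Y \<in> keys z" using wT by (simp add: z_def V_def Y_def in_keys_iff)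
    have "occ l Y = occ l X"
      using occ_Z0 occ_cong[of l Y Z0] by (simp add: Y_def Z0_def vac_def)
    then have "of_bool (p \<in> Y l) = (of_bool (p \<in> X l) :: nat)" for p
      using fun_cong[OF occ_z[OF Yz], of p] by (simp add: occ_Suc)
    then have "p \<in> Y l \<longleftrightarrow> p \<in> X l" for p
      by (metis (full_types) of_bool_eq_iff)
    then have "Y l = X l" by blast
    then have "Y = Z0" by (auto simp: Y_def Z0_def vac_def fun_eq_iff)
    then show ?thesis using Yz by simp
  qed
  have maya_z: "maya_config (Suc l) Y" if "Y \<in> keys z" for Y
    using FW_maya[of Y w "single V 1" "Suc l"] that w mayaV by (auto simp: z_def)
  \<comment> \<open>Both \<open>Y\<close> and \<open>Z0\<close> have the same total occupation, and \<open>Z0\<close> is least in the first \<open>l\<close> components.\<close>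
  have lower: "dless (Y l) (X l)" if Y: "Y \<in> keys z" "Y \<noteq> Z0" for Y
  proof -
    have charge: "charge (Y c) = v' c" if "c < l" for c
    proof -
      have "charge (Y c) = charge (Z0 c)"
        using FW_charge[of Y w V "Suc l" c] FW_charge[of Z0 w V "Suc l" c] Y(1) Z0z w mayaV
        by (simp add: z_def)
      then show ?thesis using that by (simp add: Z0_def vac_def)
    qed
    have my: "maya (Y c)" if "c < Suc l" for c using maya_z[OF Y(1)] that by (auto simp: maya_config_def)
    have Xl: "Z0 l = X l" by (simp add: Z0_def vac_def)
    have sums: "(\<Sum>c<l. beads_above (Y c) n) + beads_above (Y l) n = (\<Sum>c<l. beads_above {..v' c} n) + beads_above (X l) n" for n
    proof -
      have "(\<Sum>c<Suc l. beads_above (Y c) n) = (\<Sum>c<Suc l. beads_above (Z0 c) n)"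
        using above_occ[OF maya_z[OF Y(1)] maya_z[OF Z0z]] occ_z[OF Y(1)] occ_z[OF Z0z] by simp
      moreover have "(\<Sum>c<l. beads_above (Z0 c) n) = (\<Sum>c<l. beads_above {..v' c} n)"
        by (intro sum.cong) (auto simp: Z0_def vac_def)
      ultimately show ?thesis by (simp add: Xl)
    qed
    have ge: "beads_above {..v' c} n \<le> beads_above (Y c) n" if "c < l" for c n
      using above_ge[OF my, of c n] charge[OF that] that by simp
    have le: "beads_above (Y l) n \<le> beads_above (X l) n" for n
      using sums[of n] sum_mono[of "{..<l}" "\<lambda>c. beads_above {..v' c} n" "\<lambda>c. beads_above (Y c) n"] ge by force
    have "Y l \<noteq> X l"
    proof
      assume eq: "Y l = X l"
      have "beads_above (Y c) n = beads_above {..v' c} n" if c: "c < l" for c n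
      proof (rule ccontr)
        assume "beads_above (Y c) n \<noteq> beads_above {..v' c} n"
        then have "beads_above {..v' c} n < beads_above (Y c) n" using ge[OF c, of n] by simp
        then have "(\<Sum>c<l. beads_above {..v' c} n) < (\<Sum>c<l. beads_above (Y c) n)"
          using c ge by (intro sum_strict_mono_ex1) auto
        then show False using sums[of n] eq by simp
      qed
      then have "Y c = {..v' c}" if "c < l" for c
        using above_inject[OF my maya_atMost, of c "v' c"] that by simp
      moreover have "Y c = X c" if "c \<ge> Suc l" for c
        using FW_untouched[of Y w V "Suc l" c] Y(1) w that by (simp add: z_def V_def vac_def)
      ultimately have "Y = Z0" using eq
        by (auto simp: Z0_def vac_def fun_eq_iff not_less_eq_eq le_Suc_eq less_Suc_eq_le)
          (metis Suc_leI le_neq_implies_less linorder_not_less)+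
      then show False using Y(2) by simp
    qed
    then show ?thesis using le by (simp add: dless_def)
  qed
  have last: "Z l = Y l" if "Z \<in> keys (FW w' (single Y 1))" for Z Y
    using FW_untouched[OF that w'] by simp
  have "lookup (FW w' z) X = (\<Sum>Y\<in>keys z. if Y = Z0 then lookup z Z0 * lookup (FW w' (single Z0 1)) X else 0)"
    unfolding lookup_FW[of w' z]
  proof (intro sum.cong refl)
    fix Y assume Y: "Y \<in> keys z"
    show "lookup z Y * lookup (FW w' (single Y 1)) X
        = (if Y = Z0 then lookup z Z0 * lookup (FW w' (single Z0 1)) X else 0)"
    proof (cases "Y = Z0")
      case False
      then have "Y l \<noteq> X l" using lower[OF Y] by (simp add: dless_def)
      then have "X \<notin> keys (FW w' (single Y 1))" using last by metis
      then show ?thesis using False by (simp add: in_keys_iff)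
    qed simp
  qed
  also have "\<dots> = lookup z Z0 * lookup (FW w' (single Z0 1)) X" using Z0z by simp
  also have "\<dots> \<noteq> 0" using Z0z w'X by (simp add: Z0_def in_keys_iff)
  finally have 1: "lookup (FW (w' @ w) (single V 1)) X \<noteq> 0" by (simp add: FW_append z_def)
  have 2: "lexless (Suc l) Z X" if Z: "Z \<in> keys (FW (w' @ w) (single V 1))" "Z \<noteq> X" for Z
  proof -
    have "Z \<in> keys (FW w' z)" using Z(1) by (simp add: FW_append z_def)
    then obtain Y where Y: "Y \<in> keys z" "Z \<in> keys (FW w' (single Y 1))" by (rule keys_FW_single)
    show ?thesis
    proof (cases "Y = Z0")
      case True
      then have "lexless l Z X" using w'Z[of Z] Y(2) Z(2) by (simp add: Z0_def)
      moreover have "Z l = X l" using last[OF Y(2)] True by (simp add: Z0_def vac_def)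
      ultimately show ?thesis unfolding lexless_def by (metis less_Suc_eq)
    next
      case False
      then have "dless (Z l) (X l)" using lower[OF Y(1)] last[OF Y(2)] by simp
      then show ?thesis unfolding lexless_def by (intro exI[of _ l]) auto
    qed
  qed
  have "set (w' @ w) \<subseteq> {c. Suc c < Suc l}" using w w' by auto
  then show ?case using v 1 2 unfolding V_def by blast
qed

lemma eE_vac: "eE l j (single (vac l v X) 1) = 0"
  by (auto simp: eE_def dn_at_def vac_def can_dn_def intro!: sum.neutral)

text \<open>The vacuum is singular, and so are its images under the operators \<open>FE c\<close>, which commute with the \<open>e j\<close>.\<close>

theorem singular_vector_with_leading_term:
  assumes "maya_config l X" "dominant l X"
  shows "\<exists>y. (\<forall>j. eE l j y = 0) \<and> lookup y X \<noteq> 0 \<and> (\<forall>Z\<in>keys y. (Z \<noteq> X \<longrightarrow> lexless l Z X) \<and>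
    maya_config l Z \<and> occ l Z = occ l X \<and> (\<forall>c. charge (Z c) = charge (X c)) \<and> (\<forall>c\<ge>l. Z c = X c))"
proof -
  obtain w v where w: "set w \<subseteq> {c. Suc c < l}" "charges_of l (occ l X) v"
    "lookup (FW w (single (vac l v X) 1)) X \<noteq> 0"
    "\<And>Z. Z \<in> keys (FW w (single (vac l v X) 1)) \<Longrightarrow> Z \<noteq> X \<Longrightarrow> lexless l Z X"
    using singular_path[OF assms] by blast
  define y where "y = FW w (single (vac l v X) 1)"
  have X: "X \<in> keys y" using w(3) by (simp add: y_def in_keys_iff)
  have "eE l j y = 0" for j
    unfolding y_def using w(1)
    by (subst FW_commutes_e) (auto simp: maya_config_vac eE_vac lin_zero[OF lin_FW])
  moreover have "maya_config l Z \<and> occ l Z = occ l X \<and> (\<forall>c. charge (Z c) = charge (X c)) \<and> (\<forall>c\<ge>l. Z c = X c)"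
    if Z: "Z \<in> keys y" for Z
  proof (intro conjI allI impI)
    show "maya_config l Z"
      using FW_maya[OF Z[unfolded y_def] w(1)] by (auto simp: maya_config_vac)
    show "occ l Z = occ l X"
      using FW_occ[OF Z[unfolded y_def] w(1)] FW_occ[OF X[unfolded y_def] w(1)] by simp
    show "charge (Z c) = charge (X c)" for c
      using FW_charge[OF Z[unfolded y_def] w(1) maya_config_vac, of c]
        FW_charge[OF X[unfolded y_def] w(1) maya_config_vac, of c] by simp
    show "Z c = X c" if "c \<ge> l" for c
      using FW_untouched[OF Z[unfolded y_def] w(1) that] that by (simp add: vac_def)
  qed
  ultimately show ?thesis using w(3,4) unfolding y_def by blast
qed

section \<open>Partitions as bead sets\<close>

text \<open>
  Row \<open>a\<close> of a partition is represented by one bead, whose position is the content of the node that may be added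
  to the row. The infinitely many empty rows are included, so that the bead sets contain all small positions.
\<close>

definition row :: "nat list \<Rightarrow> nat \<Rightarrow> nat" where
  "row p a = (if a < length p then p ! a else 0)"

definition bead :: "int \<Rightarrow> nat list \<Rightarrow> nat \<Rightarrow> int" where
  "bead s p a = int (row p a) - int a + s"

definition beads :: "int \<Rightarrow> nat list \<Rightarrow> int set" where
  "beads s p = range (bead s p)"

lemma young_diagram_row: "young_diagram p = {(a, b). b < row p a}"
  by (auto simp: young_diagram_def row_def split: if_splits)

lemma row_antimono: "p \<in> partitions \<Longrightarrow> a \<le> b \<Longrightarrow> row p b \<le> row p a"
  by (cases "a = b") (auto simp: partitions_def row_def sorted_wrt_iff_nth_less)

lemma row_pos_iff: "p \<in> partitions \<Longrightarrow> row p a > 0 \<longleftrightarrow> a < length p"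
  by (auto simp: partitions_def row_def) (metis gr0I nth_mem)

lemma row_inject: "p \<in> partitions \<Longrightarrow> q \<in> partitions \<Longrightarrow> row p = row q \<Longrightarrow> p = q"
proof (rule nth_equalityI)
  assume pq: "p \<in> partitions" "q \<in> partitions" "row p = row q"
  then have "a < length p \<longleftrightarrow> a < length q" for a by (metis row_pos_iff)
  then show len: "length p = length q" by (metis linorder_neqE_nat less_irrefl)
  show "p ! a = q ! a" if "a < length p" for a
    using fun_cong[OF pq(3), of a] that len by (simp add: row_def)
qed

text \<open>Row lengths are weakly decreasing and eventually zero, and this is all there is to a partition.\<close>

lemma row_surj:
  assumes "\<And>a. g (Suc a) \<le> g a" "g n = 0"
  shows "\<exists>p\<in>partitions. row p = g"
proof -
  have anti: "g b \<le> g a" if "a \<le> b" for a b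
    by (rule lift_Suc_antimono_le[where f = g]) (use assms(1) that in auto)
  define k where "k = (LEAST k. g k = 0)"
  have k: "g k = 0" unfolding k_def by (rule LeastI[of _ n]) (rule assms(2))
  have pos: "g a > 0" if "a < k" for a using not_less_Least[of a "\<lambda>k. g k = 0"] that by (simp add: k_def)
  have zero: "g a = 0" if "\<not> a < k" for a using anti[of k a] k that by simp
  have "map g [0..<k] \<in> partitions"
    using anti by (auto simp: partitions_def sorted_wrt_iff_nth_less dest!: pos)
  moreover have "row (map g [0..<k]) = g" using zero by (auto simp: row_def fun_eq_iff)
  ultimately show ?thesis by blast
qed

lemma bead_strict_anti: "p \<in> partitions \<Longrightarrow> a < b \<Longrightarrow> bead s p b < bead s p a"
  using row_antimono[of p a b] by (simp add: bead_def)

lemma bead_inj: "p \<in> partitions \<Longrightarrow> bead s p a = bead s p b \<longleftrightarrow> a = b"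
  using bead_strict_anti[of p a b s] bead_strict_anti[of p b a s] by (cases a b rule: linorder_cases) auto

lemma maya_beads: assumes "p \<in> partitions" shows "maya (beads s p)"
proof -
  have "r \<in> beads s p" if "r \<le> s - int (length p)" for r
  proof -
    have "bead s p (nat (s - r)) = r" using that by (simp add: bead_def row_def)
    then show ?thesis unfolding beads_def by (metis rangeI)
  qed
  moreover have "r \<le> int (row p 0) + s" if "r \<in> beads s p" for r
  proof -
    obtain a where "r = bead s p a" using \<open>r \<in> beads s p\<close> by (auto simp: beads_def)
    then show ?thesis using row_antimono[OF assms, of 0 a] by (simp add: bead_def)
  qed
  ultimately have "{..s - int (length p)} \<subseteq> beads s p" "beads s p \<subseteq> {..int (row p 0) + s}" by auto
  then show ?thesis unfolding maya_def by blast
qed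

text \<open>The beads of the rows decrease, so those beyond \<open>n\<close> belong to an initial segment of the rows.\<close>

lemma bead_above:
  assumes p: "p \<in> partitions"
  shows "n < bead s p a \<longleftrightarrow> a < beads_above (beads s p) n"
proof -
  define D where "D = {a. n < bead s p a}"
  have "{r \<in> beads s p. n < r} = bead s p ` D" by (auto simp: beads_def D_def)
  moreover have "inj_on (bead s p) D" using bead_inj[OF p] by (auto simp: inj_on_def)
  ultimately have card: "beads_above (beads s p) n = card D" and fin: "finite D"
    using maya_finite[OF maya_beads[OF p, of s], of n] by (auto simp: beads_above_def card_image finite_image_iff)
  have "a \<in> D" if "b \<in> D" "a \<le> b" for a b
    using bead_strict_anti[OF p, of a b s] that by (cases "a = b") (auto simp: D_def)
  then have "D = {..<card D}"
  proof -
    assume down: "\<And>b a. b \<in> D \<Longrightarrow> a \<le> b \<Longrightarrow> a \<in> D"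
    show ?thesis
    proof (cases "D = {}")
      case False
      then have "Max D \<in> D" "\<And>b. b \<in> D \<Longrightarrow> b \<le> Max D" using fin by auto
      then have "D = {..Max D}" using down by auto
      then show ?thesis by (metis card_atMost lessThan_Suc_atMost)
    qed simp
  qed
  then show ?thesis unfolding card by (auto simp: D_def)
qed

lemma beads_inject: "p \<in> partitions \<Longrightarrow> q \<in> partitions \<Longrightarrow> beads s p = beads s q \<Longrightarrow> p = q"
proof (rule row_inject)
  assume pq: "p \<in> partitions" "q \<in> partitions" "beads s p = beads s q"
  have "n < bead s p a \<longleftrightarrow> n < bead s q a" for n a by (simp add: bead_above pq)
  then have "bead s p a = bead s q a" for a by (metis linorder_neqE less_irrefl)
  then show "row p = row q" by (auto simp: bead_def fun_eq_iff)
qed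

lemma charge_beads: assumes p: "p \<in> partitions" shows "charge (beads s p) = s"
proof -
  let ?n = "s - int (length p)"
  have "a < beads_above (beads s p) ?n \<longleftrightarrow> a < length p" for a
    using row_pos_iff[OF p, of a] by (auto simp: bead_above[OF p, symmetric] bead_def row_def)
  then have "beads_above (beads s p) ?n = length p" by (metis linorder_neqE_nat less_irrefl)
  moreover have "r \<in> beads s p" if "r \<le> ?n" for r
  proof -
    have "bead s p (nat (s - r)) = r" using that by (simp add: bead_def row_def)
    then show ?thesis unfolding beads_def by (metis rangeI)
  qed
  then have "{r. r \<notin> beads s p \<and> r \<le> ?n} = {}" by blast
  then have "card {r. r \<notin> beads s p \<and> r \<le> ?n} = 0" by (simp only: card.empty)
  ultimately show ?thesis using charge_eq[OF maya_beads[OF p], of s ?n] by (simp del: card_eq_0_iff)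
qed

text \<open>
  The bead \<open>r a\<close> of row \<open>a\<close> is read off from \<open>bead_above\<close>: it lies beyond exactly those positions that have more than
  \<open>a\<close> beads beyond them.
\<close>

lemma beads_surj:
  assumes A: "maya A" and s: "charge A = s"
  shows "\<exists>p\<in>partitions. beads s p = A"
proof -
  obtain m N where mN: "{..m} \<subseteq> A" "A \<subseteq> {..N}" using A by (auto simp: maya_def)
  have "\<exists>v. {n. a < beads_above A n} = {..v}" for a
  proof (rule down_closed_ray)
    have "int (beads_above A (s - int a - 1)) \<ge> int a + 1" using charge_eq[OF A, of "s - int a - 1"] s by simp
    then show "s - int a - 1 \<in> {n. a < beads_above A n}" by simp
    show "n \<le> N" if "n \<in> {n. a < beads_above A n}" for n
    proof (rule ccontr)
      assume "\<not> n \<le> N"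
      then have "{r \<in> A. n < r} = {}" using mN(2) by auto
      then have "beads_above A n = 0" by (simp only: beads_above_def card.empty)
      then show False using that by simp
    qed
    show "n \<in> {n. a < beads_above A n}" if "n + 1 \<in> {n. a < beads_above A n}" for n
      using above_pred[OF A, of "n + 1"] that by simp
  qed
  then obtain w where w: "\<And>a. {n. a < beads_above A n} = {..w a}" by metis
  define r where "r a = w a + 1" for a
  have r: "n < r a \<longleftrightarrow> a < beads_above A n" for a n using w[of a] by (auto simp: r_def set_eq_iff)
  have ge: "r a \<ge> s - int a" for a
  proof -
    have "int (beads_above A (s - int a - 1)) \<ge> int a + 1" using charge_eq[OF A, of "s - int a - 1"] s by simp
    then show ?thesis using r[of "s - int a - 1" a] by simp
  qed
  define g where "g a = nat (r a + int a - s)" for a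
  have g: "int (g a) = r a + int a - s" for a using ge[of a] by (simp add: g_def)
  have "g (Suc a) \<le> g a" for a
  proof -
    have "r (Suc a) - 1 < r (Suc a)" by simp
    then have "Suc a < beads_above A (r (Suc a) - 1)" using r by blast
    then have "a < beads_above A (r (Suc a))"
      using above_pred[OF A, of "r (Suc a)"] by (cases "r (Suc a) \<in> A") auto
    then have "r (Suc a) < r a" using r by blast
    then have "int (g (Suc a)) \<le> int (g a)" by (simp add: g)
    then show ?thesis by simp
  qed
  moreover have am: "int (beads_above A m) = s - m"
  proof -
    have e: "{r. r \<notin> A \<and> r \<le> m} = {}" using mN(1) by auto
    have "card {r. r \<notin> A \<and> r \<le> m} = 0" unfolding e by simp
    then show ?thesis using charge_eq[OF A, of m] s by linarith
  qed
  then have "g (nat (s - m)) = 0"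
  proof (cases "m \<le> s")
    case True
    then have "\<not> m < r (nat (s - m))" unfolding r using am by simp
    then show ?thesis using True by (simp add: g_def)
  next
    case False
    then show ?thesis using am by simp
  qed
  ultimately obtain p where p: "p \<in> partitions" "row p = g" using row_surj by blast
  have "bead s p a = r a" for a by (simp add: bead_def p g)
  then have "r' \<in> beads s p \<longleftrightarrow> (\<exists>a. r a = r')" for r' by (auto simp: beads_def)
  moreover have "(\<exists>a. r a = r') \<longleftrightarrow> r' \<in> A" for r'
  proof -
    have "r a = r' \<longleftrightarrow> \<not> r' < r a \<and> r' - 1 < r a" for a by auto
    then have "r a = r' \<longleftrightarrow> beads_above A r' \<le> a \<and> a < beads_above A (r' - 1)" for a by (simp add: r not_less)
    then show ?thesis using above_pred[OF A, of r'] by auto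
  qed
  ultimately have "beads s p = A" by blast
  then show ?thesis using p(1) by blast
qed

lemma young_diagram_insert_iff:
  assumes pq: "p \<in> partitions" "q \<in> partitions"
  shows "(a, b) \<notin> young_diagram p \<and> young_diagram q = insert (a, b) (young_diagram p)
    \<longleftrightarrow> b = row p a \<and> row q = (row p)(a := Suc (row p a))"
proof
  assume h: "(a, b) \<notin> young_diagram p \<and> young_diagram q = insert (a, b) (young_diagram p)"
  then have e: "b' < row q a' \<longleftrightarrow> (a' = a \<and> b' = b) \<or> b' < row p a'" and b: "\<not> b < row p a" for a' b'
    by (auto simp: young_diagram_row set_eq_iff)
  have other: "row q a' = row p a'" if "a' \<noteq> a" for a'
    using e[of _ a'] that by (metis linorder_neqE_nat less_irrefl)
  have "{..<row q a} = insert b {..<row p a}" using e[of _ a] by auto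
  then have "card {..<row q a} = card (insert b {..<row p a})" by simp
  then have q: "row q a = Suc (row p a)" using b by simp
  then have "b = row p a" using e[of "row p a" a] by simp
  then show "b = row p a \<and> row q = (row p)(a := Suc (row p a))" using q other by auto
next
  assume "b = row p a \<and> row q = (row p)(a := Suc (row p a))"
  then show "(a, b) \<notin> young_diagram p \<and> young_diagram q = insert (a, b) (young_diagram p)"
    by (auto simp: young_diagram_row split: if_splits)
qed

lemma beads_insert:
  assumes p: "p \<in> partitions" and q: "q \<in> partitions" "row q = (row p)(a := Suc (row p a))"
  shows "can_up (bead s p a) (beads s p) \<and> beads s q = up (bead s p a) (beads s p)"
proof -
  have bq: "bead s q a' = (if a' = a then bead s p a + 1 else bead s p a')" for a'
    by (simp add: bead_def q)
  have no: "bead s p a + 1 \<notin> beads s p"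
  proof
    assume "bead s p a + 1 \<in> beads s p"
    then obtain a' where a': "bead s p a' = bead s p a + 1" by (auto simp: beads_def)
    then have "a' \<noteq> a" by auto
    then have "bead s q a' = bead s q a" by (simp add: bq a')
    then show False using bead_inj[OF q(1)] \<open>a' \<noteq> a\<close> by simp
  qed
  have "range (bead s q) = insert (bead s p a + 1) (range (bead s p) - {bead s p a})"
    using bead_inj[OF p, of s] by (auto simp: bq image_iff)
  then show ?thesis using no by (auto simp: can_up_def up_def beads_def)
qed

text \<open>Row \<open>a\<close> can be lengthened: if row \<open>a - 1\<close> had the same length, its bead would be in the way.\<close>

lemma beads_can_up:
  assumes p: "p \<in> partitions" and j: "can_up j (beads s p)"
  shows "\<exists>a. \<exists>q\<in>partitions. j = bead s p a \<and> row q = (row p)(a := Suc (row p a))"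
proof -
  obtain a where a: "j = bead s p a" "j + 1 \<notin> beads s p" using j by (auto simp: can_up_def beads_def)
  have "\<exists>q\<in>partitions. row q = (row p)(a := Suc (row p a))"
  proof (rule row_surj)
    show "((row p)(a := Suc (row p a))) (Suc a') \<le> ((row p)(a := Suc (row p a))) a'" for a'
    proof (cases "Suc a' = a")
      case True
      have "bead s p a' \<noteq> j + 1" using a(2) unfolding beads_def by (metis rangeI)
      then have "row p a' \<noteq> row p a" using True by (auto simp: a(1) bead_def)
      then show ?thesis using True row_antimono[OF p, of a' a] by auto
    qed (use row_antimono[OF p, of a' "Suc a'"] in auto)
    show "((row p)(a := Suc (row p a))) (a + length p + 1) = 0" by (simp add: row_def)
  qed
  then show ?thesis using a(1) by blast
qed

section \<open>Multipartitions as bead configurations\<close>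

definition conf :: "nat \<Rightarrow> int list \<Rightarrow> nat list list \<Rightarrow> config" where
  "conf l s la = (\<lambda>c. if c < l then beads (s ! c) (la ! c) else {})"

lemma multipartitions_nth: "la \<in> multipartitions l \<Longrightarrow> c < l \<Longrightarrow> la ! c \<in> partitions"
  by (auto simp: multipartitions_def)

lemma conf_inject:
  "la \<in> multipartitions l \<Longrightarrow> mu \<in> multipartitions l \<Longrightarrow> conf l s la = conf l s mu \<Longrightarrow> la = mu"
proof (rule nth_equalityI)
  assume h: "la \<in> multipartitions l" "mu \<in> multipartitions l" "conf l s la = conf l s mu"
  then show "length la = length mu" by (simp add: multipartitions_def)
  show "la ! c = mu ! c" if "c < length la" for c
  proof -
    have "c < l" using h that by (simp add: multipartitions_def)
    then show ?thesis
      using fun_cong[OF h(3), of c] beads_inject multipartitions_nth h by (auto simp: conf_def)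
  qed
qed

lemma conf_surj:
  assumes "maya_config l X" "\<And>c. c < l \<Longrightarrow> charge (X c) = s ! c" "\<And>c. c \<ge> l \<Longrightarrow> X c = {}"
  shows "\<exists>la\<in>multipartitions l. conf l s la = X"
proof -
  have "\<exists>p\<in>partitions. beads (s ! c) p = X c" if "c < l" for c
    using assms that by (intro beads_surj) (auto simp: maya_config_def)
  then obtain g where g: "\<And>c. c < l \<Longrightarrow> g c \<in> partitions \<and> beads (s ! c) (g c) = X c" by metis
  have "map g [0..<l] \<in> multipartitions l" using g by (auto simp: multipartitions_def)
  moreover have "conf l s (map g [0..<l]) = X"
    using g assms(3) by (auto simp: conf_def fun_eq_iff not_less)
  ultimately show ?thesis by blast
qed

lemma nodes_row: "la \<in> multipartitions l \<Longrightarrow> (a, b, c) \<in> nodes la \<longleftrightarrow> c < l \<and> b < row (la ! c) a"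
  by (auto simp: nodes_def young_diagram_row multipartitions_def)

lemma adds_node_iff:
  assumes la: "la \<in> multipartitions l" and mu: "mu \<in> multipartitions l"
  shows "adds_node l la (a, b, c) mu \<longleftrightarrow> c < l \<and> mu = la[c := mu ! c] \<and> b = row (la ! c) a
      \<and> row (mu ! c) = (row (la ! c))(a := Suc (row (la ! c) a))"
proof -
  note len = multipartitions_def
  have "adds_node l la (a, b, c) mu \<longleftrightarrow> c < l \<and> (\<forall>c'<l. c' \<noteq> c \<longrightarrow> row (mu ! c') = row (la ! c')) \<and>
      ((a, b) \<notin> young_diagram (la ! c) \<and> young_diagram (mu ! c) = insert (a, b) (young_diagram (la ! c)))"
    (is "?L \<longleftrightarrow> ?R")
  proof
    assume ?L
    then have notin: "(a, b, c) \<notin> nodes la" and eq: "nodes mu = insert (a, b, c) (nodes la)"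
      by (auto simp: adds_node_def)
    have "(a, b, c) \<in> nodes mu" using eq by simp
    then have c: "c < l" using nodes_row[OF mu] by simp
    have e: "b' < row (mu ! c') a' \<longleftrightarrow> (a' = a \<and> b' = b \<and> c' = c) \<or> b' < row (la ! c') a'" if "c' < l" for a' b' c'
      using eq nodes_row[OF mu, of a' b' c'] nodes_row[OF la, of a' b' c'] that by auto
    have "row (mu ! c') a' = row (la ! c') a'" if "c' < l" "c' \<noteq> c" for a' c'
      using e[OF that(1), of _ a'] that(2) by (metis linorder_neqE_nat less_irrefl)
    then show ?R
      using c e[OF c] notin nodes_row[OF la, of a b c] by (auto simp: young_diagram_row)
  next
    assume R: ?R
    have "(a', b', c') \<in> nodes mu \<longleftrightarrow> (a', b', c') \<in> insert (a, b, c) (nodes la)" for a' b' c'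
    proof (cases "c' = c")
      case True
      have "b' < row (mu ! c) a' \<longleftrightarrow> (a' = a \<and> b' = b) \<or> b' < row (la ! c) a'"
        using R by (auto simp: young_diagram_row set_eq_iff)
      then show ?thesis using R True nodes_row[OF la, of a' b' c'] nodes_row[OF mu, of a' b' c'] by auto
    next
      case False
      then show ?thesis using R nodes_row[OF la, of a' b' c'] nodes_row[OF mu, of a' b' c'] by auto
    qed
    then have "nodes mu = insert (a, b, c) (nodes la)" by auto
    then show ?L using R la mu nodes_row[OF la, of a b c]
      by (auto simp: adds_node_def young_diagram_row)
  qed
  also have "\<dots> \<longleftrightarrow> c < l \<and> (\<forall>c'<l. c' \<noteq> c \<longrightarrow> mu ! c' = la ! c') \<and>
      (b = row (la ! c) a \<and> row (mu ! c) = (row (la ! c))(a := Suc (row (la ! c) a)))"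
    using young_diagram_insert_iff[of "la ! c" "mu ! c" a b] multipartitions_nth la mu row_inject by metis
  finally have 1: "adds_node l la (a, b, c) mu \<longleftrightarrow> c < l \<and> (\<forall>c'<l. c' \<noteq> c \<longrightarrow> mu ! c' = la ! c') \<and>
      (b = row (la ! c) a \<and> row (mu ! c) = (row (la ! c))(a := Suc (row (la ! c) a)))" .
  have "(\<forall>c'<l. c' \<noteq> c \<longrightarrow> mu ! c' = la ! c') \<longleftrightarrow> mu = la[c := mu ! c]" if "c < l"
    using la mu that by (auto simp: len list_eq_iff_nth_eq nth_list_update)
  then show ?thesis unfolding 1 by blast
qed

lemma adds_node_multipartitions: "adds_node l la \<gamma> mu \<Longrightarrow> la \<in> multipartitions l \<and> mu \<in> multipartitions l"
  by (simp add: adds_node_def)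

lemma content_bead: "b = row p a \<Longrightarrow> content s (a, b, c) = bead (s ! c) p a"
  by (simp add: bead_def)

lemma adds_node_conf:
  fixes s :: "int list"
  assumes "adds_node l la (a, b, c) mu"
  defines "j \<equiv> content s (a, b, c)"
  shows "c < l" "can_up j (conf l s la c)" "conf l s mu = (conf l s la)(c := up j (conf l s la c))"
    "can_dn j (conf l s mu c)" "conf l s la = (conf l s mu)(c := dn j (conf l s mu c))"
proof -
  have mp: "la \<in> multipartitions l" "mu \<in> multipartitions l" using adds_node_multipartitions[OF assms(1)] by auto
  have h: "c < l" "mu = la[c := mu ! c]" "b = row (la ! c) a"
    "row (mu ! c) = (row (la ! c))(a := Suc (row (la ! c) a))"
    using adds_node_iff[OF mp, of a b c] assms(1) by blast+
  have j: "j = bead (s ! c) (la ! c) a" unfolding j_def by (rule content_bead[OF h(3)])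
  have b: "can_up j (beads (s ! c) (la ! c))" "beads (s ! c) (mu ! c) = up j (beads (s ! c) (la ! c))"
    using beads_insert[OF multipartitions_nth[OF mp(1) h(1)] multipartitions_nth[OF mp(2) h(1)] h(4)]
    unfolding j by auto
  show 1: "c < l" "can_up j (conf l s la c)" using h(1) b by (auto simp: conf_def)
  have "mu ! c' = la ! c'" if "c' \<noteq> c" for c' using h(2) that by (metis nth_list_update_neq)
  then show 2: "conf l s mu = (conf l s la)(c := up j (conf l s la c))"
    using h(1) b by (auto simp: conf_def fun_eq_iff)
  show "can_dn j (conf l s mu c)" "conf l s la = (conf l s mu)(c := dn j (conf l s mu c))"
    unfolding 2 using 1 by (simp_all add: can_dn_up dn_up)
qed

lemma adds_node_unique:
  assumes "adds_node l la (a, b, c) mu" "adds_node l la (a', b', c) mu'"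
    "content s (a, b, c) = content s (a', b', c)"
  shows "a = a' \<and> b = b' \<and> mu = mu'"
proof -
  have mp: "la \<in> multipartitions l" "mu \<in> multipartitions l" "mu' \<in> multipartitions l"
    using adds_node_multipartitions assms by blast+
  have h: "c < l" "b = row (la ! c) a" "b' = row (la ! c) a'"
    using adds_node_iff[OF mp(1,2), of a b c] adds_node_iff[OF mp(1,3), of a' b' c] assms by auto
  have "bead (s ! c) (la ! c) a = bead (s ! c) (la ! c) a'"
    using assms(3) unfolding content_bead[OF h(2)] content_bead[OF h(3)] .
  then have "a = a'" using bead_inj[OF multipartitions_nth[OF mp(1) h(1)]] by simp
  moreover have "conf l s mu = conf l s mu'"
    using adds_node_conf(3)[OF assms(1), of s] adds_node_conf(3)[OF assms(2), of s] assms(3) by simp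
  ultimately show ?thesis using conf_inject[OF mp(2,3)] h by simp
qed

lemma adds_node_exists:
  assumes la: "la \<in> multipartitions l" and c: "c < l" and j: "can_up j (conf l s la c)"
  shows "\<exists>a b mu. adds_node l la (a, b, c) mu \<and> content s (a, b, c) = j"
proof -
  have p: "la ! c \<in> partitions" by (rule multipartitions_nth[OF la c])
  obtain a q where q: "q \<in> partitions" "j = bead (s ! c) (la ! c) a" "row q = (row (la ! c))(a := Suc (row (la ! c) a))"
    using beads_can_up[OF p, of j "s ! c"] j c by (auto simp: conf_def)
  have len: "length la = l" using la by (simp add: multipartitions_def)
  have mu: "la[c := q] \<in> multipartitions l"
    using la q(1) set_update_subset_insert[of la c q] by (auto simp: multipartitions_def)
  have "adds_node l la (a, row (la ! c) a, c) (la[c := q])"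
    unfolding adds_node_iff[OF la mu] using c len q(3) by simp
  then show ?thesis using q(2) content_bead[OF refl] by metis
qed

lemma charge_dn: "maya A \<Longrightarrow> can_dn j A \<Longrightarrow> charge (dn j A) = charge A"
  by (simp add: dn_def can_dn_def charge_insert charge_remove maya_remove)

lemma conf_maya: "la \<in> multipartitions l \<Longrightarrow> maya_config l (conf l s la)"
  and conf_charge: "la \<in> multipartitions l \<Longrightarrow> c < l \<Longrightarrow> charge (conf l s la c) = s ! c"
  and conf_outside: "c \<ge> l \<Longrightarrow> conf l s la c = {}"
  by (auto simp: maya_config_def conf_def maya_beads charge_beads multipartitions_nth)

text \<open>Lowering a bead preserves the charge, so the result is again the configuration of a multipartition.\<close>

lemma removes_node_exists:
  assumes mu: "mu \<in> multipartitions l" and c: "c < l" and j: "can_dn j (conf l s mu c)"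
  shows "\<exists>a b la. adds_node l la (a, b, c) mu \<and> content s (a, b, c) = j"
proof -
  let ?X = "(conf l s mu)(c := dn j (conf l s mu c))"
  have m: "maya (conf l s mu c)" using conf_maya[OF mu] c by (simp add: maya_config_def)
  obtain la where la: "la \<in> multipartitions l" "conf l s la = ?X"
  proof -
    have "maya_config l ?X" using conf_maya[OF mu, of s] maya_dn[OF m] by (simp add: maya_config_def)
    moreover have "charge (?X c') = s ! c'" if "c' < l" for c'
      using conf_charge[OF mu that, of s] charge_dn[OF m j] by (cases "c' = c") auto
    moreover have "?X c' = {}" if "c' \<ge> l" for c' using conf_outside[OF that] that c by auto
    ultimately show thesis using conf_surj[of l ?X s] that by blast
  qed
  then have "can_up j (conf l s la c)" using j by (simp add: can_up_dn)
  then obtain a b mu' where h: "adds_node l la (a, b, c) mu'" "content s (a, b, c) = j"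
    using adds_node_exists[OF la(1) c] by blast
  have "conf l s mu' = conf l s mu"
    using adds_node_conf(3)[OF h(1), of s] j by (simp add: h(2)[unfolded content.simps] la(2) up_dn)
  then have "mu' = mu" using conf_inject adds_node_multipartitions[OF h(1)] mu by blast
  then show ?thesis using h by blast
qed

lemma removes_node_unique:
  assumes "adds_node l la (a, b, c) mu" "adds_node l la' (a', b', c) mu"
    "content s (a, b, c) = content s (a', b', c)"
  shows "a = a' \<and> b = b' \<and> la = la'"
proof -
  have "conf l s la = conf l s la'"
    using adds_node_conf(5)[OF assms(1), of s] adds_node_conf(5)[OF assms(2), of s] assms(3) by simp
  then have "la = la'" using conf_inject adds_node_multipartitions assms by blast
  then show ?thesis using adds_node_unique[of l la a b c mu a' b' mu s] assms by blast
qed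

text \<open>In every component there is at most one addable and at most one removable node of a given content.\<close>

lemma bij_added:
  assumes la: "la \<in> multipartitions l"
  shows "bij_betw (\<lambda>(mu, \<gamma>). snd (snd \<gamma>)) {(mu, \<gamma>). adds_node l la \<gamma> mu \<and> content s \<gamma> = j}
    {c. c < l \<and> can_up j (conf l s la c)}"
  unfolding bij_betw_def
proof
  show "inj_on (\<lambda>(mu, \<gamma>). snd (snd \<gamma>)) {(mu, \<gamma>). adds_node l la \<gamma> mu \<and> content s \<gamma> = j}"
    by (rule inj_onI) (use adds_node_unique[where s = s] in \<open>fastforce simp del: content.simps\<close>)
  show "(\<lambda>(mu, \<gamma>). snd (snd \<gamma>)) ` {(mu, \<gamma>). adds_node l la \<gamma> mu \<and> content s \<gamma> = j}
      = {c. c < l \<and> can_up j (conf l s la c)}" (is "?L = ?R")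
  proof
    show "?L \<subseteq> ?R" using adds_node_conf(1) adds_node_conf(2)[where s = s] by (auto simp del: content.simps)
    show "?R \<subseteq> ?L"
    proof
      fix c assume "c \<in> ?R"
      then obtain a b mu where "adds_node l la (a, b, c) mu" "content s (a, b, c) = j"
        using adds_node_exists[OF la] by blast
      then show "c \<in> ?L" by (intro image_eqI[of _ _ "(mu, (a, b, c))"]) auto
    qed
  qed
qed

lemma bij_removed:
  assumes mu: "mu \<in> multipartitions l"
  shows "bij_betw (\<lambda>(la, \<gamma>). snd (snd \<gamma>)) {(la, \<gamma>). adds_node l la \<gamma> mu \<and> content s \<gamma> = j}
    {c. c < l \<and> can_dn j (conf l s mu c)}"
  unfolding bij_betw_def
proof
  show "inj_on (\<lambda>(la, \<gamma>). snd (snd \<gamma>)) {(la, \<gamma>). adds_node l la \<gamma> mu \<and> content s \<gamma> = j}"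
    by (rule inj_onI) (use removes_node_unique[where s = s] in \<open>fastforce simp del: content.simps\<close>)
  show "(\<lambda>(la, \<gamma>). snd (snd \<gamma>)) ` {(la, \<gamma>). adds_node l la \<gamma> mu \<and> content s \<gamma> = j}
      = {c. c < l \<and> can_dn j (conf l s mu c)}" (is "?L = ?R")
  proof
    show "?L \<subseteq> ?R" using adds_node_conf(1) adds_node_conf(4)[where s = s] by (auto simp del: content.simps)
    show "?R \<subseteq> ?L"
    proof
      fix c assume "c \<in> ?R"
      then obtain a b la where "adds_node l la (a, b, c) mu" "content s (a, b, c) = j"
        using removes_node_exists[OF mu] by blast
      then show "c \<in> ?L" by (intro image_eqI[of _ _ "(la, (a, b, c))"]) auto
    qed
  qed
qed

lemma bij_betw_restrict_image:
  "bij_betw g A {y. Q y} \<Longrightarrow> bij_betw g {x \<in> A. P (g x)} {y. Q y \<and> P y}"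
  by (auto simp: bij_betw_def inj_on_def)

lemma card_addable:
  assumes la: "la \<in> multipartitions l"
  shows "card {\<delta> \<in> addable l s j la. P (snd (snd \<delta>))} = card {c. c < l \<and> can_up j (conf l s la c) \<and> P c}"
proof -
  let ?S = "{(mu, \<gamma>). adds_node l la \<gamma> mu \<and> content s \<gamma> = j}"
  have A: "addable l s j la = snd ` ?S" by (force simp: addable_def)
  have c: "snd (snd \<delta>) = (case (mu, \<delta>) of (mu, \<gamma>) \<Rightarrow> snd (snd \<gamma>))" for mu :: "nat list list" and \<delta> :: node by simp
  have "bij_betw (\<lambda>\<delta>. snd (snd \<delta>)) (addable l s j la) {c. c < l \<and> can_up j (conf l s la c)}"
    using bij_added[OF la, of s j] unfolding bij_betw_def A
    by (auto simp: inj_on_def image_image case_prod_unfold simp del: content.simps)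
  then have "bij_betw (\<lambda>\<delta>. snd (snd \<delta>)) {\<delta> \<in> addable l s j la. P (snd (snd \<delta>))}
      {c. c < l \<and> can_up j (conf l s la c) \<and> P c}"
    by (auto dest: bij_betw_restrict_image[where P = P] simp: conj_assoc)
  then show ?thesis by (rule bij_betw_same_card)
qed

lemma card_removable:
  assumes la: "la \<in> multipartitions l"
  shows "card {\<delta> \<in> removable l s j la. P (snd (snd \<delta>))} = card {c. c < l \<and> can_dn j (conf l s la c) \<and> P c}"
proof -
  let ?S = "{(ka, \<gamma>). adds_node l ka \<gamma> la \<and> content s \<gamma> = j}"
  have A: "removable l s j la = snd ` ?S" by (force simp: removable_def)
  have "bij_betw (\<lambda>\<delta>. snd (snd \<delta>)) (removable l s j la) {c. c < l \<and> can_dn j (conf l s la c)}"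
    using bij_removed[OF la, of s j] unfolding bij_betw_def A
    by (auto simp: inj_on_def image_image case_prod_unfold simp del: content.simps)
  then have "bij_betw (\<lambda>\<delta>. snd (snd \<delta>)) {\<delta> \<in> removable l s j la. P (snd (snd \<delta>))}
      {c. c < l \<and> can_dn j (conf l s la c) \<and> P c}"
    by (auto dest: bij_betw_restrict_image[where P = P] simp: conj_assoc)
  then show ?thesis by (rule bij_betw_same_card)
qed

lemma sum_nb_card:
  assumes "finite S"
  shows "(\<Sum>c\<in>S. nb j (X c)) = int (card {c \<in> S. can_up j (X c)}) - int (card {c \<in> S. can_dn j (X c)})"
proof -
  have "(\<Sum>c\<in>S. nb j (X c)) = (\<Sum>c\<in>S. of_bool (can_up j (X c)) - of_bool (can_dn j (X c)))"
    by (intro sum.cong refl) (auto simp: nb_def can_up_def can_dn_def)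
  then show ?thesis using assms by (simp add: sum_subtractf sum_of_bool_eq Int_def)
qed

lemma N_total_conf: "la \<in> multipartitions l \<Longrightarrow> N_total l s j la = wtE l (conf l s la) j"
  using card_addable[of la l s j "\<lambda>_. True"] card_removable[of la l s j "\<lambda>_. True"]
  by (simp add: N_total_def wtE_def sum_nb_card)

lemma node_less_iff: "node_less \<gamma> \<delta> \<longleftrightarrow> snd (snd \<delta>) < snd (snd \<gamma>)"
  by (cases "(\<gamma>, \<delta>)" rule: node_less.cases) auto

lemma N_succ_conf:
  "la \<in> multipartitions l \<Longrightarrow> c \<le> l \<Longrightarrow> N_succ l s j la (a, b, c) = (\<Sum>c'\<in>{..<c}. nb j (conf l s la c'))"
proof -
  assume la: "la \<in> multipartitions l" and c: "c \<le> l"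
  have "{c'. c' < l \<and> P c' \<and> c' < c} = {c' \<in> {..<c}. P c'}" for P using c by auto
  then show ?thesis
    using card_addable[OF la, of s j "\<lambda>c'. c' < c"] card_removable[OF la, of s j "\<lambda>c'. c' < c"]
    by (simp add: N_succ_def node_less_iff sum_nb_card)
qed

lemma N_prec_conf:
  "la \<in> multipartitions l \<Longrightarrow> N_prec l s j la (a, b, c) = (\<Sum>c'\<in>{c<..<l}. nb j (conf l s la c'))"
proof -
  assume la: "la \<in> multipartitions l"
  have "{c'. c' < l \<and> P c' \<and> c < c'} = {c' \<in> {c<..<l}. P c'}" for P by auto
  then show ?thesis
    using card_addable[OF la, of s j "\<lambda>c'. c < c'"] card_removable[OF la, of s j "\<lambda>c'. c < c'"]
    by (simp add: N_prec_def node_less_iff sum_nb_card)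
qed

section \<open>The Fock space inside the space of bead configurations\<close>

lemma linear_extension_eq: "linear_extension = lext"
  by (simp add: fun_eq_iff linear_extension_def lext_def fock_scale_def sc_def)

lemma fock_scale_eq: "fock_scale = sc"
  by (simp add: fun_eq_iff fock_scale_def sc_def)

text \<open>
  This injection carries the operators \<open>e\<^sub>j\<close> and \<open>f\<^sub>j\<close> of the Fock space to those on configurations, and it
  preserves the form. So the axioms for the Fock space are inherited from those for configurations.
\<close>

definition to_config :: "nat \<Rightarrow> int list \<Rightarrow> fock \<Rightarrow> (config \<Rightarrow>\<^sub>0 ratfun)" where
  "to_config l s = lext (\<lambda>la. single (conf l s la) 1)"

lemma lin_to_config: "lin (to_config l s)" by (simp add: to_config_def lin_lext)

lemma to_config_single [simp]: "to_config l s (single la a) = single (conf l s la) a"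
  by (simp add: to_config_def)

lemma lookup_to_config:
  assumes "keys x \<subseteq> multipartitions l" "la \<in> multipartitions l"
  shows "lookup (to_config l s x) (conf l s la) = lookup x la"
proof -
  have "lookup (to_config l s x) (conf l s la) = (\<Sum>mu\<in>keys x. if mu = la then lookup x mu else 0)"
    unfolding to_config_def lookup_lext
    by (intro sum.cong refl) (use assms conf_inject in \<open>auto simp: lookup_single when_def\<close>)
  then show ?thesis by (simp add: in_keys_iff)
qed

lemma to_config_inject:
  assumes "keys x \<subseteq> multipartitions l" "keys y \<subseteq> multipartitions l" "to_config l s x = to_config l s y"
  shows "x = y"
proof (rule poly_mapping_eqI)
  fix la
  show "lookup x la = lookup y la"
  proof (cases "la \<in> multipartitions l")
    case True
    then show ?thesis using lookup_to_config assms by metis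
  next
    case False
    then have "la \<notin> keys x" "la \<notin> keys y" using assms by auto
    then show ?thesis by (simp add: in_keys_iff)
  qed
qed

lemma keys_to_config: "Z \<in> keys (to_config l s x) \<Longrightarrow> \<exists>la\<in>keys x. Z = conf l s la"
  using keys_lext[of "\<lambda>la. single (conf l s la) (1::ratfun)" x] unfolding to_config_def by auto

lemma to_config_surj:
  assumes "keys y \<subseteq> conf l s ` multipartitions l"
  obtains x where "keys x \<subseteq> multipartitions l" "to_config l s x = y"
proof -
  define r where "r Z = (SOME la. la \<in> multipartitions l \<and> conf l s la = Z)" for Z
  have r: "r Z \<in> multipartitions l \<and> conf l s (r Z) = Z" if "Z \<in> keys y" for Z
    unfolding r_def by (rule someI_ex) (use assms that in auto)
  define x where "x = lext (\<lambda>Z. single (r Z) 1) y"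
  have "keys x \<subseteq> multipartitions l"
    using keys_lext[of "\<lambda>Z. single (r Z) (1::ratfun)" y] r unfolding x_def by auto
  moreover have "to_config l s x = lext (\<lambda>Z. single Z 1) y"
    unfolding x_def lin_lext_compose[OF lin_to_config] by (rule lext_cong) (simp add: r)
  ultimately show ?thesis using that lext_singles by metis
qed

lemma Fock_f_single: "uq_f (Fock l s) j (single la 1)
    = (\<Sum>(mu, \<gamma>) \<in> {(mu, \<gamma>). adds_node l la \<gamma> mu \<and> content s \<gamma> = j}. single mu (qq powi N_succ l s j la \<gamma>))"
  by (simp add: Fock_def linear_extension_eq)

lemma Fock_e_single: "uq_e (Fock l s) j (single mu 1)
    = (\<Sum>(la, \<gamma>) \<in> {(la, \<gamma>). adds_node l la \<gamma> mu \<and> content s \<gamma> = j}. single la (qq powi (- N_prec l s j la \<gamma>)))"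
  by (simp add: Fock_def linear_extension_eq)

lemma lin_Fock: "lin (uq_e (Fock l s) j)" "lin (uq_f (Fock l s) j)"
  by (simp_all add: Fock_def linear_extension_eq lin_lext)

lemma to_config_f_single:
  assumes la: "la \<in> multipartitions l"
  shows "to_config l s (uq_f (Fock l s) j (single la 1)) = fE l j (single (conf l s la) 1)"
proof -
  let ?X = "conf l s la"
  let ?S = "{(mu, \<gamma>). adds_node l la \<gamma> mu \<and> content s \<gamma> = j}"
  let ?T = "{c. c < l \<and> can_up j (?X c)}"
  define k where "k c = single (?X(c := up j (?X c))) (qq powi (\<Sum>c'\<in>{..<c}. nb j (?X c')))" for c
  have "to_config l s (uq_f (Fock l s) j (single la 1))
      = (\<Sum>z\<in>?S. to_config l s (case z of (mu, \<gamma>) \<Rightarrow> single mu (qq powi N_succ l s j la \<gamma>)))"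
    unfolding Fock_f_single by (rule lin_sum[OF lin_to_config])
  also have "\<dots> = (\<Sum>z\<in>?S. k (case z of (mu, \<gamma>) \<Rightarrow> snd (snd \<gamma>)))"
  proof (intro sum.cong refl)
    fix z assume "z \<in> ?S"
    then obtain mu a b c where z: "z = (mu, (a, b, c))" "adds_node l la (a, b, c) mu" "content s (a, b, c) = j"
      by auto
    have "c < l" by (rule adds_node_conf(1)[OF z(2)])
    then show "to_config l s (case z of (mu, \<gamma>) \<Rightarrow> single mu (qq powi N_succ l s j la \<gamma>))
        = k (case z of (mu, \<gamma>) \<Rightarrow> snd (snd \<gamma>))"
      using adds_node_conf(3)[OF z(2), of s] unfolding z(3)
      by (simp add: z(1) k_def N_succ_conf[OF la])
  qed
  also have "\<dots> = (\<Sum>c\<in>?T. k c)"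
    by (rule sum.reindex_bij_betw[OF bij_added[OF la]])
  also have "\<dots> = (\<Sum>c<l. if can_up j (?X c) then k c else 0)"
    by (simp add: sum.If_cases Int_def lessThan_def)
  also have "\<dots> = fE l j (single ?X 1)"
    unfolding fE_def lext_single sc_simps(3) by (intro sum.cong refl) (simp add: up_at_def k_def)
  finally show ?thesis .
qed

lemma to_config_e_single:
  assumes mu: "mu \<in> multipartitions l"
  shows "to_config l s (uq_e (Fock l s) j (single mu 1)) = eE l j (single (conf l s mu) 1)"
proof -
  let ?X = "conf l s mu"
  let ?S = "{(la, \<gamma>). adds_node l la \<gamma> mu \<and> content s \<gamma> = j}"
  let ?T = "{c. c < l \<and> can_dn j (?X c)}"
  define k where "k c = single (?X(c := dn j (?X c))) (qq powi (- (\<Sum>c'\<in>{c<..<l}. nb j (?X c'))))" for c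
  have "to_config l s (uq_e (Fock l s) j (single mu 1))
      = (\<Sum>z\<in>?S. to_config l s (case z of (la, \<gamma>) \<Rightarrow> single la (qq powi (- N_prec l s j la \<gamma>))))"
    unfolding Fock_e_single by (rule lin_sum[OF lin_to_config])
  also have "\<dots> = (\<Sum>z\<in>?S. k (case z of (la, \<gamma>) \<Rightarrow> snd (snd \<gamma>)))"
  proof (intro sum.cong refl)
    fix z assume "z \<in> ?S"
    then obtain la a b c where z: "z = (la, (a, b, c))" "adds_node l la (a, b, c) mu" "content s (a, b, c) = j"
      by auto
    have la: "la \<in> multipartitions l" using adds_node_multipartitions[OF z(2)] by blast
    have eq: "conf l s la = ?X(c := dn j (?X c))" using adds_node_conf(5)[OF z(2), of s] unfolding z(3) .
    have "(\<Sum>c'\<in>{c<..<l}. nb j (conf l s la c')) = (\<Sum>c'\<in>{c<..<l}. nb j (?X c'))"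
      by (intro sum.cong refl) (simp add: eq)
    then show "to_config l s (case z of (la, \<gamma>) \<Rightarrow> single la (qq powi (- N_prec l s j la \<gamma>)))
        = k (case z of (la, \<gamma>) \<Rightarrow> snd (snd \<gamma>))"
      using eq by (simp add: z(1) k_def N_prec_conf[OF la])
  qed
  also have "\<dots> = (\<Sum>c\<in>?T. k c)"
    by (rule sum.reindex_bij_betw[OF bij_removed[OF mu]])
  also have "\<dots> = (\<Sum>c<l. if can_dn j (?X c) then k c else 0)"
    by (simp add: sum.If_cases Int_def lessThan_def)
  also have "\<dots> = eE l j (single ?X 1)"
    unfolding eE_def lext_single sc_simps(3) by (intro sum.cong refl) (simp add: dn_at_def k_def)
  finally show ?thesis .
qed

lemma keys_Fock_f: "mu \<in> keys (uq_f (Fock l s) j (single la 1)) \<Longrightarrow> \<exists>\<gamma>. adds_node l la \<gamma> mu"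
  unfolding Fock_f_single by (drule in_keys_sum) auto

lemma keys_Fock_e: "la \<in> keys (uq_e (Fock l s) j (single mu 1)) \<Longrightarrow> \<exists>\<gamma>. adds_node l la \<gamma> mu"
  unfolding Fock_e_single by (drule in_keys_sum) auto

lemma to_config_e:
  assumes "keys x \<subseteq> multipartitions l"
  shows "to_config l s (uq_e (Fock l s) j x) = eE l j (to_config l s x)"
  by (rule lin_eq_on[OF lin_compose[OF lin_to_config lin_Fock(1)] lin_compose[OF config.lin_e lin_to_config]])
    (use assms to_config_e_single in auto)

lemma to_config_f:
  assumes "keys x \<subseteq> multipartitions l"
  shows "to_config l s (uq_f (Fock l s) j x) = fE l j (to_config l s x)"
  by (rule lin_eq_on[OF lin_compose[OF lin_to_config lin_Fock(2)] lin_compose[OF config.lin_f lin_to_config]])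
    (use assms to_config_f_single in auto)

lemma Fock_closed:
  assumes "keys x \<subseteq> multipartitions l"
  shows "keys (uq_e (Fock l s) j x) \<subseteq> multipartitions l" "keys (uq_f (Fock l s) j x) \<subseteq> multipartitions l"
proof -
  show "keys (uq_e (Fock l s) j x) \<subseteq> multipartitions l"
    using lin_keys_le[OF lin_Fock(1), of l s j x] keys_Fock_e adds_node_multipartitions by blast
  show "keys (uq_f (Fock l s) j x) \<subseteq> multipartitions l"
    using lin_keys_le[OF lin_Fock(2), of l s j x] keys_Fock_f adds_node_multipartitions by blast
qed

lemma finite_nodes: "la \<in> multipartitions l \<Longrightarrow> finite (nodes la)"
proof -
  assume la: "la \<in> multipartitions l"
  have "nodes la = (\<Union>c<l. \<Union>a<length (la ! c). (\<lambda>b. (a, b, c)) ` {..<la ! c ! a})"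
    using la by (auto simp: nodes_def young_diagram_def multipartitions_def)
  then show ?thesis by simp
qed

lemma card_nodes_adds: "adds_node l la \<gamma> mu \<Longrightarrow> card (nodes mu) = Suc (card (nodes la))"
  using finite_nodes by (auto simp: adds_node_def)

lemma nodes_bound:
  assumes la: "la \<in> multipartitions l" and n: "(a, b, c) \<in> nodes la"
  shows "a < card (nodes la) \<and> b < card (nodes la) \<and> c < l"
proof -
  have h: "c < l" "b < row (la ! c) a" using n nodes_row[OF la] by auto
  have "(\<lambda>a'. (a', 0, c)) ` {..a} \<subseteq> nodes la"
    using h row_antimono[OF multipartitions_nth[OF la h(1)]] nodes_row[OF la] by fastforce
  then have "card ((\<lambda>a'. (a', 0::nat, c)) ` {..a}) \<le> card (nodes la)"
    by (rule card_mono[OF finite_nodes[OF la]])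
  moreover have "(\<lambda>b'. (a, b', c)) ` {..b} \<subseteq> nodes la"
    using h nodes_row[OF la] by auto
  then have "card ((\<lambda>b'. (a, b', c)) ` {..b}) \<le> card (nodes la)"
    by (rule card_mono[OF finite_nodes[OF la]])
  ultimately show ?thesis using h(1) by (simp add: card_image inj_on_def)
qed

lemma nodes_inject: "la \<in> multipartitions l \<Longrightarrow> mu \<in> multipartitions l \<Longrightarrow> nodes la = nodes mu \<Longrightarrow> la = mu"
proof (rule nth_equalityI)
  assume h: "la \<in> multipartitions l" "mu \<in> multipartitions l" "nodes la = nodes mu"
  then show "length la = length mu" by (simp add: multipartitions_def)
  show "la ! c = mu ! c" if "c < length la" for c
  proof (rule row_inject)
    have c: "c < l" using h that by (simp add: multipartitions_def)
    then show "la ! c \<in> partitions" "mu ! c \<in> partitions" using h multipartitions_nth by blast+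
    have "b < row (la ! c) a \<longleftrightarrow> b < row (mu ! c) a" for a b
      using nodes_row[OF h(1), of a b c] nodes_row[OF h(2), of a b c] h(3) c by simp
    then have "row (la ! c) a = row (mu ! c) a" for a by (metis linorder_neqE_nat less_irrefl)
    then show "row (la ! c) = row (mu ! c)" by auto
  qed
qed

lemma finite_multipartitions_bounded: "finite {la \<in> multipartitions l. card (nodes la) < n}"
proof (rule finite_imageD)
  have "nodes ` {la \<in> multipartitions l. card (nodes la) < n} \<subseteq> Pow ({..<n} \<times> {..<n} \<times> {..<l})"
    using nodes_bound by fastforce
  then show "finite (nodes ` {la \<in> multipartitions l. card (nodes la) < n})"
    by (rule finite_subset) simp
  show "inj_on nodes {la \<in> multipartitions l. card (nodes la) < n}"
    using nodes_inject by (auto simp: inj_on_def)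
qed

theorem graded_contravariant_Fock:
  "graded_contravariant (multipartitions l) (uq_e (Fock l s)) (uq_f (Fock l s))
    (\<lambda>la j. N_total l s j la) (\<lambda>la. card (nodes la))"
proof
  show "lin (uq_e (Fock l s) j)" "lin (uq_f (Fock l s) j)" for j by (rule lin_Fock)+
  fix la assume la: "la \<in> multipartitions l"
  have k1: "keys (single la (1::ratfun)) \<subseteq> multipartitions l" using la by simp
  show "keys (uq_f (Fock l s) j (single la 1)) \<subseteq> multipartitions l" for j
    by (rule Fock_closed(2)[OF k1])
  show "mu \<in> multipartitions l \<and> (\<forall>i. N_total l s i mu = N_total l s i la + cartan i j)"
    if mu: "mu \<in> keys (uq_e (Fock l s) j (single la 1))" for mu j
  proof -
    have m: "mu \<in> multipartitions l" using Fock_closed(1)[OF k1] mu by blast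
    have "lookup (eE l j (single (conf l s la) 1)) (conf l s mu) = lookup (uq_e (Fock l s) j (single la 1)) mu"
      unfolding to_config_e_single[OF la, symmetric] by (rule lookup_to_config[OF Fock_closed(1)[OF k1] m])
    then have "conf l s mu \<in> keys (eE l j (single (conf l s la) 1))" using mu by (simp add: in_keys_iff)
    then show ?thesis
      using contravariant.e_basis[OF contravariant_config, of "conf l s la" "conf l s mu" l j] m la
      by (simp add: N_total_conf)
  qed
  show "uq_e (Fock l s) i (uq_f (Fock l s) j (single la 1)) - uq_f (Fock l s) j (uq_e (Fock l s) i (single la 1))
      = (if i = j then single la (qint (N_total l s i la)) else 0)" for i j
  proof (rule to_config_inject)
    show "keys (uq_e (Fock l s) i (uq_f (Fock l s) j (single la 1)) - uq_f (Fock l s) j (uq_e (Fock l s) i (single la 1)))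
        \<subseteq> multipartitions l" by (intro keys_subset_diff Fock_closed k1)
    show "keys (if i = j then single la (qint (N_total l s i la)) else 0) \<subseteq> multipartitions l"
      using la by simp
    show "to_config l s (uq_e (Fock l s) i (uq_f (Fock l s) j (single la 1)) - uq_f (Fock l s) j (uq_e (Fock l s) i (single la 1)))
        = to_config l s (if i = j then single la (qint (N_total l s i la)) else 0)"
      using contravariant.e_f_basis[OF contravariant_config, of "conf l s la" l i j]
      by (cases "i = j") (simp_all add: lin_diff[OF lin_to_config] to_config_e[OF Fock_closed(2)[OF k1]]
          to_config_f[OF Fock_closed(1)[OF k1]] to_config_e[OF k1] to_config_f[OF k1]
          N_total_conf[OF la] lin_zero[OF lin_to_config])
  qed
  show "lookup (uq_f (Fock l s) j (single la 1)) mu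
      = qq powi (N_total l s j la - 1) * lookup (uq_e (Fock l s) j (single mu 1)) la"
    if mu: "mu \<in> multipartitions l" for mu j
  proof -
    have k2: "keys (single mu (1::ratfun)) \<subseteq> multipartitions l" using mu by simp
    show ?thesis
      using contravariant.adj_basis[OF contravariant_config, of "conf l s la" "conf l s mu" l j]
        lookup_to_config[OF Fock_closed(2)[OF k1] mu, of s s j] lookup_to_config[OF Fock_closed(1)[OF k2] la, of s s j]
      by (simp add: to_config_f_single[OF la] to_config_e_single[OF mu] N_total_conf[OF la])
  qed
  show "card (nodes la) = Suc (card (nodes mu))" if "mu \<in> keys (uq_e (Fock l s) j (single la 1))" for mu j
    using keys_Fock_e[OF that] card_nodes_adds by blast
next
  show "finite {la \<in> multipartitions l. card (nodes la) < n}" for n by (rule finite_multipartitions_bounded)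
qed

interpretation fock: graded_contravariant "multipartitions l" "uq_e (Fock l s)" "uq_f (Fock l s)"
    "\<lambda>la j. N_total l s j la" "\<lambda>la. card (nodes la)" for l s
  by (rule graded_contravariant_Fock)

lemma fock_rep: "fock.rep l s = Fock l s"
  unfolding fock.rep_def fock.t_def fock.tinv_def
  by (simp add: Fock_def fock_scale_eq linear_extension_eq diag_def)

section \<open>Singular vectors of the Fock space\<close>

definition vacuum :: "nat \<Rightarrow> fock" where "vacuum l = single (replicate l []) 1"

text \<open>The total occupation of the vacuum with charges \<open>v\<close>.\<close>

definition occ_of :: "int list \<Rightarrow> int \<Rightarrow> nat" where
  "occ_of v p = (\<Sum>c<length v. of_bool (p \<le> v ! c))"

lemma empty_multipartition: "replicate l [] \<in> multipartitions l"
  by (auto simp: multipartitions_def partitions_def)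

lemma beads_Nil: "beads s [] = {..s}"
proof -
  have "r \<in> beads s []" if "r \<le> s" for r
  proof -
    have "bead s [] (nat (s - r)) = r" using that by (simp add: bead_def row_def)
    then show ?thesis unfolding beads_def by (metis rangeI)
  qed
  then show ?thesis by (auto simp: beads_def bead_def row_def)
qed

lemma conf_empty: "conf l s (replicate l []) = vac l (\<lambda>c. s ! c) (\<lambda>_. {})"
  by (auto simp: conf_def vac_def beads_Nil fun_eq_iff)

lemma Lambda_weight_occ_of: "Lambda_weight v j = int (occ_of v j) - int (occ_of v (j + 1))"
  unfolding Lambda_weight_def occ_of_def of_nat_sum sum_subtractf[symmetric]
  by (intro sum.cong refl) (auto simp: fund_weight_def)

lemma vacuum_singular:
  assumes "length v = l"
  shows "fock.singular_of_weight l v (Lambda_weight v) (vacuum l)" "vacuum l \<noteq> 0"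
proof -
  have k: "keys (vacuum l) \<subseteq> multipartitions l" by (simp add: vacuum_def empty_multipartition)
  have "uq_e (Fock l v) j (vacuum l) = 0" for j
  proof (rule to_config_inject[OF fock.e_closed[OF k]])
    show "to_config l v (uq_e (Fock l v) j (vacuum l)) = to_config l v 0"
      unfolding to_config_e[OF k] by (simp add: vacuum_def conf_empty eE_vac lin_zero[OF lin_to_config])
  qed simp
  moreover have "N_total l v j (replicate l []) = Lambda_weight v j" for j
  proof -
    have "occ l (conf l v (replicate l [])) = occ_of v"
      unfolding conf_empty occ_def occ_of_def fun_eq_iff using assms by (intro allI sum.cong) (auto simp: vac_def)
    then show ?thesis by (simp add: N_total_conf[OF empty_multipartition] wtE_occ Lambda_weight_occ_of)
  qed
  ultimately show "fock.singular_of_weight l v (Lambda_weight v) (vacuum l)"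
    using k by (auto simp: fock.singular_of_weight_def fock.singular_def vacuum_def)
  have "lookup (vacuum l) (replicate l []) = 1" by (simp add: vacuum_def)
  then show "vacuum l \<noteq> 0" by auto
qed

lemma V_infty_eq:
  assumes "length v = l"
  shows "V_infty l v = fock.rep l v\<lparr>uq_carrier := range (fock.ev l v (vacuum l))\<rparr>"
  using fock.generated_singular[OF vacuum_singular(1)[OF assms]]
  by (simp add: V_infty_def fock_rep vacuum_def)

lemma V_infty_irreducible:
  "length v = l \<Longrightarrow> irreducible_highest_weight (V_infty l v) (Lambda_weight v)"
  unfolding V_infty_eq by (rule fock.irreducible_range_ev[OF vacuum_singular(1) vacuum_singular(2)])

lemma singular_with_leading_term:
  assumes la: "la \<in> multipartitions l" and dom: "dominant l (conf l s la)"
  shows "\<exists>x. fock.singular l s x \<and> lookup x la \<noteq> 0 \<and>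
    (\<forall>mu\<in>keys x. (mu \<noteq> la \<longrightarrow> lexless l (conf l s mu) (conf l s la)) \<and> occ l (conf l s mu) = occ l (conf l s la))"
proof -
  let ?X = "conf l s la"
  obtain y where y0: "(\<forall>j. eE l j y = 0) \<and> lookup y ?X \<noteq> 0 \<and> (\<forall>Z\<in>keys y. (Z \<noteq> ?X \<longrightarrow> lexless l Z ?X) \<and>
    maya_config l Z \<and> occ l Z = occ l ?X \<and> (\<forall>c. charge (Z c) = charge (?X c)) \<and> (\<forall>c\<ge>l. Z c = ?X c))"
    using singular_vector_with_leading_term[OF conf_maya[OF la] dom] by (rule exE)
  have y: "eE l j y = 0" "lookup y ?X \<noteq> 0"
    "Z \<in> keys y \<Longrightarrow> (Z \<noteq> ?X \<longrightarrow> lexless l Z ?X) \<and> maya_config l Z \<and> occ l Z = occ l ?X \<and>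
      (\<forall>c. charge (Z c) = charge (?X c)) \<and> (\<forall>c\<ge>l. Z c = ?X c)" for j Z
    using y0 by simp_all
  have "keys y \<subseteq> conf l s ` multipartitions l"
  proof
    fix Z assume "Z \<in> keys y"
    then have "maya_config l Z" "\<And>c. c < l \<Longrightarrow> charge (Z c) = s ! c" "\<And>c. c \<ge> l \<Longrightarrow> Z c = {}"
      using y(3)[of Z] conf_charge[OF la, of _ s] conf_outside[of l _ s la] by simp_all
    then show "Z \<in> conf l s ` multipartitions l" using conf_surj[of l Z s] by blast
  qed
  then obtain x where x: "keys x \<subseteq> multipartitions l" "to_config l s x = y" by (rule to_config_surj)
  have "uq_e (Fock l s) j x = 0" for j
    by (rule to_config_inject[where s = s, OF fock.e_closed[OF x(1)]])
      (simp_all add: to_config_e[OF x(1)] x(2) y(1) lin_zero[OF lin_to_config])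
  then have "fock.singular l s x" using x(1) by (simp add: fock.singular_def)
  moreover have "lookup x la \<noteq> 0" using lookup_to_config[OF x(1) la, of s] y(2) x(2) by simp
  moreover have "(mu \<noteq> la \<longrightarrow> lexless l (conf l s mu) ?X) \<and> occ l (conf l s mu) = occ l ?X" if mu: "mu \<in> keys x" for mu
  proof -
    have m: "mu \<in> multipartitions l" using x(1) mu by blast
    have "conf l s mu \<in> keys y"
      using mu lookup_to_config[OF x(1) m, of s] by (simp add: x(2) in_keys_iff)
    then show ?thesis using y(3)[of "conf l s mu"] conf_inject[OF m la, of s] by auto
  qed
  ultimately show ?thesis by blast
qed

lemma singular_maximal_dominant:
  assumes x: "fock.singular l s x" and la: "la \<in> keys x"
    and max: "\<And>mu. mu \<in> keys x \<Longrightarrow> \<not> lexless l (conf l s la) (conf l s mu)"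
  shows "dominant l (conf l s la)"
proof (rule dominant_of_maximal)
  have k: "keys x \<subseteq> multipartitions l" using x by (simp add: fock.singular_def)
  have m: "la \<in> multipartitions l" using k la by blast
  show "eE l j (to_config l s x) = 0" for j
    using x to_config_e[OF k, of s j] by (simp add: fock.singular_def lin_zero[OF lin_to_config])
  show "conf l s la \<in> keys (to_config l s x)"
    using lookup_to_config[OF k m, of s] la by (simp add: in_keys_iff)
  show "maya_config l Z" if "Z \<in> keys (to_config l s x)" for Z
    using keys_to_config[OF that] k conf_maya by blast
  show "\<not> lexless l (conf l s la) Z" if "Z \<in> keys (to_config l s x)" for Z
    using keys_to_config[OF that] max by blast
qed

section \<open>Tableaux and dominant configurations\<close>

lemma multicharges_length: "v \<in> multicharges l \<Longrightarrow> length v = l"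
  by (simp add: multicharges_def)

lemma occ_of_charges:
  assumes v: "v \<in> multicharges l"
  shows "charges_of l (occ_of v) (\<lambda>c. v ! c)"
  unfolding charges_of_def
proof (intro allI impI)
  fix c p assume c: "c < l"
  have len: "length v = l" and mono: "\<And>i j. i \<le> j \<Longrightarrow> j < l \<Longrightarrow> v ! i \<le> v ! j"
    using v by (auto simp: multicharges_def sorted_iff_nth_mono)
  have card: "occ_of v p = card {i. i < l \<and> p \<le> v ! i}"
    by (simp add: occ_of_def len sum_of_bool_eq Int_def)
  show "p \<le> v ! c \<longleftrightarrow> l \<le> occ_of v p + c"
  proof
    assume "p \<le> v ! c"
    then have "{c..<l} \<subseteq> {i. i < l \<and> p \<le> v ! i}" using mono by (auto intro: order_trans)
    then have "card {c..<l} \<le> occ_of v p" unfolding card by (intro card_mono) auto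
    then show "l \<le> occ_of v p + c" using c by simp
  next
    assume h: "l \<le> occ_of v p + c"
    show "p \<le> v ! c"
    proof (rule ccontr)
      assume n: "\<not> p \<le> v ! c"
      have "i \<in> {Suc c..<l}" if "i < l" "p \<le> v ! i" for i
      proof -
        have "\<not> i \<le> c" using mono[of i c] c n that by auto
        then show ?thesis using that by simp
      qed
      then have "{i. i < l \<and> p \<le> v ! i} \<subseteq> {Suc c..<l}" by auto
      then have "occ_of v p \<le> card {Suc c..<l}" unfolding card by (intro card_mono) auto
      then show False using h c by simp
    qed
  qed
qed

lemma occ_of_le: "occ_of v p \<le> length v"
  unfolding occ_of_def using sum_mono[of "{..<length v}" "\<lambda>c. of_bool (p \<le> v ! c)" "\<lambda>_. 1 :: nat"] by simp

lemma occ_of_inject: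
  assumes "v \<in> multicharges l" "v' \<in> multicharges l" "occ_of v = occ_of v'" shows "v = v'"
proof (rule nth_equalityI)
  show "length v = length v'" using assms by (simp add: multicharges_def)
  fix c assume "c < length v"
  then have "p \<le> v ! c \<longleftrightarrow> p \<le> v' ! c" for p
    using occ_of_charges[OF assms(1)] occ_of_charges[OF assms(2)] assms(1,3)
    by (simp add: charges_of_def multicharges_def)
  then show "v ! c = v' ! c" by (metis order_antisym order_refl)
qed

text \<open>Together with \<open>dominant_of_maximal\<close>, this shows that only the weights \<open>\<Lambda>\<^sub>v\<close> can occur.\<close>

lemma occ_of_exists:
  assumes "maya_config l X" "dominant l X"
  shows "\<exists>v\<in>multicharges l. occ l X = occ_of v"
proof -
  obtain w where w: "charges_of l (occ l X) w"
    using charges_of_exists[OF assms(1)] assms(2) by (auto simp: dominant_def)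
  have "w c \<le> w c'" if "c \<le> c'" "c' < l" for c c'
  proof -
    have "l \<le> occ l X (w c) + c"
      using w[unfolded charges_of_def, rule_format, of c "w c"] that by simp
    then have "l \<le> occ l X (w c) + c'" using that by simp
    then show ?thesis using w that by (auto simp: charges_of_def)
  qed
  then have "map w [0..<l] \<in> multicharges l" by (auto simp: multicharges_def sorted_iff_nth_mono)
  moreover have "occ l X p = occ_of (map w [0..<l]) p" for p
  proof -
    have "occ l X p = occ l (vac l w X) p" by (rule occ_vac[OF w occ_le, symmetric])
    also have "\<dots> = occ_of (map w [0..<l]) p"
      unfolding occ_def occ_of_def by (intro sum.cong) (auto simp: vac_def)
    finally show ?thesis .
  qed
  ultimately show ?thesis by blast
qed

lemma nth_sorted_list_le_iff:
  fixes S :: "nat set"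
  assumes S: "finite S" "a < card S"
  shows "sorted_list_of_set S ! a \<le> t \<longleftrightarrow> a < card {x \<in> S. x \<le> t}"
proof -
  define xs where "xs = sorted_list_of_set S"
  have xs: "sorted xs" "distinct xs" "set xs = S" "length xs = card S"
    using S by (simp_all add: xs_def)
  define D where "D = {i. i < length xs \<and> xs ! i \<le> t}"
  have "{x \<in> S. x \<le> t} = (!) xs ` D"
    unfolding xs(3)[symmetric] D_def by (auto simp: in_set_conv_nth)
  moreover have "inj_on ((!) xs) D" using xs(2) by (auto simp: inj_on_def D_def nth_eq_iff_index_eq)
  ultimately have card: "card {x \<in> S. x \<le> t} = card D" by (simp add: card_image)
  have fin: "finite D" by (simp add: D_def)
  show ?thesis unfolding card xs_def[symmetric]
  proof
    assume "xs ! a \<le> t"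
    then have "{..a} \<subseteq> D"
      using xs S(2) by (auto simp: D_def intro: order_trans[OF sorted_nth_mono])
    then have "card {..a} \<le> card D" by (rule card_mono[OF fin])
    then show "a < card D" by simp
  next
    assume a: "a < card D"
    show "xs ! a \<le> t"
    proof (rule ccontr)
      assume n: "\<not> xs ! a \<le> t"
      have "i < a" if "i \<in> D" for i
      proof (rule ccontr)
        assume "\<not> i < a"
        then have "xs ! a \<le> xs ! i" using that xs(1) by (intro sorted_nth_mono) (auto simp: D_def)
        then show False using n that by (simp add: D_def)
      qed
      then have "D \<subseteq> {..<a}" by auto
      then have "card D \<le> card {..<a}" by (rule card_mono[OF finite_lessThan])
      then show False using a by simp
    qed
  qed
qed

lemma antimono_int:
  fixes g :: "int \<Rightarrow> nat"
  assumes "\<And>p. g (p + 1) \<le> g p" "p \<le> q" shows "g q \<le> g p"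
  using assms(2)
proof (induction q rule: int_ge_induct)
  case (step q)
  then show ?case using assms(1)[of q] by simp
qed simp

lemma occ_full: "occ l X p = l \<Longrightarrow> c < l \<Longrightarrow> p \<in> X c"
proof (rule ccontr)
  assume h: "occ l X p = l" "c < l" "p \<notin> X c"
  have "occ l X p = card {c. c < l \<and> p \<in> X c}" by (simp add: occ_def sum_of_bool_eq Int_def)
  also have "\<dots> < card {..<l}" using h by (intro psubset_card_mono) auto
  finally show False using h(1) by simp
qed

text \<open>The leading terms of the singular vectors of weight \<open>\<Lambda>\<^sub>v\<close>.\<close>

definition leading :: "nat \<Rightarrow> int list \<Rightarrow> int list \<Rightarrow> nat list list set" where
  "leading l s v = {la \<in> multipartitions l. dominant l (conf l s la) \<and> occ l (conf l s la) = occ_of v}"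

definition row_set :: "nat \<Rightarrow> int list \<Rightarrow> config \<Rightarrow> nat \<Rightarrow> nat set" where
  "row_set l v X b = Suc ` {c. c < l \<and> v ! 0 + 1 + int b \<in> X c}"

definition tableau_of :: "nat \<Rightarrow> int list \<Rightarrow> config \<Rightarrow> nat \<times> nat \<Rightarrow> nat" where
  "tableau_of l v X = (\<lambda>(b, a)\<in>lambda_shape v. sorted_list_of_set (row_set l v X b) ! a)"

context
  fixes l :: nat and v :: "int list"
  assumes l: "l \<ge> 1" and v: "v \<in> multicharges l"
begin

text \<open>
  The \<open>b\<close>-th row of the conjugate diagram has one box for each \<open>c\<close> with \<open>v ! c - v ! 0 > b\<close>, that is, for each
  bead in position \<open>v ! 0 + 1 + b\<close> of the vacuum with charges \<open>v\<close>.
\<close>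

lemma shape_iff: "(b, a) \<in> lambda_shape v \<longleftrightarrow> a < occ_of v (v ! 0 + 1 + int b)"
proof -
  have len: "length v = l" using v by (rule multicharges_length)
  let ?p = "v ! 0 + 1 + int b"
  have "(b, a) \<in> lambda_shape v \<longleftrightarrow> (a, b) \<in> young_diagram (map (\<lambda>x. nat (x - v ! 0)) (rev v))"
    by (force simp: lambda_shape_def)
  also have "\<dots> \<longleftrightarrow> a < l \<and> ?p \<le> v ! (l - 1 - a)"
    by (auto simp: young_diagram_def len rev_nth)
  also have "\<dots> \<longleftrightarrow> a < l \<and> l \<le> occ_of v ?p + (l - 1 - a)"
  proof (cases "a < l")
    case True
    then have "l - 1 - a < l" by simp
    then show ?thesis using occ_of_charges[OF v] unfolding charges_of_def by blast
  qed simp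
  also have "\<dots> \<longleftrightarrow> a < occ_of v ?p" using occ_of_le[of v ?p] len by auto
  finally show ?thesis .
qed

lemma finite_shape: "finite (lambda_shape v)"
proof -
  have "finite (young_diagram p)" for p
  proof -
    have "young_diagram p = (\<Union>a<length p. (\<lambda>b. (a, b)) ` {..<p ! a})" by (auto simp: young_diagram_def)
    then show ?thesis by simp
  qed
  then show ?thesis by (simp add: lambda_shape_def)
qed

lemma occ_of_low: "p \<le> v ! 0 \<Longrightarrow> occ_of v p = l"
  using v occ_of_charges[OF v] occ_of_le[of v p] l unfolding charges_of_def
  by (metis add.right_neutral le_antisym less_le_trans multicharges_length zero_less_one)

lemma card_row_set_le: "k \<le> l \<Longrightarrow> card {x \<in> row_set l v X b. x \<le> k} = occ k X (v ! 0 + 1 + int b)"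
proof -
  assume k: "k \<le> l"
  have "{x \<in> row_set l v X b. x \<le> k} = Suc ` {c. c < k \<and> v ! 0 + 1 + int b \<in> X c}"
    using k by (auto simp: row_set_def)
  then show ?thesis by (simp add: card_image occ_def sum_of_bool_eq Int_def)
qed

lemma row_set_sub: "row_set l v X b \<subseteq> {1..l}" by (auto simp: row_set_def)

lemma finite_row_set: "finite (row_set l v X b)" by (rule finite_subset[OF row_set_sub]) simp

lemma card_row_set: "card (row_set l v X b) = occ l X (v ! 0 + 1 + int b)"
proof -
  have "{x \<in> row_set l v X b. x \<le> l} = row_set l v X b" by (auto simp: row_set_def)
  then show ?thesis using card_row_set_le[of l X b] by simp
qed

text \<open>
  The rows of the tableau of a configuration list, for the positions beyond the least charge, the
  components with a bead in that position. The partial occupations of the configuration count the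
  entries up to a given letter, so they decrease if and only if the columns increase weakly.
\<close>

context
  fixes X assumes occX: "occ l X = occ_of v"
begin

lemma row_card: "card (row_set l v X b) = occ_of v (v ! 0 + 1 + int b)"
  by (simp add: card_row_set occX)

lemma tableau_of_in: "(b, a) \<in> lambda_shape v \<Longrightarrow> tableau_of l v X (b, a) \<in> row_set l v X b"
proof -
  assume s: "(b, a) \<in> lambda_shape v"
  then have "a < length (sorted_list_of_set (row_set l v X b))" by (simp add: shape_iff row_card)
  then have "sorted_list_of_set (row_set l v X b) ! a \<in> set (sorted_list_of_set (row_set l v X b))"
    by (rule nth_mem)
  then show ?thesis using s by (simp add: tableau_of_def finite_row_set)
qed

lemma tableau_of_row: "(b, a') \<in> lambda_shape v \<Longrightarrow> a < a' \<Longrightarrow> tableau_of l v X (b, a) < tableau_of l v X (b, a')"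
proof -
  assume s: "(b, a') \<in> lambda_shape v" and a: "a < a'"
  then have "(b, a) \<in> lambda_shape v" by (simp add: shape_iff)
  moreover have "sorted_list_of_set (row_set l v X b) ! a < sorted_list_of_set (row_set l v X b) ! a'"
    using s a by (intro sorted_wrt_nth_less[OF strict_sorted_list_of_set]) (simp_all add: shape_iff row_card)
  ultimately show ?thesis using s by (simp add: tableau_of_def)
qed

lemma tableau_of_surj: "x \<in> row_set l v X b \<Longrightarrow> \<exists>a. (b, a) \<in> lambda_shape v \<and> tableau_of l v X (b, a) = x"
proof -
  assume "x \<in> row_set l v X b"
  then have "x \<in> set (sorted_list_of_set (row_set l v X b))" using finite_row_set by simp
  then obtain a where "a < length (sorted_list_of_set (row_set l v X b))" "sorted_list_of_set (row_set l v X b) ! a = x"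
    by (auto simp: in_set_conv_nth)
  then have "(b, a) \<in> lambda_shape v" "tableau_of l v X (b, a) = x"
    by (simp_all add: shape_iff row_card tableau_of_def)
  then show ?thesis by blast
qed

text \<open>
  The boxes with entry \<open>c + 1\<close> correspond to the beads of component \<open>c\<close> beyond \<open>v ! 0\<close>. As there are no holes
  up to \<open>v ! 0\<close>, their number is the difference of charges.
\<close>

lemma tableau_of_content:
  assumes c: "c < l" and m: "maya (X c)"
  shows "int (card {x \<in> lambda_shape v. tableau_of l v X x = c + 1}) = charge (X c) - v ! 0"
proof -
  let ?A = "{x \<in> lambda_shape v. tableau_of l v X x = c + 1}"
  have "bij_betw (\<lambda>x. v ! 0 + 1 + int (fst x)) ?A {q \<in> X c. v ! 0 < q}"
    unfolding bij_betw_def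
  proof
    show "inj_on (\<lambda>x. v ! 0 + 1 + int (fst x)) ?A"
    proof (rule inj_onI)
      fix x y assume x: "x \<in> ?A" and y: "y \<in> ?A" and eq: "v ! 0 + 1 + int (fst x) = v ! 0 + 1 + int (fst y)"
      obtain b a a' where xy: "x = (b, a)" "y = (b, a')" using eq by (cases x; cases y) auto
      have "\<not> a < a'" "\<not> a' < a"
        using tableau_of_row[of b a' a] tableau_of_row[of b a a'] x y unfolding xy by auto
      then show "x = y" by (simp add: xy)
    qed
    show "(\<lambda>x. v ! 0 + 1 + int (fst x)) ` ?A = {q \<in> X c. v ! 0 < q}"
    proof
      show "(\<lambda>x. v ! 0 + 1 + int (fst x)) ` ?A \<subseteq> {q \<in> X c. v ! 0 < q}"
        using tableau_of_in by (fastforce simp: row_set_def)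
      show "{q \<in> X c. v ! 0 < q} \<subseteq> (\<lambda>x. v ! 0 + 1 + int (fst x)) ` ?A"
      proof
        fix q assume q: "q \<in> {q \<in> X c. v ! 0 < q}"
        define b where "b = nat (q - v ! 0 - 1)"
        have b: "v ! 0 + 1 + int b = q" using q by (simp add: b_def)
        then have "Suc c \<in> row_set l v X b" using q c by (auto simp: row_set_def)
        then obtain a where "(b, a) \<in> lambda_shape v" "tableau_of l v X (b, a) = Suc c"
          using tableau_of_surj by blast
        then show "q \<in> (\<lambda>x. v ! 0 + 1 + int (fst x)) ` ?A" using b by (intro image_eqI[of _ _ "(b, a)"]) auto
      qed
    qed
  qed
  then have "card ?A = beads_above (X c) (v ! 0)" unfolding beads_above_def by (rule bij_betw_same_card)
  moreover have "{r. r \<notin> X c \<and> r \<le> v ! 0} = {}"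
    using occ_full[OF _ c] occ_of_low occX by auto
  then have "card {r. r \<notin> X c \<and> r \<le> v ! 0} = 0" by (simp only: card.empty)
  ultimately show ?thesis using charge_eq[OF m, of "v ! 0"] by linarith
qed

lemma tableau_of_tableaux:
  assumes "dominant l X"
  shows "tableau_of l v X \<in> tableaux (lambda_shape v) l"
  unfolding tableaux_def
proof (intro CollectI conjI allI impI)
  have "tableau_of l v X (b, a) \<in> {1..l}" if "(b, a) \<in> lambda_shape v" for b a
    using tableau_of_in[OF that] row_set_sub by blast
  moreover have "tableau_of l v X \<in> extensional (lambda_shape v)" by (simp add: tableau_of_def)
  ultimately show "tableau_of l v X \<in> lambda_shape v \<rightarrow>\<^sub>E {1..l}" by (auto simp: PiE_def)
  show "tableau_of l v X (b, a) < tableau_of l v X (b, a')"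
    if "(b, a) \<in> lambda_shape v \<and> (b, a') \<in> lambda_shape v \<and> a < a'" for b a a'
    using tableau_of_row that by blast
  show "tableau_of l v X (b, a) \<le> tableau_of l v X (b', a)"
    if h: "(b, a) \<in> lambda_shape v \<and> (b', a) \<in> lambda_shape v \<and> b < b'" for b b' a
  proof -
    define t where "t = tableau_of l v X (b', a)"
    have t: "t \<le> l" using tableau_of_in[of b' a] row_set_sub[of X b'] h by (auto simp: t_def)
    have a: "a < card (row_set l v X b)" "a < card (row_set l v X b')"
      using h by (simp_all add: row_card shape_iff[symmetric])
    have "a < card {x \<in> row_set l v X b'. x \<le> t}"
      using nth_sorted_list_le_iff[OF finite_row_set a(2), of t] h by (simp add: t_def tableau_of_def)
    also have "\<dots> = occ t X (v ! 0 + 1 + int b')" by (rule card_row_set_le[OF t])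
    also have "\<dots> \<le> occ t X (v ! 0 + 1 + int b)"
      by (rule antimono_int[where g = "occ t X"]) (use assms t h in \<open>simp_all add: dominant_def\<close>)
    also have "\<dots> = card {x \<in> row_set l v X b. x \<le> t}" by (rule card_row_set_le[OF t, symmetric])
    finally show ?thesis
      using nth_sorted_list_le_iff[OF finite_row_set a(1), of t] h by (simp add: t_def tableau_of_def)
  qed
qed

end

lemma tableau_of_inject:
  assumes occ: "occ l X = occ_of v" "occ l X' = occ_of v" and eq: "tableau_of l v X = tableau_of l v X'"
    and c: "c < l"
  shows "X c = X' c"
proof (rule set_eqI)
  have rows: "row_set l v X b = row_set l v X' b" for b
    using tableau_of_surj[OF occ(1), of _ b] tableau_of_surj[OF occ(2), of _ b]
      tableau_of_in[OF occ(1), of b] tableau_of_in[OF occ(2), of b] eq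
    by (intro equalityI subsetI) metis+
  fix p
  show "p \<in> X c \<longleftrightarrow> p \<in> X' c"
  proof (cases "p \<le> v ! 0")
    case True
    then show ?thesis using occ_full[OF _ c, of X p] occ_full[OF _ c, of X' p] occ_of_low occ by simp
  next
    case False
    define b where "b = nat (p - v ! 0 - 1)"
    have "v ! 0 + 1 + int b = p" using False by (simp add: b_def)
    then have "p \<in> Y c \<longleftrightarrow> Suc c \<in> row_set l v Y b" for Y using c by (auto simp: row_set_def)
    then show ?thesis using rows by simp
  qed
qed

text \<open>The inverse of \<open>tableau_of\<close>.\<close>

definition config_of :: "(nat \<times> nat \<Rightarrow> nat) \<Rightarrow> config" where
  "config_of T = (\<lambda>c. if c < l then {..v ! 0} \<union>
     (\<lambda>b. v ! 0 + 1 + int b) ` {b. \<exists>a. (b, a) \<in> lambda_shape v \<and> T (b, a) = Suc c} else {})"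

context
  fixes T assumes T: "T \<in> tableaux (lambda_shape v) l"
begin

lemma T_range: "(b, a) \<in> lambda_shape v \<Longrightarrow> T (b, a) \<in> {1..l}"
  and T_row: "(b, a') \<in> lambda_shape v \<Longrightarrow> a < a' \<Longrightarrow> T (b, a) < T (b, a')"
  and T_col: "(b', a) \<in> lambda_shape v \<Longrightarrow> (b, a) \<in> lambda_shape v \<Longrightarrow> b < b' \<Longrightarrow> T (b, a) \<le> T (b', a)"
proof -
  show "(b, a) \<in> lambda_shape v \<Longrightarrow> T (b, a) \<in> {1..l}" using T by (auto simp: tableaux_def PiE_def Pi_def)
  show "T (b, a) < T (b, a')" if h: "(b, a') \<in> lambda_shape v" "a < a'"
  proof -
    have "(b, a) \<in> lambda_shape v" using h by (simp add: shape_iff)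
    then show ?thesis using T h by (simp add: tableaux_def)
  qed
  show "(b', a) \<in> lambda_shape v \<Longrightarrow> (b, a) \<in> lambda_shape v \<Longrightarrow> b < b' \<Longrightarrow> T (b, a) \<le> T (b', a)"
    using T by (simp add: tableaux_def)
qed

lemma row_set_config_of: "row_set l v (config_of T) b = (\<lambda>a. T (b, a)) ` {..<occ_of v (v ! 0 + 1 + int b)}"
proof -
  have "v ! 0 + 1 + int b \<in> config_of T c \<longleftrightarrow> (\<exists>a. (b, a) \<in> lambda_shape v \<and> T (b, a) = Suc c)" if "c < l" for c
    using that by (auto simp: config_of_def)
  then have "x \<in> row_set l v (config_of T) b \<longleftrightarrow> (\<exists>c<l. x = Suc c \<and> (\<exists>a. (b, a) \<in> lambda_shape v \<and> T (b, a) = Suc c))" for x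
    by (auto simp: row_set_def)
  also have "\<dots> x \<longleftrightarrow> (\<exists>a. (b, a) \<in> lambda_shape v \<and> T (b, a) = x)" for x
    using T_range[of b] by (cases x) fastforce+
  finally show ?thesis by (auto simp: shape_iff)
qed

lemma T_row_strict: "strict_mono_on {..<occ_of v (v ! 0 + 1 + int b)} (\<lambda>a. T (b, a))"
  using T_row[of b] by (auto simp: strict_mono_on_def shape_iff)

lemma sorted_row_config_of:
  "sorted_list_of_set (row_set l v (config_of T) b) = map (\<lambda>a. T (b, a)) [0..<occ_of v (v ! 0 + 1 + int b)]"
proof -
  let ?n = "occ_of v (v ! 0 + 1 + int b)"
  let ?xs = "map (\<lambda>a. T (b, a)) [0..<?n]"
  have "sorted_wrt (<) ?xs"
    using T_row[of b] by (auto simp: sorted_wrt_iff_nth_less shape_iff)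
  then have "sorted_list_of_set (set ?xs) = ?xs"
    using sorted_list_of_set.idem_if_sorted_distinct[of ?xs] unfolding strict_sorted_iff by blast
  moreover have "set ?xs = row_set l v (config_of T) b"
    unfolding row_set_config_of by (simp add: atLeast0LessThan)
  ultimately show ?thesis by simp
qed

lemma occ_config_of: "occ l (config_of T) = occ_of v"
proof
  fix p
  show "occ l (config_of T) p = occ_of v p"
  proof (cases "p \<le> v ! 0")
    case True
    then have "occ l (config_of T) p = l" by (simp add: occ_def config_of_def)
    then show ?thesis using occ_of_low[OF True] by simp
  next
    case False
    define b where "b = nat (p - v ! 0 - 1)"
    have b: "v ! 0 + 1 + int b = p" using False by (simp add: b_def)
    have "card (row_set l v (config_of T) b) = occ_of v p"
      unfolding row_set_config_of b using strict_mono_on_imp_inj_on[OF T_row_strict[of b]] b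
      by (simp add: card_image)
    then show ?thesis by (simp add: card_row_set b)
  qed
qed

lemma tableau_of_config_of: "tableau_of l v (config_of T) = T"
proof
  fix x :: "nat \<times> nat"
  obtain b a where x: "x = (b, a)" by (cases x)
  show "tableau_of l v (config_of T) x = T x"
  proof (cases "x \<in> lambda_shape v")
    case True
    then show ?thesis by (simp add: tableau_of_def x sorted_row_config_of shape_iff)
  next
    case False
    moreover have "T \<in> extensional (lambda_shape v)" using T by (auto simp: tableaux_def PiE_def)
    ultimately show ?thesis by (simp add: tableau_of_def extensional_def x)
  qed
qed

lemma maya_config_of: "c < l \<Longrightarrow> maya (config_of T c)"
proof -
  assume c: "c < l"
  obtain n where n: "\<And>x. x \<in> fst ` lambda_shape v \<Longrightarrow> x < n"
    using finite_shape finite_nat_set_iff_bounded[of "fst ` lambda_shape v"] by auto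
  have "{..v ! 0} \<subseteq> config_of T c" using c by (auto simp: config_of_def)
  moreover have "config_of T c \<subseteq> {..v ! 0 + 1 + int n}"
  proof -
    have "b < n" if "(b, a) \<in> lambda_shape v" for a b using n[of b] that by force
    then show ?thesis using c by (fastforce simp: config_of_def)
  qed
  ultimately show ?thesis unfolding maya_def by blast
qed

lemma dominant_config_of: "dominant l (config_of T)"
  unfolding dominant_def
proof (intro allI impI)
  fix k p assume k: "k \<le> l"
  let ?X = "config_of T"
  show "occ k ?X (p + 1) \<le> occ k ?X p"
  proof (cases "p \<le> v ! 0")
    case True
    then have "occ k ?X p = k" using k by (simp add: occ_def config_of_def)
    then show ?thesis using occ_le by simp
  next
    case False
    define b where "b = nat (p - v ! 0 - 1)"
    have b: "v ! 0 + 1 + int b = p" "v ! 0 + 1 + int (Suc b) = p + 1" using False by (simp_all add: b_def)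
    have count: "occ k ?X (v ! 0 + 1 + int b) = card {a. (b, a) \<in> lambda_shape v \<and> T (b, a) \<le> k}" for b
    proof -
      have "{x \<in> row_set l v ?X b. x \<le> k} = (\<lambda>a. T (b, a)) ` {a. (b, a) \<in> lambda_shape v \<and> T (b, a) \<le> k}"
        unfolding row_set_config_of by (auto simp: shape_iff)
      moreover have "inj_on (\<lambda>a. T (b, a)) {a. (b, a) \<in> lambda_shape v \<and> T (b, a) \<le> k}"
        by (rule inj_on_subset[OF strict_mono_on_imp_inj_on[OF T_row_strict[of b]]]) (auto simp: shape_iff)
      ultimately show ?thesis using card_row_set_le[OF k, of ?X b] by (simp add: card_image)
    qed
    have fin: "finite {a. (b, a) \<in> lambda_shape v \<and> T (b, a) \<le> k}"
      by (rule finite_subset[of _ "{..<occ_of v (v ! 0 + 1 + int b)}"]) (auto simp: shape_iff)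
    have "(b, a) \<in> lambda_shape v \<and> T (b, a) \<le> k" if h: "(Suc b, a) \<in> lambda_shape v \<and> T (Suc b, a) \<le> k" for a
    proof -
      have anti: "occ_of v (q + 1) \<le> occ_of v q" for q
        unfolding occ_of_def by (intro sum_mono) auto
      have "(b, a) \<in> lambda_shape v"
        using h anti[of "v ! 0 + 1 + int b"] by (simp add: shape_iff algebra_simps)
      then show ?thesis using T_col[of "Suc b" a b] h by simp
    qed
    then have "card {a. (Suc b, a) \<in> lambda_shape v \<and> T (Suc b, a) \<le> k}
        \<le> card {a. (b, a) \<in> lambda_shape v \<and> T (b, a) \<le> k}"
      by (intro card_mono fin) auto
    then show ?thesis unfolding count[symmetric] b .
  qed
qed

end

theorem leading_tableaux_bij:
  "bij_betw (\<lambda>la. tableau_of l v (conf l s la)) (leading l s v)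
    {T \<in> tableaux (lambda_shape v) l. \<forall>c<l. int (card {x \<in> lambda_shape v. T x = c + 1}) = s ! c - v ! 0}"
  (is "bij_betw ?t _ ?T")
  unfolding bij_betw_def
proof
  show "inj_on ?t (leading l s v)"
  proof (rule inj_onI)
    fix la mu assume h: "la \<in> leading l s v" "mu \<in> leading l s v" "?t la = ?t mu"
    have "conf l s la c = conf l s mu c" for c
    proof (cases "c < l")
      case True
      then show ?thesis using tableau_of_inject[OF _ _ h(3)] h by (simp add: leading_def)
    qed (simp add: conf_def)
    then have "conf l s la = conf l s mu" by (rule ext)
    then show "la = mu" using conf_inject[of la l mu s] h by (simp add: leading_def)
  qed
  show "?t ` leading l s v = ?T"
  proof
    show "?t ` leading l s v \<subseteq> ?T"
    proof
      fix T assume "T \<in> ?t ` leading l s v"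
      then obtain la where la: "la \<in> multipartitions l" "dominant l (conf l s la)" "occ l (conf l s la) = occ_of v"
        and T: "T = ?t la" by (auto simp: leading_def)
      have "int (card {x \<in> lambda_shape v. T x = c + 1}) = s ! c - v ! 0" if "c < l" for c
        unfolding T using tableau_of_content[OF la(3) that] conf_maya[OF la(1), of s] conf_charge[OF la(1) that, of s] that
        by (simp add: maya_config_def)
      then show "T \<in> ?T" using tableau_of_tableaux[OF la(3,2)] T by simp
    qed
    show "?T \<subseteq> ?t ` leading l s v"
    proof
      fix T assume h: "T \<in> ?T"
      then have T: "T \<in> tableaux (lambda_shape v) l" by simp
      have "maya_config l (config_of T)" using maya_config_of[OF T] by (simp add: maya_config_def)
      moreover have "charge (config_of T c) = s ! c" if "c < l" for c
        using tableau_of_content[OF occ_config_of[OF T] that maya_config_of[OF T that]] h that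
        unfolding tableau_of_config_of[OF T] by simp
      moreover have "config_of T c = {}" if "c \<ge> l" for c using that by (simp add: config_of_def)
      ultimately obtain la where la: "la \<in> multipartitions l" "conf l s la = config_of T"
        using conf_surj[of l "config_of T" s] by blast
      then have "la \<in> leading l s v"
        using dominant_config_of[OF T] occ_config_of[OF T] by (simp add: leading_def)
      moreover have "?t la = T" using la(2) tableau_of_config_of[OF T] by simp
      ultimately show "T \<in> ?t ` leading l s v" by blast
    qed
  qed
qed

lemma leading_K_mult: "finite (leading l s v) \<and> card (leading l s v) = K_mult l s v"
proof -
  have "finite (lambda_shape v \<rightarrow>\<^sub>E {1..l})" using finite_shape by (intro finite_PiE) auto
  then have "finite {T \<in> tableaux (lambda_shape v) l. \<forall>c<l. int (card {x \<in> lambda_shape v. T x = c + 1}) = s ! c - v ! 0}"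
    by (rule rev_finite_subset) (auto simp: tableaux_def)
  then show ?thesis
    using bij_betw_finite[OF leading_tableaux_bij[of s]] bij_betw_same_card[OF leading_tableaux_bij[of s]]
    by (simp add: K_mult_def)
qed

end

section \<open>The decomposition\<close>

text \<open>
  Equal occupations confine the beads: beyond some position there are none, and below some position there are all.
\<close>

lemma finite_occ_class: "finite {mu \<in> multipartitions l. occ l (conf l s mu) = occ l (conf l s la)}" (is "finite ?S")
proof (cases "?S = {}")
  case False
  then obtain ka where ka: "ka \<in> multipartitions l" "occ l (conf l s ka) = occ l (conf l s la)" by blast
  have "\<exists>m N. \<forall>c<l. {..m} \<subseteq> conf l s ka c \<and> conf l s ka c \<subseteq> {..N}"
    by (rule maya_config_bounds[OF conf_maya[OF ka(1)]])
  then obtain m N where mN: "\<And>c. c < l \<Longrightarrow> {..m} \<subseteq> conf l s ka c" "\<And>c. c < l \<Longrightarrow> conf l s ka c \<subseteq> {..N}"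
    by blast
  have low: "p \<in> conf l s mu c" if "mu \<in> ?S" "c < l" "p \<le> m" for mu c p
  proof -
    have "occ l (conf l s ka) p = l" using mN(1) that(3) by (auto simp: occ_def subset_iff)
    then show ?thesis using occ_full[of l "conf l s mu" p c] that ka(2) by simp
  qed
  have high: "p \<le> N" if "mu \<in> ?S" "c < l" "p \<in> conf l s mu c" for mu c p
  proof (rule ccontr)
    assume "\<not> p \<le> N"
    then have "p \<notin> conf l s ka c" if "c < l" for c using mN(2)[OF that] by auto
    then have "occ l (conf l s ka) p = 0" by (simp add: occ_def)
    moreover have "occ l (conf l s mu) p = occ l (conf l s ka) p" using that(1) ka(2) by simp
    ultimately have "occ l (conf l s mu) p = 0" by simp
    then show False using that by (auto simp: occ_def)
  qed
  define code where "code mu = {(c, p). c < l \<and> m < p \<and> p \<in> conf l s mu c}" for mu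
  have "inj_on code ?S"
  proof (rule inj_onI)
    fix mu mu' assume h: "mu \<in> ?S" "mu' \<in> ?S" "code mu = code mu'"
    have "conf l s mu c = conf l s mu' c" for c
    proof (cases "c < l")
      case True
      have "p \<in> conf l s mu c \<longleftrightarrow> p \<in> conf l s mu' c" for p
      proof (cases "p \<le> m")
        case True
        then show ?thesis using low[OF h(1) \<open>c < l\<close>] low[OF h(2) \<open>c < l\<close>] by blast
      next
        case False
        then have "p \<in> conf l s ka' c \<longleftrightarrow> (c, p) \<in> code ka'" for ka' using True by (simp add: code_def)
        then show ?thesis using h(3) by simp
      qed
      then show ?thesis by blast
    qed (simp add: conf_def)
    then have "conf l s mu = conf l s mu'" by (rule ext)
    then show "mu = mu'" using conf_inject[of mu l mu' s] h by simp
  qed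
  moreover have "code ` ?S \<subseteq> Pow ({..<l} \<times> {m..N})"
    using high by (fastforce simp: code_def)
  then have "finite (code ` ?S)" by (rule finite_subset) simp
  ultimately show ?thesis by (rule finite_imageD[rotated])
next
  case True
  then show ?thesis by (simp only: finite.emptyI)
qed

text \<open>
  Let \<open>hw\<close> be a family of singular vectors whose leading terms are the dominant configurations, each occurring
  once. It is independent because the leading terms are distinct, and it spans because subtracting a
  multiple of some \<open>hw i\<close> cancels the leading term of a singular vector.
\<close>

context
  fixes l :: nat and s :: "int list" and I :: "'i set" and \<theta> :: "'i \<Rightarrow> nat list list" and hw :: "'i \<Rightarrow> fock"
  assumes \<theta>: "inj_on \<theta> I" "\<theta> ` I = {la \<in> multipartitions l. dominant l (conf l s la)}"
    and hw: "\<And>i. i \<in> I \<Longrightarrow> fock.singular l s (hw i)" "\<And>i. i \<in> I \<Longrightarrow> lookup (hw i) (\<theta> i) \<noteq> 0"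
      "\<And>i mu. i \<in> I \<Longrightarrow> mu \<in> keys (hw i) \<Longrightarrow> mu \<noteq> \<theta> i \<Longrightarrow> lexless l (conf l s mu) (conf l s (\<theta> i))"
      "\<And>i mu. i \<in> I \<Longrightarrow> mu \<in> keys (hw i) \<Longrightarrow> occ l (conf l s mu) = occ l (conf l s (\<theta> i))"
begin

lemma lex_maximal_multipartition:
  assumes "finite S" "S \<noteq> {}" "S \<subseteq> multipartitions l"
  shows "\<exists>la\<in>S. \<forall>mu\<in>S. \<not> lexless l (conf l s la) (conf l s mu)"
proof -
  have "maya_config l X" if "X \<in> conf l s ` S" for X using that assms(3) conf_maya by auto
  then show ?thesis using lexless_maximal_exists[of "conf l s ` S" l] assms by auto
qed

lemma hw_independent:
  assumes c: "keys c \<subseteq> I" "lext hw c = 0" shows "c = 0"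
proof (rule ccontr)
  assume "c \<noteq> 0"
  then have "keys c \<noteq> {}" by auto
  moreover have "\<theta> ` keys c \<subseteq> multipartitions l" using c(1) \<theta>(2) by blast
  ultimately obtain i where i: "i \<in> keys c" and
    max: "\<And>k. k \<in> keys c \<Longrightarrow> \<not> lexless l (conf l s (\<theta> i)) (conf l s (\<theta> k))"
    using lex_maximal_multipartition[of "\<theta> ` keys c"] by auto
  have "lookup (lext hw c) (\<theta> i) = (\<Sum>k\<in>keys c. if k = i then lookup c i * lookup (hw i) (\<theta> i) else 0)"
    unfolding lookup_lext
  proof (intro sum.cong refl)
    fix k assume k: "k \<in> keys c"
    show "lookup c k * lookup (hw k) (\<theta> i) = (if k = i then lookup c i * lookup (hw i) (\<theta> i) else 0)"
    proof (cases "k = i")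
      case False
      have kI: "k \<in> I" "i \<in> I" using k i c(1) by auto
      then have "\<theta> i \<noteq> \<theta> k" using False \<theta>(1) by (auto simp: inj_on_def)
      then have "\<theta> i \<notin> keys (hw k)" using hw(3)[OF kI(1)] max[OF k] by blast
      then show ?thesis using False by (simp add: in_keys_iff)
    qed simp
  qed
  also have "\<dots> = lookup c i * lookup (hw i) (\<theta> i)" using i by simp
  finally have "lookup c i * lookup (hw i) (\<theta> i) = 0" using c(2) by simp
  moreover have "lookup (hw i) (\<theta> i) \<noteq> 0" using hw(2) i c(1) by blast
  ultimately show False using i by (simp add: in_keys_iff)
qed

text \<open>
  The descent in \<open>hw_spanning\<close> ends because this set shrinks. It is finite since only configurations with the
  occupation of some configuration of \<open>z\<close> are taken.
\<close>

definition lower :: "fock \<Rightarrow> nat list list set" where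
  "lower z = {mu \<in> multipartitions l. \<exists>la\<in>keys z. occ l (conf l s mu) = occ l (conf l s la) \<and>
     (mu = la \<or> lexless l (conf l s mu) (conf l s la))}"

lemma finite_lower: "finite (lower z)"
proof -
  have "lower z \<subseteq> (\<Union>la\<in>keys z. {mu \<in> multipartitions l. occ l (conf l s mu) = occ l (conf l s la)})"
    by (auto simp: lower_def)
  then show ?thesis by (rule finite_subset) (simp add: finite_occ_class)
qed

lemma hw_spanning: "fock.singular l s z \<Longrightarrow> \<exists>c. keys c \<subseteq> I \<and> z = lext hw c"
proof (induction "card (lower z)" arbitrary: z rule: less_induct)
  case less
  have kz: "keys z \<subseteq> multipartitions l" using less.prems by (simp add: fock.singular_def)
  show ?case
  proof (cases "keys z = {}")
    case True
    then show ?thesis by (intro exI[of _ 0]) (simp add: lin_zero[OF lin_lext])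
  next
    case False
    then obtain la where la: "la \<in> keys z" and max: "\<And>mu. mu \<in> keys z \<Longrightarrow> \<not> lexless l (conf l s la) (conf l s mu)"
      using lex_maximal_multipartition[OF _ _ kz] by auto
    have "dominant l (conf l s la)" by (rule singular_maximal_dominant[OF less.prems la max])
    then have "la \<in> \<theta> ` I" using kz la \<theta>(2) by auto
    then obtain i where i: "i \<in> I" "\<theta> i = la" by blast
    define a where "a = lookup z la / lookup (hw i) la"
    define z' where "z' = z - sc a (hw i)"
    have khw: "keys (hw i) \<subseteq> multipartitions l" using hw(1)[OF i(1)] by (simp add: fock.singular_def)
    have kz': "keys z' \<subseteq> multipartitions l"
      unfolding z'_def by (intro keys_subset_diff keys_subset_sc kz khw)
    have "fock.singular l s z'"
      using less.prems hw(1)[OF i(1)] kz' by (simp add: fock.singular_def z'_def fock.linearity)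
    moreover have "lower z' \<subset> lower z"
    proof -
      have maya: "maya_config l (conf l s mu)" if "mu \<in> multipartitions l" for mu
        using that by (rule conf_maya)
      have la_notin: "la \<notin> keys z'"
        using hw(2)[OF i(1)] i(2) by (simp add: z'_def a_def in_keys_iff lookup_minus)
      have key: "mu \<in> keys z \<or> (mu \<in> keys (hw i) \<and> mu \<noteq> la)" if "mu \<in> keys z'" for mu
        using that la_notin keys_diff[of z "sc a (hw i)"] keys_sc[of a "hw i"] unfolding z'_def by blast
      have sub: "mu \<in> lower z" if mu: "mu \<in> lower z'" for mu
      proof -
        obtain ka where ka: "ka \<in> keys z'" "occ l (conf l s mu) = occ l (conf l s ka)"
          "mu = ka \<or> lexless l (conf l s mu) (conf l s ka)" and mp: "mu \<in> multipartitions l"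
          using mu by (auto simp: lower_def)
        show ?thesis
        proof (cases "ka \<in> keys z")
          case True
          then show ?thesis using ka mp by (auto simp: lower_def)
        next
          case False
          then have "ka \<in> keys (hw i)" "ka \<noteq> la" using key[OF ka(1)] by auto
          then have less: "lexless l (conf l s ka) (conf l s la)" "occ l (conf l s ka) = occ l (conf l s la)"
            using hw(3)[OF i(1)] hw(4)[OF i(1)] i(2) by auto
          have "lexless l (conf l s mu) (conf l s la)"
            using ka(3) less(1) lexless_trans[OF maya[OF mp] maya[of ka]] ka(1) kz' by blast
          then show ?thesis using la mp ka(2) less(2) by (auto simp: lower_def)
        qed
      qed
      have "la \<notin> lower z'"
      proof
        assume "la \<in> lower z'"
        then obtain ka where ka: "ka \<in> keys z'" "la = ka \<or> lexless l (conf l s la) (conf l s ka)"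
          by (auto simp: lower_def)
        have "la \<noteq> ka" using la_notin ka(1) by blast
        then have lt: "lexless l (conf l s la) (conf l s ka)" using ka(2) by simp
        show False
        proof (cases "ka \<in> keys z")
          case True
          then show False using max lt by blast
        next
          case False
          then have "ka \<in> keys (hw i)" "ka \<noteq> la" using key[OF ka(1)] by auto
          then have "lexless l (conf l s ka) (conf l s la)" using hw(3)[OF i(1)] i(2) by auto
          then have "lexless l (conf l s la) (conf l s la)"
            using lexless_trans[OF maya maya lt] la kz ka(1) kz' by blast
          then show False using lexless_irrefl by blast
        qed
      qed
      moreover have "la \<in> lower z" using la kz by (auto simp: lower_def)
      ultimately show ?thesis using sub by blast
    qed
    then have "card (lower z') < card (lower z)" by (rule psubset_card_mono[OF finite_lower])
    ultimately obtain c where c: "keys c \<subseteq> I" "z' = lext hw c" using less.hyps by blast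
    have "z = lext hw (c + single i a)" by (simp add: lin_add[OF lin_lext] c(2)[symmetric] z'_def)
    moreover have "keys (c + single i a) \<subseteq> I" using c(1) i(1) by (intro keys_subset_add) auto
    ultimately show ?thesis by blast
  qed
qed

end

theorem theorem6p6:
  fixes l :: nat and s :: "int list"
  assumes "l \<ge> 1" and "s \<in> multicharges l"
  shows "(\<forall>v\<in>multicharges l. irreducible_highest_weight (V_infty l v) (Lambda_weight v)) \<and>
    uq_isomorphic (Fock l s)
      (uq_direct_sum (SIGMA v:multicharges l. {..<K_mult l s v}) (\<lambda>(v, i). V_infty l v))"
proof
  show "\<forall>v\<in>multicharges l. irreducible_highest_weight (V_infty l v) (Lambda_weight v)"
    using V_infty_irreducible multicharges_length by blast
  let ?I = "SIGMA v:multicharges l. {..<K_mult l s v}"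
  have lead: "finite (leading l s v) \<and> card (leading l s v) = K_mult l s v" if "v \<in> multicharges l" for v
    by (rule leading_K_mult[OF assms(1) that])
  have "\<exists>h. bij_betw h {..<K_mult l s v} (leading l s v)" if "v \<in> multicharges l" for v
    using ex_bij_betw_nat_finite[of "leading l s v"] lead[OF that] by (simp add: atLeast0LessThan)
  then obtain h where h: "\<And>v. v \<in> multicharges l \<Longrightarrow> bij_betw (h v) {..<K_mult l s v} (leading l s v)"
    by metis
  \<comment> \<open>\<open>\<theta>\<close> lists the dominant multipartitions by weight; these will be the leading terms of the
    singular vectors \<open>hw\<close>.\<close>
  define \<theta> where "\<theta> = (\<lambda>(v, i). h v i)"
  have \<theta>_in: "\<theta> (v, i) \<in> leading l s v" if "(v, i) \<in> ?I" for v i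
    using that bij_betwE[OF h[of v]] by (auto simp: \<theta>_def)
  have inj: "inj_on \<theta> ?I"
  proof (rule inj_onI)
    fix x y assume x: "x \<in> ?I" and y: "y \<in> ?I" and eq: "\<theta> x = \<theta> y"
    obtain v i w k where xy: "x = (v, i)" "y = (w, k)" by (cases x; cases y)
    have "\<theta> x \<in> leading l s v" "\<theta> y \<in> leading l s w" using \<theta>_in x y unfolding xy by blast+
    then have "occ_of v = occ_of w" unfolding eq by (auto simp: leading_def)
    then have vw: "v = w" using occ_of_inject x y xy by auto
    then have "i = k"
      using bij_betw_imp_inj_on[OF h[of v]] x y eq unfolding xy inj_on_def \<theta>_def by auto
    then show "x = y" using vw xy by simp
  qed
  have image: "\<theta> ` ?I = {la \<in> multipartitions l. dominant l (conf l s la)}"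
  proof
    show "\<theta> ` ?I \<subseteq> {la \<in> multipartitions l. dominant l (conf l s la)}"
      using \<theta>_in by (fastforce simp: leading_def)
    show "{la \<in> multipartitions l. dominant l (conf l s la)} \<subseteq> \<theta> ` ?I"
    proof
      fix la assume la: "la \<in> {la \<in> multipartitions l. dominant l (conf l s la)}"
      then obtain v where v: "v \<in> multicharges l" "occ l (conf l s la) = occ_of v"
        using occ_of_exists[OF conf_maya] by blast
      then have "la \<in> leading l s v" using la by (simp add: leading_def)
      then obtain i where "i < K_mult l s v" "la = h v i"
        using bij_betw_imp_surj_on[OF h[OF v(1)]] by blast
      then show "la \<in> \<theta> ` ?I" using v(1) by (intro image_eqI[of _ _ "(v, i)"]) (auto simp: \<theta>_def)
    qed
  qed
  define good where "good la x \<longleftrightarrow> fock.singular l s x \<and> lookup x la \<noteq> 0 \<and>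
    (\<forall>mu\<in>keys x. (mu \<noteq> la \<longrightarrow> lexless l (conf l s mu) (conf l s la)) \<and> occ l (conf l s mu) = occ l (conf l s la))"
    for la and x :: fock
  have "\<exists>x. good la x" if "la \<in> multipartitions l" "dominant l (conf l s la)" for la
    unfolding good_def by (rule singular_with_leading_term[OF that])
  then obtain X where X: "\<And>la. la \<in> multipartitions l \<Longrightarrow> dominant l (conf l s la) \<Longrightarrow> good la (X la)"
    by metis
  define hw where "hw i = X (\<theta> i)" for i
  have good: "good (\<theta> i) (hw i)" if "i \<in> ?I" for i
  proof -
    have "\<theta> i \<in> {la \<in> multipartitions l. dominant l (conf l s la)}" using that image by blast
    then show ?thesis unfolding hw_def using X by blast
  qed
  have g: "fock.singular l s (hw i)" "lookup (hw i) (\<theta> i) \<noteq> 0"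
    "mu \<in> keys (hw i) \<Longrightarrow> mu \<noteq> \<theta> i \<Longrightarrow> lexless l (conf l s mu) (conf l s (\<theta> i))"
    "mu \<in> keys (hw i) \<Longrightarrow> occ l (conf l s mu) = occ l (conf l s (\<theta> i))" if "i \<in> ?I" for i mu
    using good[OF that] unfolding good_def by blast+
  have weight: "fock.singular_of_weight l s (Lambda_weight v) (hw (v, i))" if vi: "(v, i) \<in> ?I" for v i
  proof -
    have "(\<lambda>j. N_total l s j mu) = Lambda_weight v" if mu: "mu \<in> keys (hw (v, i))" for mu
    proof
      fix j
      have "mu \<in> multipartitions l" using g(1)[OF vi] mu by (auto simp: fock.singular_def)
      moreover have "occ l (conf l s mu) = occ_of v"
        using g(4)[OF vi mu] \<theta>_in[OF vi] by (simp add: leading_def)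
      ultimately show "N_total l s j mu = Lambda_weight v j"
        by (simp add: N_total_conf wtE_occ Lambda_weight_occ_of)
    qed
    then show ?thesis using g(1)[OF vi] by (simp add: fock.singular_of_weight_def)
  qed
  have "uq_isomorphic (fock.rep l s) (uq_direct_sum ?I (\<lambda>(v, i). V_infty l v))"
  proof (rule decomposition_from_singular_basis[where hw = hw and vac = "\<lambda>_. vacuum l"
        and \<Lambda> = "\<lambda>(v, i). Lambda_weight v" and B' = "\<lambda>_. multipartitions l"
        and e' = "\<lambda>(v, i). uq_e (Fock l v)" and f' = "\<lambda>(v, i). uq_f (Fock l v)"
        and wt' = "\<lambda>(v, i) la j. N_total l v j la" and deg' = "\<lambda>_ la. card (nodes la)"
        and deg = "\<lambda>la. card (nodes la)"])
    show "graded_contravariant (multipartitions l) (uq_e (Fock l s)) (uq_f (Fock l s))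
        (\<lambda>la j. N_total l s j la) (\<lambda>la. card (nodes la))" by (rule graded_contravariant_Fock)
    show "c = 0" if "keys c \<subseteq> ?I" "lext hw c = 0" for c :: "(int list \<times> nat) \<Rightarrow>\<^sub>0 ratfun"
      by (rule hw_independent[OF inj image g that])
    show "\<exists>c. keys c \<subseteq> ?I \<and> z = lext hw c" if "fock.singular l s z" for z
      by (rule hw_spanning[OF inj image g that])
    show "vector_space (uq_scale (case i of (v, i) \<Rightarrow> V_infty l v))" for i
      by (cases i) (simp add: V_infty_def Fock_def fock_scale_eq vector_space_sc)
  next
    fix i assume i: "i \<in> ?I"
    obtain v k where vk: "i = (v, k)" by (cases i)
    have len: "length v = l" using i vk multicharges_length by auto
    show "graded_contravariant (multipartitions l) (case i of (v, i) \<Rightarrow> uq_e (Fock l v))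
        (case i of (v, i) \<Rightarrow> uq_f (Fock l v)) (case i of (v, i) \<Rightarrow> \<lambda>la j. N_total l v j la)
        (\<lambda>la. card (nodes la))"
      unfolding vk by (simp add: graded_contravariant_Fock)
    show "contravariant.singular_of_weight (multipartitions l) (case i of (v, i) \<Rightarrow> uq_e (Fock l v))
        (case i of (v, i) \<Rightarrow> \<lambda>la j. N_total l v j la) (case i of (v, i) \<Rightarrow> Lambda_weight v) (vacuum l)"
      unfolding vk using vacuum_singular(1)[OF len] by simp
    show "vacuum l \<noteq> 0" by (rule vacuum_singular(2)[OF len])
    show "fock.singular_of_weight l s (case i of (v, i) \<Rightarrow> Lambda_weight v) (hw i)"
      using weight[of v k] i unfolding vk by simp
    show "(case i of (v, i) \<Rightarrow> V_infty l v) = (contravariant.rep (multipartitions l)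
        (case i of (v, i) \<Rightarrow> uq_e (Fock l v)) (case i of (v, i) \<Rightarrow> uq_f (Fock l v))
        (case i of (v, i) \<Rightarrow> \<lambda>la j. N_total l v j la))
        \<lparr>uq_carrier := range (contravariant.ev (case i of (v, i) \<Rightarrow> uq_f (Fock l v)) (vacuum l))\<rparr>"
      unfolding vk using V_infty_eq[OF len] by simp
  qed
  then show "uq_isomorphic (Fock l s) (uq_direct_sum ?I (\<lambda>(v, i). V_infty l v))"
    unfolding fock_rep .
qed

end
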